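(* Let $(A,\{\Delta(\lambda)\}_{\lambda\in\Lambda})$ be a split quasi-hereditary algebra over a commutative Noetherian ring $R$, with costandard modules $\nabla(\lambda)$. Assume there are modules $T(\lambda)$ and $Q(\lambda)$, $\lambda\in\Lambda$, with exact sequences $$0\to\Delta(\lambda)\to T(\lambda)\to X(\lambda)\to0,\qquad 0\to Y(\lambda)\to T(\lambda)\to\nabla(\lambda)\to0,$$ $$0\to\Delta(\lambda)\to Q(\lambda)\to X'(\lambda)\to0,\qquad 0\to Y'(\lambda)\to Q(\lambda)\to\nabla(\lambda)\to0,$$ where $X(\lambda),X'(\lambda)\in\mathcal{F}(\tilde\Delta_{\mu<\lambda})$ and $Y(\lambda),Y'(\lambda)\in\mathcal{F}(\tilde\nabla_{\mu<\lambda})$. Let $T=\bigoplus_{\lambda\in\Lambda}T(\lambda)$ and $Q=\bigoplus_{\lambda\in\Lambda}Q(\lambda)$. Then $\operatorname{add}_AT=\operatorname{add}_AQ$. Further, $\operatorname{End}_A(T)^{op}$ and $\operatorname{End}_A(Q)^{op}$ are Morita equivalent.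
   Context: Let $R$ be a commutative Noetherian ring with identity. A projective Noetherian $R$-algebra is an $R$-algebra that is finitely generated and projective as an $R$-module. $A\text{-mod}$ denotes finitely generated left $A$-modules, $A\text{-proj}$ (resp. $R\text{-proj}$) the finitely generated projective ones, $\operatorname{add}_A M$ the full subcategory of direct summands of finite direct sums of copies of $M$, $D=\operatorname{Hom}_R(-,R)\colon A\text{-mod}\to A^{op}\text{-mod}$. For a set $\theta$ of $A$-modules, $\mathcal{F}(\theta)$ is the full subcategory of $A\text{-mod}$ of modules admitting a finite filtration with successive quotients (isomorphic to modules) in $\theta$ (including the zero module). Split quasi-hereditary: a projective Noetherian $R$-algebra $A$ with a collection $\{\Delta(\lambda)\colon\lambda\in\Lambda\}$ in $A\text{-mod}$ indexed by a finite poset $\Lambda$ is split quasi-hereditary if: (i) each $\Delta(\lambda)$ is projective over $R$; (ii) $\operatorname{Hom}_A(\Delta(\lambda),\Delta(\mu))\neq0$ implies $\lambda\le\mu$; (iii) $\operatorname{End}_A(\Delta(\lambda))\simeq R$; (iv) for each $\lambda$ there is $P(\lambda)\in A\text{-proj}$ and an exact sequence $0\to C(\lambda)\to P(\lambda)\to\Delta(\lambda)\to0$ such that $C(\lambda)$ has a finite filtration by modules $\Delta(\mu)\otimes_R U_\mu$ with $U_\mu\in R\text{-proj}$, $\mu>\lambda$; (v) $\operatorname{add}_A(\bigoplus_{\lambda}P(\lambda))=A\text{-proj}$. The costandard modules $\{\nabla(\lambda)\}_{\lambda\in\Lambda}$ are the $A$-modules, unique up to isomorphism, such that $(A^{op},\{D\nabla(\lambda)\}_{\lambda\in\Lambda})$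 is split quasi-hereditary (same poset) and $\operatorname{Ext}_A^i(\Delta(\lambda),\nabla(\beta))$ is $R$ if $i=0$ and $\lambda=\beta$, and $0$ otherwise. Put $\tilde\Delta_{\mu<\lambda}=\{\Delta(\mu)\otimes_R U\colon \mu\in\Lambda,\ \mu<\lambda,\ U\in R\text{-proj}\}$ and $\tilde\nabla_{\mu<\lambda}=\{\nabla(\mu)\otimes_R U\colon \mu\in\Lambda,\ \mu<\lambda,\ U\in R\text{-proj}\}$. *)

theory Defs
  imports
    "HOL-Algebra.Module"
    "HOL-Algebra.Ring_Divisibility"
    "HOL-Algebra.Generated_Groups"
    "HOL-Library.FuncSet"
    "HOL-Library.Poly_Mapping"
    "HOL-Library.Infinite_Typeclass"
begin

section \<open>Left modules over a ring\<close>

text \<open>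
  The locale \<open>module\<close> of HOL-Algebra is restricted to commutative scalars; here the same axioms are
  imposed over an arbitrary ring. The record type \<open>('a, 'm) module\<close> is reused; its fields
  \<open>mult\<close> and \<open>one\<close> are meaningless for a module and are never consulted. An associative
  \<open>R\<close>-algebra is an element of \<open>('r, 'a) module\<close> for which they are meaningful, so it is at
  the same time a ring and an \<open>R\<close>-module.
\<close>

locale left_module = A?: ring A + M?: abelian_group M
  for A :: "('a, 'q) ring_scheme" and M :: "('a, 'm) module" (structure) +
  assumes smult_closed:
      "\<lbrakk>a \<in> carrier A; x \<in> carrier M\<rbrakk> \<Longrightarrow> a \<odot>\<^bsub>M\<^esub> x \<in> carrier M"
    and smult_l_distr:
      "\<lbrakk>a \<in> carrier A; b \<in> carrier A; x \<in> carrier M\<rbrakk>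
        \<Longrightarrow> (a \<oplus>\<^bsub>A\<^esub> b) \<odot>\<^bsub>M\<^esub> x = a \<odot>\<^bsub>M\<^esub> x \<oplus>\<^bsub>M\<^esub> b \<odot>\<^bsub>M\<^esub> x"
    and smult_r_distr:
      "\<lbrakk>a \<in> carrier A; x \<in> carrier M; y \<in> carrier M\<rbrakk>
        \<Longrightarrow> a \<odot>\<^bsub>M\<^esub> (x \<oplus>\<^bsub>M\<^esub> y) = a \<odot>\<^bsub>M\<^esub> x \<oplus>\<^bsub>M\<^esub> a \<odot>\<^bsub>M\<^esub> y"
    and smult_assoc:
      "\<lbrakk>a \<in> carrier A; b \<in> carrier A; x \<in> carrier M\<rbrakk>
        \<Longrightarrow> (a \<otimes>\<^bsub>A\<^esub> b) \<odot>\<^bsub>M\<^esub> x = a \<odot>\<^bsub>M\<^esub> (b \<odot>\<^bsub>M\<^esub> x)"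
    and smult_one: "x \<in> carrier M \<Longrightarrow> \<one>\<^bsub>A\<^esub> \<odot>\<^bsub>M\<^esub> x = x"

text \<open>Homomorphisms are extensional, so that equality of morphisms is equality in HOL.\<close>

definition mod_hom ::
    "('a, 'q) ring_scheme \<Rightarrow> ('a, 'm) module \<Rightarrow> ('a, 'n) module \<Rightarrow> ('m \<Rightarrow> 'n) set" where
  "mod_hom A M N = {f \<in> carrier M \<rightarrow>\<^sub>E carrier N.
     (\<forall>x\<in>carrier M. \<forall>y\<in>carrier M. f (x \<oplus>\<^bsub>M\<^esub> y) = f x \<oplus>\<^bsub>N\<^esub> f y) \<and>
     (\<forall>a\<in>carrier A. \<forall>x\<in>carrier M. f (a \<odot>\<^bsub>M\<^esub> x) = a \<odot>\<^bsub>N\<^esub> f x)}"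

definition mod_iso ::
    "('a, 'q) ring_scheme \<Rightarrow> ('a, 'm) module \<Rightarrow> ('a, 'n) module \<Rightarrow> ('m \<Rightarrow> 'n) set" where
  "mod_iso A M N = {f \<in> mod_hom A M N. bij_betw f (carrier M) (carrier N)}"

definition mod_isomorphic ::
    "('a, 'q) ring_scheme \<Rightarrow> ('a, 'm) module \<Rightarrow> ('a, 'n) module \<Rightarrow> bool" where
  "mod_isomorphic A M N \<longleftrightarrow> mod_iso A M N \<noteq> {}"

definition zero_hom :: "('a, 'm) module \<Rightarrow> ('a, 'n) module \<Rightarrow> 'm \<Rightarrow> 'n" where
  "zero_hom M N = (\<lambda>x\<in>carrier M. \<zero>\<^bsub>N\<^esub>)"

definition short_exact ::
    "('a, 'q) ring_scheme \<Rightarrow> ('a, 'l) module \<Rightarrow> ('a, 'm) module \<Rightarrow> ('a, 'n) module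
      \<Rightarrow> ('l \<Rightarrow> 'm) \<Rightarrow> ('m \<Rightarrow> 'n) \<Rightarrow> bool" where
  "short_exact A L M N f g \<longleftrightarrow>
     left_module A L \<and> left_module A M \<and> left_module A N \<and>
     f \<in> mod_hom A L M \<and> g \<in> mod_hom A M N \<and>
     inj_on f (carrier L) \<and> f ` carrier L = a_kernel M N g \<and> g ` carrier M = carrier N"

definition fg_module :: "('a, 'q) ring_scheme \<Rightarrow> ('a, 'm) module \<Rightarrow> bool" where
  "fg_module A M \<longleftrightarrow> left_module A M \<and>
     (\<exists>S. finite S \<and> S \<subseteq> carrier M \<and> (\<forall>H. submodule H A M \<and> S \<subseteq> H \<longrightarrow> H = carrier M))"

definition regular_module :: "('a, 'q) ring_scheme \<Rightarrow> ('a, 'a) module" where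
  "regular_module A = \<lparr>carrier = carrier A, mult = mult A, one = \<one>\<^bsub>A\<^esub>,
     zero = \<zero>\<^bsub>A\<^esub>, add = add A, smult = mult A\<rparr>"

text \<open>
  The product of a family, which is the direct sum for a finite index set (the only case used).
\<close>

definition direct_sum :: "'i set \<Rightarrow> ('i \<Rightarrow> ('a, 'm) module) \<Rightarrow> ('a, 'i \<Rightarrow> 'm) module" where
  "direct_sum I M = \<lparr>carrier = (\<Pi>\<^sub>E i\<in>I. carrier (M i)), mult = undefined, one = undefined,
     zero = (\<lambda>i\<in>I. \<zero>\<^bsub>M i\<^esub>), add = (\<lambda>x y. \<lambda>i\<in>I. x i \<oplus>\<^bsub>M i\<^esub> y i),
     smult = (\<lambda>a x. \<lambda>i\<in>I. a \<odot>\<^bsub>M i\<^esub> x i)\<rparr>"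

definition copies :: "nat \<Rightarrow> ('a, 'm) module \<Rightarrow> ('a, nat \<Rightarrow> 'm) module" where
  "copies n M = direct_sum {..<n} (\<lambda>_. M)"

definition direct_summand ::
    "('a, 'q) ring_scheme \<Rightarrow> ('a, 'm) module \<Rightarrow> ('a, 'n) module \<Rightarrow> bool" where
  "direct_summand A N M \<longleftrightarrow>
     (\<exists>i\<in>mod_hom A N M. \<exists>p\<in>mod_hom A M N. \<forall>x\<in>carrier N. p (i x) = x)"

text \<open>
  \<open>add_A M\<close>, as the class of its objects with elements in an arbitrary type \<open>'n\<close>.
\<close>

definition add_closure ::
    "('a, 'q) ring_scheme \<Rightarrow> ('a, 'm) module \<Rightarrow> ('a, 'n) module set" where
  "add_closure A M = {N. left_module A N \<and> (\<exists>n. direct_summand A N (copies n M))}"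

text \<open>
  Finitely generated projective modules: direct summands of finitely generated free modules. Each
  is isomorphic to one whose elements lie in \<open>A\<^sup>n\<close>, hence in the type \<open>nat \<Rightarrow> 'a\<close>.
  Wherever a finitely generated projective module is bound inside a definition below, it is taken
  with elements in this type, without loss of generality.
\<close>

definition fg_projective :: "('a, 'q) ring_scheme \<Rightarrow> ('a, 'm) module \<Rightarrow> bool" where
  "fg_projective A P \<longleftrightarrow>
     left_module A P \<and> (\<exists>n. direct_summand A P (copies n (regular_module A)))"

text \<open>
  A scalar acts on a coset \<open>C\<close> by \<open>a (H + c) = H + a c\<close>. The definition only uses the
  operations of \<open>M\<close>, so it can be applied below to a representative structure in which the
  module axioms hold only modulo \<open>H\<close>.
\<close>

definition quotient_module :: "('a, 'm) module \<Rightarrow> 'm set \<Rightarrow> ('a, 'm set) module" where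
  "quotient_module M H = \<lparr>carrier = a_rcosets\<^bsub>M\<^esub> H, mult = undefined, one = undefined,
     zero = H, add = (\<lambda>C D. C <+>\<^bsub>M\<^esub> D),
     smult = (\<lambda>a C. \<Union>c\<in>C. H +>\<^bsub>M\<^esub> (a \<odot>\<^bsub>M\<^esub> c))\<rparr>"

definition filtered ::
    "('a, 'q) ring_scheme \<Rightarrow> ('a, 't) module set \<Rightarrow> ('a, 'm) module set" where
  "filtered A \<theta> = {M. left_module A M \<and>
     (\<exists>n F. F 0 = {\<zero>\<^bsub>M\<^esub>} \<and> F n = carrier M \<and>
        (\<forall>i\<le>n. submodule (F i) A M) \<and>
        (\<forall>i<n. F i \<subseteq> F (Suc i) \<and>
           (\<exists>X\<in>\<theta>. mod_isomorphic A (quotient_module (M\<lparr>carrier := F (Suc i)\<rparr>) (F i)) X)))}"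


section \<open>Algebras over a commutative ring\<close>

locale assoc_algebra = R?: cring R + A?: ring A + left_module R A
  for R :: "('r, 'z) ring_scheme" and A :: "('r, 'a) module" (structure) +
  assumes smult_mult_left:
      "\<lbrakk>r \<in> carrier R; x \<in> carrier A; y \<in> carrier A\<rbrakk>
        \<Longrightarrow> (r \<odot>\<^bsub>A\<^esub> x) \<otimes>\<^bsub>A\<^esub> y = r \<odot>\<^bsub>A\<^esub> (x \<otimes>\<^bsub>A\<^esub> y)"
    and smult_mult_right:
      "\<lbrakk>r \<in> carrier R; x \<in> carrier A; y \<in> carrier A\<rbrakk>
        \<Longrightarrow> x \<otimes>\<^bsub>A\<^esub> (r \<odot>\<^bsub>A\<^esub> y) = r \<odot>\<^bsub>A\<^esub> (x \<otimes>\<^bsub>A\<^esub> y)"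

definition projective_noetherian_algebra ::
    "('r, 'z) ring_scheme \<Rightarrow> ('r, 'a) module \<Rightarrow> bool" where
  "projective_noetherian_algebra R A \<longleftrightarrow>
     cring R \<and> noetherian_ring R \<and> assoc_algebra R A \<and> fg_projective R A"

definition opposite :: "('r, 'a) module \<Rightarrow> ('r, 'a) module" where
  "opposite A = A\<lparr>mult := (\<lambda>x y. y \<otimes>\<^bsub>A\<^esub> x)\<rparr>"

definition algebra_isomorphic ::
    "('r, 'z) ring_scheme \<Rightarrow> ('r, 'a) module \<Rightarrow> ('r, 'b) module \<Rightarrow> bool" where
  "algebra_isomorphic R A B \<longleftrightarrow>
     (\<exists>h\<in>ring_iso A B. \<forall>r\<in>carrier R. \<forall>x\<in>carrier A. h (r \<odot>\<^bsub>A\<^esub> x) = r \<odot>\<^bsub>B\<^esub> h x)"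

text \<open>The \<open>R\<close>-module underlying an \<open>A\<close>-module.\<close>

definition restrict_scalars :: "('r, 'a) module \<Rightarrow> ('a, 'm) module \<Rightarrow> ('r, 'm) module" where
  "restrict_scalars A M = \<lparr>carrier = carrier M, mult = mult M, one = \<one>\<^bsub>M\<^esub>,
     zero = \<zero>\<^bsub>M\<^esub>, add = add M, smult = (\<lambda>r x. (r \<odot>\<^bsub>A\<^esub> \<one>\<^bsub>A\<^esub>) \<odot>\<^bsub>M\<^esub> x)\<rparr>"

definition hom_module ::
    "('r, 'a) module \<Rightarrow> ('a, 'm) module \<Rightarrow> ('a, 'n) module \<Rightarrow> ('r, 'm \<Rightarrow> 'n) module" where
  "hom_module A M N = \<lparr>carrier = mod_hom A M N, mult = undefined, one = undefined,
     zero = zero_hom M N, add = (\<lambda>f g. \<lambda>x\<in>carrier M. f x \<oplus>\<^bsub>N\<^esub> g x),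
     smult = (\<lambda>r f. \<lambda>x\<in>carrier M. (r \<odot>\<^bsub>A\<^esub> \<one>\<^bsub>A\<^esub>) \<odot>\<^bsub>N\<^esub> f x)\<rparr>"

definition End_algebra :: "('r, 'a) module \<Rightarrow> ('a, 'm) module \<Rightarrow> ('r, 'm \<Rightarrow> 'm) module" where
  "End_algebra A M = (hom_module A M M)
     \<lparr>mult := (\<lambda>f g. compose (carrier M) f g), one := (\<lambda>x\<in>carrier M. x)\<rparr>"

text \<open>
  \<open>Hom_R(M, R)\<close>, with the action of \<open>A\<^sup>o\<^sup>p\<close> by precomposition.
\<close>

definition dual_module ::
    "('r, 'z) ring_scheme \<Rightarrow> ('r, 'a) module \<Rightarrow> ('a, 'm) module \<Rightarrow> ('a, 'm \<Rightarrow> 'r) module" where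
  "dual_module R A M = \<lparr>carrier = mod_hom R (restrict_scalars A M) (regular_module R),
     mult = undefined, one = undefined, zero = (\<lambda>x\<in>carrier M. \<zero>\<^bsub>R\<^esub>),
     add = (\<lambda>f g. \<lambda>x\<in>carrier M. f x \<oplus>\<^bsub>R\<^esub> g x),
     smult = (\<lambda>a f. \<lambda>x\<in>carrier M. f (a \<odot>\<^bsub>M\<^esub> x))\<rparr>"


subsection \<open>The tensor product over the base ring\<close>

text \<open>
  \<open>M \<otimes>\<^sub>R U\<close> is the free abelian group on \<open>M \<times> U\<close> modulo the bilinearity
  and balancing relations; \<open>A\<close> acts through the first factor on generators.
\<close>

definition tensor_free ::
    "('a, 'm) module \<Rightarrow> ('r, 'u) module \<Rightarrow> ('a, ('m \<times> 'u) \<Rightarrow>\<^sub>0 int) module" where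
  "tensor_free M U = \<lparr>carrier = {c. Poly_Mapping.keys c \<subseteq> carrier M \<times> carrier U},
     mult = undefined, one = undefined, zero = 0, add = (+),
     smult = (\<lambda>a. frag_extend (\<lambda>(x, u). frag_of (a \<odot>\<^bsub>M\<^esub> x, u)))\<rparr>"

definition tensor_relations ::
    "('r, 'z) ring_scheme \<Rightarrow> ('r, 'a) module \<Rightarrow> ('a, 'm) module \<Rightarrow> ('r, 'u) module
      \<Rightarrow> (('m \<times> 'u) \<Rightarrow>\<^sub>0 int) set" where
  "tensor_relations R A M U =
     {frag_of (x \<oplus>\<^bsub>M\<^esub> y, u) - frag_of (x, u) - frag_of (y, u) | x y u.
        x \<in> carrier M \<and> y \<in> carrier M \<and> u \<in> carrier U} \<union>
     {frag_of (x, u \<oplus>\<^bsub>U\<^esub> v) - frag_of (x, u) - frag_of (x, v) | x u v.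
        x \<in> carrier M \<and> u \<in> carrier U \<and> v \<in> carrier U} \<union>
     {frag_of ((r \<odot>\<^bsub>A\<^esub> \<one>\<^bsub>A\<^esub>) \<odot>\<^bsub>M\<^esub> x, u) - frag_of (x, r \<odot>\<^bsub>U\<^esub> u) | r x u.
        r \<in> carrier R \<and> x \<in> carrier M \<and> u \<in> carrier U}"

definition tensor ::
    "('r, 'z) ring_scheme \<Rightarrow> ('r, 'a) module \<Rightarrow> ('a, 'm) module \<Rightarrow> ('r, 'u) module
      \<Rightarrow> ('a, (('m \<times> 'u) \<Rightarrow>\<^sub>0 int) set) module" where
  "tensor R A M U = quotient_module (tensor_free M U)
     (generate (add_monoid (tensor_free M U)) (tensor_relations R A M U))"

text \<open>
  The set of modules \<open>\<Delta>(\<mu>) \<otimes>\<^sub>R U\<close> with \<open>\<mu> \<in> I\<close> and \<open>U\<close>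
  finitely generated projective over \<open>R\<close>.
\<close>

definition tensor_class ::
    "('r, 'z) ring_scheme \<Rightarrow> ('r, 'a) module \<Rightarrow> 'l set \<Rightarrow> ('l \<Rightarrow> ('a, 'm) module)
      \<Rightarrow> ('a, (('m \<times> (nat \<Rightarrow> 'r)) \<Rightarrow>\<^sub>0 int) set) module set" where
  "tensor_class R A I \<Delta> =
     {tensor R A (\<Delta> \<mu>) U | \<mu> U. \<mu> \<in> I \<and> fg_projective R (U :: ('r, nat \<Rightarrow> 'r) module)}"


subsection \<open>Ext\<close>

definition projective_resolution ::
    "('a, 'q) ring_scheme \<Rightarrow> ('a, 'm) module \<Rightarrow> (nat \<Rightarrow> ('a, 'p) module)
      \<Rightarrow> (nat \<Rightarrow> 'p \<Rightarrow> 'p) \<Rightarrow> ('p \<Rightarrow> 'm) \<Rightarrow> bool" where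
  "projective_resolution A M P d \<epsilon> \<longleftrightarrow>
     (\<forall>i. fg_projective A (P i)) \<and>
     \<epsilon> \<in> mod_hom A (P 0) M \<and> (\<forall>i. d i \<in> mod_hom A (P (Suc i)) (P i)) \<and>
     \<epsilon> ` carrier (P 0) = carrier M \<and>
     d 0 ` carrier (P (Suc 0)) = a_kernel (P 0) M \<epsilon> \<and>
     (\<forall>i. d (Suc i) ` carrier (P (Suc (Suc i))) = a_kernel (P (Suc i)) (P i) (d i))"

definition cocycles ::
    "('a, 'q) ring_scheme \<Rightarrow> (nat \<Rightarrow> ('a, 'p) module) \<Rightarrow> (nat \<Rightarrow> 'p \<Rightarrow> 'p) \<Rightarrow> ('a, 'n) module
      \<Rightarrow> nat \<Rightarrow> ('p \<Rightarrow> 'n) set" where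
  "cocycles A P d N i = {f \<in> mod_hom A (P i) N.
     compose (carrier (P (Suc i))) f (d i) = zero_hom (P (Suc i)) N}"

primrec coboundaries ::
    "('a, 'q) ring_scheme \<Rightarrow> (nat \<Rightarrow> ('a, 'p) module) \<Rightarrow> (nat \<Rightarrow> 'p \<Rightarrow> 'p) \<Rightarrow> ('a, 'n) module
      \<Rightarrow> nat \<Rightarrow> ('p \<Rightarrow> 'n) set" where
  "coboundaries A P d N 0 = {zero_hom (P 0) N}"
| "coboundaries A P d N (Suc i) =
     (\<lambda>f. compose (carrier (P (Suc i))) f (d i)) ` mod_hom A (P i) N"

text \<open>
  \<open>has_Ext R A M N i E\<close>: the \<open>R\<close>-module \<open>Ext_A^i(M, N)\<close> is isomorphic to \<open>E\<close>.
  Ext is computed from a resolution by finitely generated projectives, which exists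
  for finitely generated \<open>M\<close> because \<open>A\<close> is Noetherian; the outcome does not depend on the choice.
\<close>

definition has_Ext ::
    "('r, 'z) ring_scheme \<Rightarrow> ('r, 'a) module \<Rightarrow> ('a, 'm) module \<Rightarrow> ('a, 'n) module
      \<Rightarrow> nat \<Rightarrow> ('r, 'e) module \<Rightarrow> bool" where
  "has_Ext R A M N i E \<longleftrightarrow>
     (\<exists>(P :: nat \<Rightarrow> ('a, nat \<Rightarrow> 'a) module) d \<epsilon>. projective_resolution A M P d \<epsilon> \<and>
        mod_isomorphic R
          (quotient_module ((hom_module A (P i) N)\<lparr>carrier := cocycles A P d N i\<rparr>)
             (coboundaries A P d N i)) E)"


section \<open>Split quasi-hereditary algebras\<close>

text \<open>
  The kernel \<open>C\<close> embeds into \<open>P l\<close>, so taking its elements in the same type is no restriction.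
\<close>

definition split_quasi_hereditary ::
    "('r, 'z) ring_scheme \<Rightarrow> ('r, 'a) module \<Rightarrow> 'l::order set \<Rightarrow> ('l \<Rightarrow> ('a, 'm) module)
      \<Rightarrow> bool" where
  "split_quasi_hereditary R A \<Lambda> \<Delta> \<longleftrightarrow>
     projective_noetherian_algebra R A \<and> finite \<Lambda> \<and>
     (\<forall>l\<in>\<Lambda>. fg_module A (\<Delta> l)) \<and>
     (\<forall>l\<in>\<Lambda>. fg_projective R (restrict_scalars A (\<Delta> l))) \<and>
     (\<forall>l\<in>\<Lambda>. \<forall>m\<in>\<Lambda>. mod_hom A (\<Delta> l) (\<Delta> m) \<noteq> {zero_hom (\<Delta> l) (\<Delta> m)} \<longrightarrow> l \<le> m) \<and>
     (\<forall>l\<in>\<Lambda>. algebra_isomorphic R (End_algebra A (\<Delta> l)) (regular_module R)) \<and>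
     (\<exists>P :: 'l \<Rightarrow> ('a, nat \<Rightarrow> 'a) module.
        (\<forall>l\<in>\<Lambda>. fg_projective A (P l) \<and>
           (\<exists>(C :: ('a, nat \<Rightarrow> 'a) module) f g. short_exact A C (P l) (\<Delta> l) f g \<and>
              C \<in> filtered A (tensor_class R A {m\<in>\<Lambda>. l < m} \<Delta>))) \<and>
        add_closure A (direct_sum \<Lambda> P) =
          {N :: ('a, nat \<Rightarrow> 'a) module. fg_projective A N})"

definition costandard_modules ::
    "('r, 'z) ring_scheme \<Rightarrow> ('r, 'a) module \<Rightarrow> 'l::order set \<Rightarrow> ('l \<Rightarrow> ('a, 'm) module)
      \<Rightarrow> ('l \<Rightarrow> ('a, 'n) module) \<Rightarrow> bool" where
  "costandard_modules R A \<Lambda> \<Delta> \<Delta>' \<longleftrightarrow>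
     (\<forall>l\<in>\<Lambda>. fg_module A (\<Delta>' l)) \<and>
     split_quasi_hereditary R (opposite A) \<Lambda> (\<lambda>l. dual_module R A (\<Delta>' l)) \<and>
     (\<forall>l\<in>\<Lambda>. \<forall>m\<in>\<Lambda>. \<forall>i. has_Ext R A (\<Delta> l) (\<Delta>' m) i
        (if i = 0 \<and> l = m then regular_module R
         else (regular_module R)\<lparr>carrier := {\<zero>\<^bsub>R\<^esub>}\<rparr>))"


section \<open>Morita equivalence\<close>

text \<open>
  The category of left \<open>S\<close>-modules is represented by the modules whose elements lie in a fixed
  type \<open>'u\<close>, which plays the role of the universe. The notion is meant for infinite \<open>'u\<close>, so that
  the category is closed under finite powers, and for all such \<open>'u\<close> at once. A functor consists of an object map \<open>F\<close> and a
  morphism map \<open>F'\<close>; the latter takes source and target explicitly, since these are not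
  determined by the underlying function.
\<close>

definition module_functor ::
    "('s, 'p) ring_scheme \<Rightarrow> ('t, 'q) ring_scheme \<Rightarrow> (('s, 'u) module \<Rightarrow> ('t, 'u) module)
      \<Rightarrow> (('s, 'u) module \<Rightarrow> ('s, 'u) module \<Rightarrow> ('u \<Rightarrow> 'u) \<Rightarrow> ('u \<Rightarrow> 'u)) \<Rightarrow> bool" where
  "module_functor S T F F' \<longleftrightarrow>
     (\<forall>M. left_module S M \<longrightarrow> left_module T (F M)) \<and>
     (\<forall>M N f. left_module S M \<and> left_module S N \<and> f \<in> mod_hom S M N \<longrightarrow>
        F' M N f \<in> mod_hom T (F M) (F N)) \<and>
     (\<forall>M. left_module S M \<longrightarrow> F' M M (\<lambda>x\<in>carrier M. x) = (\<lambda>x\<in>carrier (F M). x)) \<and>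
     (\<forall>L M N f g. left_module S L \<and> left_module S M \<and> left_module S N \<and>
        f \<in> mod_hom S L M \<and> g \<in> mod_hom S M N \<longrightarrow>
        F' L N (compose (carrier L) g f) = compose (carrier (F L)) (F' M N g) (F' L M f))"

definition naturally_isomorphic_to_id ::
    "('s, 'p) ring_scheme \<Rightarrow> (('s, 'u) module \<Rightarrow> ('s, 'u) module)
      \<Rightarrow> (('s, 'u) module \<Rightarrow> ('s, 'u) module \<Rightarrow> ('u \<Rightarrow> 'u) \<Rightarrow> ('u \<Rightarrow> 'u)) \<Rightarrow> bool" where
  "naturally_isomorphic_to_id S H H' \<longleftrightarrow>
     (\<exists>\<eta>. (\<forall>M. left_module S M \<longrightarrow> \<eta> M \<in> mod_iso S M (H M)) \<and>
          (\<forall>M N f. left_module S M \<and> left_module S N \<and> f \<in> mod_hom S M N \<longrightarrow>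
             compose (carrier M) (\<eta> N) f = compose (carrier M) (H' M N f) (\<eta> M)))"

definition morita_equivalent ::
    "'u itself \<Rightarrow> ('s, 'p) ring_scheme \<Rightarrow> ('t, 'q) ring_scheme \<Rightarrow> bool" where
  "morita_equivalent U S T \<longleftrightarrow> ring S \<and> ring T \<and>
     (\<exists>(F :: ('s, 'u) module \<Rightarrow> ('t, 'u) module) F' G G'.
        module_functor S T F F' \<and> module_functor T S G G' \<and>
        naturally_isomorphic_to_id S (\<lambda>M. G (F M)) (\<lambda>M N f. G' (F M) (F N) (F' M N f)) \<and>
        naturally_isomorphic_to_id T (\<lambda>M. F (G M)) (\<lambda>M N f. F' (G M) (G N) (G' M N f)))"

end

theory Submission
  imports Defs "HOL-Algebra.Free_Abelian_Groups"
begin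

text \<open>
  The statement is a rigidity property of modules that have both a standard and a costandard
  filtration. Say that \<open>N\<close> is acyclic if \<open>Ext\<^sup>1(\<Delta>(\<mu>), N) = 0\<close> for all \<open>\<mu>\<close>. Each \<open>\<nabla>(\<nu>)\<close> is
  acyclic, and acyclicity passes to finite direct sums, direct summands and extensions. Since
  \<open>\<nabla>(\<nu>) \<otimes> U\<close> is a direct summand of a power of \<open>\<nabla>(\<nu>)\<close> (\<open>factors_of_tensor\<close>), the costandard
  filtrations make all \<open>T(\<lambda>)\<close> and \<open>Q(\<lambda>)\<close> acyclic
  (\<open>kernel_maps_extend_into_costandard_filtered\<close>). In the first variable, a map into an acyclic
  module extends over every extension whose cokernel is filtered by the modules \<open>\<Delta>(\<mu>) \<otimes> U\<close>
  (\<open>kernel_maps_extend_over_filtered\<close>).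

  Consequently the inclusions of \<open>\<Delta>(\<lambda>)\<close> extend to \<open>u : T(\<lambda>) \<rightarrow> Q(\<lambda>)\<close> and \<open>v : Q(\<lambda>) \<rightarrow> T(\<lambda>)\<close>, and
  \<open>id - v u\<close> kills \<open>\<Delta>(\<lambda>)\<close>, so it factors through \<open>X(\<lambda>)\<close>. A map from a standardly filtered module
  to an acyclic one is a finite sum of composites through modules \<open>Q(\<mu>)\<close>
  (\<open>factors_of_filtered\<close>): a layer is a direct summand of a power of some \<open>\<Delta>(\<mu>)\<close>, whose maps into
  an acyclic module extend along \<open>\<Delta>(\<mu>) \<rightarrow> Q(\<mu>)\<close>, and the factorisations obtained on the layers
  extend to the whole module because the \<open>Q(\<mu>)\<close> are acyclic.
  Hence the identity of \<open>T(\<lambda>)\<close> is a finite sum of composites through the \<open>Q(\<mu>)\<close>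
  (\<open>identity_factors_through_tilting\<close>), which says that \<open>T(\<lambda>)\<close> lies in \<open>add Q\<close>. By symmetry
  \<open>add T = add Q\<close>.

  For the second assertion, let \<open>X\<close> and \<open>Y\<close> be modules whose identities are finite sums of composites
  through each other. A left module \<open>M\<close> over \<open>End(X)\<^sup>o\<^sup>p\<close> is sent to the homomorphisms from
  \<open>Hom(X, Y)\<close> to \<open>M\<close>, on which \<open>End(Y)\<^sup>o\<^sup>p\<close> acts by composition in \<open>Y\<close>. This functor and its analogue
  with \<open>X\<close> and \<open>Y\<close> exchanged are mutually inverse equivalences (\<open>round_trip_natural\<close>). The values
  of the functor are spaces of functions; as each function is determined by finitely many values,
  they can be coded in the type in which \<open>M\<close> lives as soon as that type is infinite
  (\<open>ex_coded_hom\<close>).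
\<close>

section \<open>Linear maps and submodules\<close>

text \<open>
  In contrast to \<open>mod_hom\<close>, values outside the carrier are left open. Composites and pointwise
  sums of linear maps are then plain lambda terms, and restriction to a submodule does not change the
  function.
\<close>

definition linear_map ::
    "('a, 'q) ring_scheme \<Rightarrow> ('a, 'm) module \<Rightarrow> ('a, 'n) module \<Rightarrow> ('m \<Rightarrow> 'n) \<Rightarrow> bool" where
  "linear_map A M N f \<longleftrightarrow> f \<in> carrier M \<rightarrow> carrier N \<and>
     (\<forall>x\<in>carrier M. \<forall>y\<in>carrier M. f (x \<oplus>\<^bsub>M\<^esub> y) = f x \<oplus>\<^bsub>N\<^esub> f y) \<and>
     (\<forall>a\<in>carrier A. \<forall>x\<in>carrier M. f (a \<odot>\<^bsub>M\<^esub> x) = a \<odot>\<^bsub>N\<^esub> f x)"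

lemma linear_mapI:
  assumes "\<And>x. x \<in> carrier M \<Longrightarrow> f x \<in> carrier N"
    and "\<And>x y. \<lbrakk>x \<in> carrier M; y \<in> carrier M\<rbrakk> \<Longrightarrow> f (x \<oplus>\<^bsub>M\<^esub> y) = f x \<oplus>\<^bsub>N\<^esub> f y"
    and "\<And>a x. \<lbrakk>a \<in> carrier A; x \<in> carrier M\<rbrakk> \<Longrightarrow> f (a \<odot>\<^bsub>M\<^esub> x) = a \<odot>\<^bsub>N\<^esub> f x"
  shows "linear_map A M N f"
  using assms by (auto simp: linear_map_def)

lemma linear_map_closed: "linear_map A M N f \<Longrightarrow> x \<in> carrier M \<Longrightarrow> f x \<in> carrier N"
  by (auto simp: linear_map_def)

lemma linear_map_plus:
  "linear_map A M N f \<Longrightarrow> x \<in> carrier M \<Longrightarrow> y \<in> carrier M \<Longrightarrow> f (x \<oplus>\<^bsub>M\<^esub> y) = f x \<oplus>\<^bsub>N\<^esub> f y"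
  by (auto simp: linear_map_def)

lemma linear_map_scale:
  "linear_map A M N f \<Longrightarrow> a \<in> carrier A \<Longrightarrow> x \<in> carrier M \<Longrightarrow> f (a \<odot>\<^bsub>M\<^esub> x) = a \<odot>\<^bsub>N\<^esub> f x"
  by (auto simp: linear_map_def)

lemma mod_hom_iff: "f \<in> mod_hom A M N \<longleftrightarrow> linear_map A M N f \<and> f \<in> extensional (carrier M)"
  by (auto simp: mod_hom_def linear_map_def PiE_def)

lemma mod_hom_linear: "f \<in> mod_hom A M N \<Longrightarrow> linear_map A M N f"
  by (simp add: mod_hom_iff)

lemma linear_map_id: "linear_map A M M (\<lambda>x. x)"
  by (auto simp: linear_map_def)

lemma linear_map_comp:
  "linear_map A M N f \<Longrightarrow> linear_map A L M g \<Longrightarrow> linear_map A L N (\<lambda>x. f (g x))"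
  by (auto simp: linear_map_def Pi_iff)

lemma left_moduleD:
  assumes "left_module A M"
  shows "ring A" "abelian_group M" "abelian_monoid M"
  using assms abelian_group.axioms(1) unfolding left_module_def by blast+

lemma linear_map_cong:
  assumes "left_module A M" "linear_map A M N f" "\<And>x. x \<in> carrier M \<Longrightarrow> g x = f x"
  shows "linear_map A M N g"
proof -
  interpret left_module A M by fact
  show ?thesis using assms(2,3) by (auto simp: linear_map_def Pi_iff smult_closed)
qed

lemma linear_map_restrict:
  assumes "left_module A M" "linear_map A M N f"
  shows "restrict f (carrier M) \<in> mod_hom A M N"
  using linear_map_cong[OF assms, of "restrict f (carrier M)"] by (simp add: mod_hom_iff)

lemma (in left_module) smult_zero_right: "a \<in> carrier A \<Longrightarrow> a \<odot> \<zero> = \<zero>"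
  by (metis M.l_zero M.zero_closed M.add.l_cancel_one smult_closed smult_r_distr)

lemma (in left_module) smult_minus_right:
  "a \<in> carrier A \<Longrightarrow> x \<in> carrier M \<Longrightarrow> a \<odot> (\<ominus> x) = \<ominus> (a \<odot> x)"
  by (metis M.add.inv_closed M.l_neg M.minus_equality smult_closed smult_r_distr smult_zero_right)

lemma (in abelian_group) minus_eq_zero_iff:
  "x \<in> carrier G \<Longrightarrow> y \<in> carrier G \<Longrightarrow> x \<ominus> y = \<zero> \<longleftrightarrow> x = y"
  by (metis a_inv_closed local.minus_minus minus_eq minus_equality r_neg)

lemma (in abelian_group) minus_add_cancel:
  "x \<in> carrier G \<Longrightarrow> y \<in> carrier G \<Longrightarrow> (x \<ominus> y) \<oplus> y = x"
  by (simp add: minus_eq a_assoc l_neg)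

lemma (in abelian_group) add_minus_both:
  assumes "x \<in> carrier G" "y \<in> carrier G" shows "(x \<oplus> y) \<ominus> x \<ominus> y = \<zero>"
proof -
  have "(x \<oplus> y) \<ominus> x \<ominus> y = (x \<oplus> y) \<oplus> (\<ominus> x \<oplus> \<ominus> y)" using assms by (simp add: minus_eq a_assoc)
  also have "\<ominus> x \<oplus> \<ominus> y = \<ominus> (x \<oplus> y)" using assms by (simp add: minus_add)
  finally show ?thesis using assms by (simp add: r_neg)
qed

lemma linear_map_zero:
  assumes "abelian_group M" "abelian_group N" "linear_map A M N f"
  shows "f \<zero>\<^bsub>M\<^esub> = \<zero>\<^bsub>N\<^esub>"
proof -
  interpret M: abelian_group M by fact
  interpret N: abelian_group N by fact
  have "f \<zero>\<^bsub>M\<^esub> \<oplus>\<^bsub>N\<^esub> f \<zero>\<^bsub>M\<^esub> = f \<zero>\<^bsub>M\<^esub>"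
    using linear_map_plus[OF assms(3), of "\<zero>\<^bsub>M\<^esub>" "\<zero>\<^bsub>M\<^esub>"] by simp
  then show ?thesis using linear_map_closed[OF assms(3), of "\<zero>\<^bsub>M\<^esub>"] by simp
qed

lemma linear_map_uminus:
  assumes "abelian_group M" "abelian_group N" "linear_map A M N f" "x \<in> carrier M"
  shows "f (\<ominus>\<^bsub>M\<^esub> x) = \<ominus>\<^bsub>N\<^esub> f x"
proof -
  interpret M: abelian_group M by fact
  interpret N: abelian_group N by fact
  have "f (\<ominus>\<^bsub>M\<^esub> x) \<oplus>\<^bsub>N\<^esub> f x = \<zero>\<^bsub>N\<^esub>"
    using linear_map_plus[OF assms(3), of "\<ominus>\<^bsub>M\<^esub> x" x] linear_map_zero[OF assms(1-3)] assms(4)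
    by (simp add: M.l_neg)
  then show ?thesis using linear_map_closed[OF assms(3)] assms(4)
    by (metis M.a_inv_closed N.minus_equality)
qed

lemma linear_map_diff:
  assumes "abelian_group M" "abelian_group N" "linear_map A M N f" "x \<in> carrier M" "y \<in> carrier M"
  shows "f (x \<ominus>\<^bsub>M\<^esub> y) = f x \<ominus>\<^bsub>N\<^esub> f y"
proof -
  interpret M: abelian_group M by fact
  show ?thesis using assms linear_map_uminus[OF assms(1-3)] linear_map_plus[OF assms(3)]
    by (simp add: a_minus_def)
qed

lemma linear_map_const_zero:
  assumes "left_module A N" shows "linear_map A M N (\<lambda>x. \<zero>\<^bsub>N\<^esub>)"
proof -
  interpret left_module A N by fact
  show ?thesis by (rule linear_mapI) (auto simp: smult_zero_right)
qed

lemma linear_map_add: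
  assumes "left_module A N" "linear_map A M N f" "linear_map A M N g"
  shows "linear_map A M N (\<lambda>x. f x \<oplus>\<^bsub>N\<^esub> g x)"
proof -
  interpret left_module A N by fact
  show ?thesis using assms(2,3)
    by (auto intro!: linear_mapI simp: linear_map_def Pi_iff M.a_ac smult_r_distr)
qed

lemma linear_map_neg:
  assumes "left_module A N" "linear_map A M N f"
  shows "linear_map A M N (\<lambda>x. \<ominus>\<^bsub>N\<^esub> f x)"
proof -
  interpret left_module A N by fact
  show ?thesis using assms(2)
    by (auto intro!: linear_mapI simp: linear_map_def Pi_iff M.minus_add smult_minus_right)
qed

lemma linear_map_sub:
  assumes "left_module A N" "linear_map A M N f" "linear_map A M N g"
  shows "linear_map A M N (\<lambda>x. f x \<ominus>\<^bsub>N\<^esub> g x)"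
  unfolding a_minus_def by (intro linear_map_add linear_map_neg assms)

lemma finsum_lessThan_Suc:
  assumes "abelian_monoid N" "\<And>k. k < Suc n \<Longrightarrow> f k \<in> carrier N"
  shows "(\<Oplus>\<^bsub>N\<^esub>k\<in>{..<Suc n}. f k) = (\<Oplus>\<^bsub>N\<^esub>k\<in>{..<n}. f k) \<oplus>\<^bsub>N\<^esub> f n"
proof -
  interpret abelian_monoid N by fact
  show ?thesis using assms(2) by (simp add: lessThan_Suc finsum_insert Pi_iff a_comm)
qed

lemma linear_map_finsum:
  assumes M: "left_module A M" and N: "left_module A N"
    and f: "\<And>k. k < (n::nat) \<Longrightarrow> linear_map A M N (f k)"
  shows "linear_map A M N (\<lambda>x. \<Oplus>\<^bsub>N\<^esub>k\<in>{..<n}. f k x)"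
  using f
proof (induction n)
  case 0
  interpret left_module A N by fact
  show ?case using linear_map_const_zero[OF N] by simp
next
  case (Suc n)
  have *: "linear_map A M N (\<lambda>x. (\<Oplus>\<^bsub>N\<^esub>k\<in>{..<n}. f k x) \<oplus>\<^bsub>N\<^esub> f n x)"
    using Suc by (intro linear_map_add[OF N]) auto
  show ?case
    by (rule linear_map_cong[OF M *])
       (use Suc.prems in \<open>auto intro!: finsum_lessThan_Suc left_moduleD(3)[OF N] linear_map_closed[of A M N]\<close>)
qed

text \<open>
  Only additivity is assumed, so that the lemma also covers maps between modules over different rings.
\<close>

lemma additive_finsum:
  assumes M: "abelian_group M" and N: "abelian_group N"
    and cl: "\<And>x. x \<in> carrier M \<Longrightarrow> f x \<in> carrier N"
    and add: "\<And>x y. x \<in> carrier M \<Longrightarrow> y \<in> carrier M \<Longrightarrow> f (x \<oplus>\<^bsub>M\<^esub> y) = f x \<oplus>\<^bsub>N\<^esub> f y"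
    and x: "\<And>k. k < (n::nat) \<Longrightarrow> x k \<in> carrier M"
  shows "f (\<Oplus>\<^bsub>M\<^esub>k\<in>{..<n}. x k) = (\<Oplus>\<^bsub>N\<^esub>k\<in>{..<n}. f (x k))"
  using x
proof (induction n)
  case 0
  interpret M: abelian_group M by fact
  interpret N: abelian_group N by fact
  have "f \<zero>\<^bsub>M\<^esub> \<oplus>\<^bsub>N\<^esub> f \<zero>\<^bsub>M\<^esub> = f \<zero>\<^bsub>M\<^esub>" using add[of "\<zero>\<^bsub>M\<^esub>" "\<zero>\<^bsub>M\<^esub>"] by simp
  then show ?case using cl[of "\<zero>\<^bsub>M\<^esub>"] by simp
next
  case (Suc n)
  interpret M: abelian_group M by fact
  interpret N: abelian_group N by fact
  show ?case using Suc cl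
    by (simp add: finsum_lessThan_Suc M.abelian_monoid_axioms N.abelian_monoid_axioms add M.finsum_closed Pi_iff)
qed

lemma linear_map_of_finsum:
  assumes "abelian_group M" "abelian_group N" "linear_map A M N f" "\<And>k. k < (n::nat) \<Longrightarrow> x k \<in> carrier M"
  shows "f (\<Oplus>\<^bsub>M\<^esub>k\<in>{..<n}. x k) = (\<Oplus>\<^bsub>N\<^esub>k\<in>{..<n}. f (x k))"
  by (rule additive_finsum[OF assms(1,2) linear_map_closed[OF assms(3)] linear_map_plus[OF assms(3)] assms(4)])

lemma submodule_iff:
  assumes "left_module A M"
  shows "submodule H A M \<longleftrightarrow> H \<subseteq> carrier M \<and> \<zero>\<^bsub>M\<^esub> \<in> H \<and> (\<forall>x\<in>H. \<ominus>\<^bsub>M\<^esub> x \<in> H) \<and>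
    (\<forall>x\<in>H. \<forall>y\<in>H. x \<oplus>\<^bsub>M\<^esub> y \<in> H) \<and> (\<forall>a\<in>carrier A. \<forall>x\<in>H. a \<odot>\<^bsub>M\<^esub> x \<in> H)"
  unfolding submodule_def submodule_axioms_def subgroup_def a_inv_def[symmetric]
  by (auto simp: a_inv_def[symmetric])

lemma submoduleD:
  assumes "left_module A M" "submodule H A M"
  shows "H \<subseteq> carrier M" "\<zero>\<^bsub>M\<^esub> \<in> H" "\<And>x. x \<in> H \<Longrightarrow> \<ominus>\<^bsub>M\<^esub> x \<in> H"
    "\<And>x y. x \<in> H \<Longrightarrow> y \<in> H \<Longrightarrow> x \<oplus>\<^bsub>M\<^esub> y \<in> H" "\<And>a x. a \<in> carrier A \<Longrightarrow> x \<in> H \<Longrightarrow> a \<odot>\<^bsub>M\<^esub> x \<in> H"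
  using assms(2) unfolding submodule_iff[OF assms(1)] by auto

lemma left_module_submodule:
  assumes "left_module A M" "submodule H A M"
  shows "left_module A (M\<lparr>carrier := H\<rparr>)"
proof -
  interpret left_module A M by fact
  note D = submoduleD[OF assms]
  have inc: "x \<in> H \<Longrightarrow> x \<in> carrier M" for x using D(1) by auto
  have "abelian_group (M\<lparr>carrier := H\<rparr>)"
  proof (rule abelian_groupI, goal_cases)
    case (6 x)
    then show ?case using D(3) M.l_neg inc by auto
  qed (use D inc in \<open>auto simp: M.a_assoc intro: M.a_comm\<close>)
  then show ?thesis
    by (intro left_module.intro left_module_axioms.intro A.ring_axioms)
       (auto simp: D inc smult_l_distr smult_r_distr smult_assoc smult_one)
qed

lemma linear_map_submodule:
  assumes "linear_map A M N f" "H \<subseteq> carrier M"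
  shows "linear_map A (M\<lparr>carrier := H\<rparr>) N f"
  using assms by (auto simp: linear_map_def Pi_iff subset_iff)

lemma linear_map_into_submodule:
  assumes "linear_map A M N f" "\<And>x. x \<in> carrier M \<Longrightarrow> f x \<in> H"
  shows "linear_map A M (N\<lparr>carrier := H\<rparr>) f"
  using assms by (auto simp: linear_map_def)

lemma carrier_update_self: "(M :: ('a, 'm) module)\<lparr>carrier := carrier M\<rparr> = M"
  by (cases M) simp

lemma linear_map_inverse:
  assumes L: "left_module A L" and f: "linear_map A L M f" and inj: "inj_on f (carrier L)"
  shows "linear_map A (M\<lparr>carrier := f ` carrier L\<rparr>) L (inv_into (carrier L) f)"
proof -
  interpret left_module A L by fact
  show ?thesis
    by (rule linear_mapI)
       (auto simp: inv_into_f_f[OF inj] linear_map_plus[OF f, symmetric] linear_map_scale[OF f, symmetric] smult_closed)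
qed

lemma a_kernel_eq: "a_kernel M N f = {x \<in> carrier M. f x = \<zero>\<^bsub>N\<^esub>}"
  by (auto simp: a_kernel_def kernel_def)

lemma submodule_preimage:
  assumes M: "left_module A M" and N: "left_module A N" and f: "linear_map A M N f" and H: "submodule H A N"
  shows "submodule {x \<in> carrier M. f x \<in> H} A M"
proof -
  interpret M: left_module A M by fact
  interpret N: left_module A N by fact
  note G = left_moduleD(2)[OF M] left_moduleD(2)[OF N]
  show ?thesis unfolding submodule_iff[OF M]
    using submoduleD[OF N H] linear_map_zero[OF G f] linear_map_uminus[OF G f]
      linear_map_plus[OF f] linear_map_scale[OF f] by (auto simp: M.smult_closed)
qed

lemma submodule_zero:
  assumes "left_module A N" shows "submodule {\<zero>\<^bsub>N\<^esub>} A N"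
proof -
  interpret left_module A N by fact
  show ?thesis unfolding submodule_iff[OF assms] by (auto simp: smult_zero_right)
qed

lemma submodule_kernel:
  assumes "left_module A M" "left_module A N" "linear_map A M N f"
  shows "submodule (a_kernel M N f) A M"
  using submodule_preimage[OF assms submodule_zero[OF assms(2)]] by (simp add: a_kernel_eq)

lemma finsum_submodule:
  assumes "left_module A M" "submodule H A M" "\<And>k. k < (n::nat) \<Longrightarrow> x k \<in> H"
  shows "(\<Oplus>\<^bsub>M\<lparr>carrier := H\<rparr>\<^esub>k\<in>{..<n}. x k) = (\<Oplus>\<^bsub>M\<^esub>k\<in>{..<n}. x k)"
  using assms(3)
proof (induction n)
  case 0
  interpret M: left_module A M by fact
  interpret H: left_module A "M\<lparr>carrier := H\<rparr>" by (rule left_module_submodule[OF assms(1,2)])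
  show ?case using H.M.finsum_empty M.M.finsum_empty by simp
next
  case (Suc n)
  interpret M: left_module A M by fact
  interpret H: left_module A "M\<lparr>carrier := H\<rparr>" by (rule left_module_submodule[OF assms(1,2)])
  have "x k \<in> carrier M" if "k < Suc n" for k
    using Suc.prems[OF that] submoduleD(1)[OF assms(1,2)] by auto
  then show ?case using Suc
    by (simp add: finsum_lessThan_Suc[OF M.M.abelian_monoid_axioms] finsum_lessThan_Suc[OF H.M.abelian_monoid_axioms])
qed

text \<open>
  The universal property of the cokernel, for an arbitrary surjection in place of a quotient
  projection.
\<close>

lemma factor_over_surjection:
  assumes M: "left_module A M" and X: "left_module A X" and N: "left_module A N"
    and g: "linear_map A M X g" "g ` carrier M = carrier X"
    and h: "linear_map A M N h" "\<And>x. x \<in> a_kernel M X g \<Longrightarrow> h x = \<zero>\<^bsub>N\<^esub>"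
  obtains h' where "linear_map A X N h'" "\<And>x. x \<in> carrier M \<Longrightarrow> h' (g x) = h x"
proof -
  interpret M: left_module A M by fact
  interpret X: left_module A X by fact
  interpret N: left_module A N by fact
  note G = left_moduleD(2)[OF M] left_moduleD(2)[OF X] left_moduleD(2)[OF N]
  define s where "s = inv_into (carrier M) g"
  have s: "s x \<in> carrier M" "g (s x) = x" if "x \<in> carrier X" for x
    using that g(2) by (auto simp: s_def inv_into_into f_inv_into_f)
  have eq: "h x = h y" if "x \<in> carrier M" "y \<in> carrier M" "g x = g y" for x y
  proof -
    have "x \<ominus>\<^bsub>M\<^esub> y \<in> a_kernel M X g"
      using that linear_map_diff[OF G(1,2) g(1)] linear_map_closed[OF g(1)] by (simp add: a_kernel_eq X.M.minus_eq_zero_iff)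
    then have "h x \<ominus>\<^bsub>N\<^esub> h y = \<zero>\<^bsub>N\<^esub>" using h(2) linear_map_diff[OF G(1,3) h(1)] that by metis
    then show ?thesis using linear_map_closed[OF h(1)] that by (simp add: N.M.minus_eq_zero_iff)
  qed
  have gc: "g x \<in> carrier X" if "x \<in> carrier M" for x using linear_map_closed[OF g(1) that] .
  have val: "h (s (g x)) = h x" if "x \<in> carrier M" for x
    by (rule eq) (use that s gc in auto)
  have "linear_map A X N (\<lambda>x. h (s x))"
  proof (rule linear_mapI, goal_cases)
    case (1 x) then show ?case using s linear_map_closed[OF h(1)] by auto
  next
    case (2 x y)
    have "h (s (x \<oplus>\<^bsub>X\<^esub> y)) = h (s x \<oplus>\<^bsub>M\<^esub> s y)"
      by (rule eq) (use 2 s linear_map_plus[OF g(1)] in auto)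
    then show ?case using linear_map_plus[OF h(1)] s 2 by auto
  next
    case (3 a x)
    have "h (s (a \<odot>\<^bsub>X\<^esub> x)) = h (a \<odot>\<^bsub>M\<^esub> s x)"
      by (rule eq) (use 3 s linear_map_scale[OF g(1)] in \<open>auto simp: X.smult_closed M.smult_closed\<close>)
    then show ?case using linear_map_scale[OF h(1)] s 3 by auto
  qed
  then show ?thesis using that val by blast
qed

section \<open>Direct sums\<close>

lemma direct_sum_simps [simp]:
  "carrier (direct_sum I M) = (\<Pi>\<^sub>E i\<in>I. carrier (M i))"
  "\<zero>\<^bsub>direct_sum I M\<^esub> = (\<lambda>i\<in>I. \<zero>\<^bsub>M i\<^esub>)"
  "add (direct_sum I M) x y = (\<lambda>i\<in>I. x i \<oplus>\<^bsub>M i\<^esub> y i)"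
  "smult (direct_sum I M) a x = (\<lambda>i\<in>I. a \<odot>\<^bsub>M i\<^esub> x i)"
  by (simp_all add: direct_sum_def)

lemma left_module_direct_sum:
  assumes "ring A" "\<And>i. i \<in> I \<Longrightarrow> left_module A (M i)"
  shows "left_module A (direct_sum I M)"
proof -
  interpret A: ring A by fact
  have ab: "abelian_group (M i)" if "i \<in> I" for i using assms(2)[OF that] left_moduleD by blast
  have mon: "abelian_monoid (M i)" if "i \<in> I" for i using ab[OF that] abelian_group.axioms(1) by blast
  have "abelian_group (direct_sum I M)"
  proof (rule abelian_groupI, goal_cases)
    case (6 x)
    have "(\<lambda>i\<in>I. \<ominus>\<^bsub>M i\<^esub> x i) \<in> carrier (direct_sum I M)"
      using 6 ab by (auto simp: PiE_iff abelian_group.a_inv_closed)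
    moreover have "(\<lambda>i\<in>I. \<ominus>\<^bsub>M i\<^esub> x i) \<oplus>\<^bsub>direct_sum I M\<^esub> x = \<zero>\<^bsub>direct_sum I M\<^esub>"
      using 6 ab by (auto simp: PiE_iff fun_eq_iff abelian_group.l_neg)
    ultimately show ?case by blast
  qed (use mon in \<open>auto simp: PiE_iff fun_eq_iff extensional_def abelian_monoid.a_closed abelian_monoid.zero_closed
      abelian_monoid.a_assoc abelian_monoid.l_zero intro: abelian_monoid.a_comm\<close>)
  then show ?thesis
    using assms(2)
    by (intro left_module.intro left_module_axioms.intro A.ring_axioms)
       (auto simp: PiE_iff fun_eq_iff extensional_def left_module.smult_closed[OF assms(2)]
         left_module.smult_l_distr[OF assms(2)] left_module.smult_r_distr[OF assms(2)]
         left_module.smult_assoc[OF assms(2)] left_module.smult_one[OF assms(2)])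
qed

definition inclusion :: "'i set \<Rightarrow> ('i \<Rightarrow> ('a, 'm) module) \<Rightarrow> 'i \<Rightarrow> 'm \<Rightarrow> 'i \<Rightarrow> 'm" where
  "inclusion I M j x = (\<lambda>i\<in>I. if i = j then x else \<zero>\<^bsub>M i\<^esub>)"

lemma linear_map_inclusion:
  assumes "\<And>i. i \<in> I \<Longrightarrow> left_module A (M i)"
  shows "linear_map A (M j) (direct_sum I M) (inclusion I M j)"
proof -
  have mon: "abelian_monoid (M i)" if "i \<in> I" for i using assms[OF that] left_moduleD by blast
  show ?thesis
    using assms mon
    by (auto intro!: linear_mapI restrict_ext simp: inclusion_def fun_eq_iff abelian_monoid.zero_closed abelian_monoid.l_zero
        left_module.smult_zero_right[OF assms])
qed

lemma linear_map_projection: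
  "j \<in> I \<Longrightarrow> linear_map A (direct_sum I M) (M j) (\<lambda>x. x j)"
  by (auto intro!: linear_mapI)

lemma linear_map_into_direct_sum:
  assumes "\<And>i. i \<in> I \<Longrightarrow> linear_map A N (M i) (f i)"
  shows "linear_map A N (direct_sum I M) (\<lambda>x. \<lambda>i\<in>I. f i x)"
  using assms
  by (auto intro!: linear_mapI restrict_ext simp: linear_map_closed[OF assms] linear_map_plus[OF assms] linear_map_scale[OF assms])

lemma linear_map_from_direct_sum:
  assumes "ring A" "\<And>k. k < (n::nat) \<Longrightarrow> left_module A (M k)" "left_module A N"
    and "\<And>k. k < n \<Longrightarrow> linear_map A (M k) N (f k)"
  shows "linear_map A (direct_sum {..<n} M) N (\<lambda>x. \<Oplus>\<^bsub>N\<^esub>k\<in>{..<n}. f k (x k))"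
proof (rule linear_map_finsum[OF left_module_direct_sum[OF assms(1)] assms(3)])
  fix k assume "k < n"
  then show "linear_map A (direct_sum {..<n} M) N (\<lambda>x. f k (x k))"
    using linear_map_comp[OF assms(4) linear_map_projection[of k "{..<n}" A M]] by simp
qed (use assms(2) in auto)

lemma finsum_delta:
  assumes "abelian_monoid N" "i < (n::nat)" "x \<in> carrier N"
  shows "(\<Oplus>\<^bsub>N\<^esub>k\<in>{..<n}. if i = k then x else \<zero>\<^bsub>N\<^esub>) = x"
proof -
  interpret abelian_monoid N by fact
  show ?thesis by (rule add.finprod_singleton[of i "{..<n}" "\<lambda>k. x"]) (use assms(2,3) in auto)
qed

text \<open>
  The index set is enumerated because all finite sums below run over initial segments of the
  natural numbers.
\<close>

lemma direct_sum_expansion: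
  assumes "ring A" "\<And>i. i \<in> I \<Longrightarrow> left_module A (M i)" "bij_betw l {..<n::nat} I"
    and x: "x \<in> carrier (direct_sum I M)"
  shows "(\<Oplus>\<^bsub>direct_sum I M\<^esub>k\<in>{..<n}. inclusion I M (l k) (x (l k))) = x"
proof -
  note DS = left_module_direct_sum[OF assms(1,2)]
  have lI: "l k \<in> I" if "k < n" for k using assms(3) that by (auto simp: bij_betw_def)
  have cl: "inclusion I M (l k) (x (l k)) \<in> carrier (direct_sum I M)" if "k < n" for k
  proof (rule linear_map_closed)
    show "linear_map A (M (l k)) (direct_sum I M) (inclusion I M (l k))"
      by (rule linear_map_inclusion[OF assms(2)])
    show "x (l k) \<in> carrier (M (l k))" using x lI[OF that] by (auto simp: PiE_iff)
  qed
  have "(\<Oplus>\<^bsub>direct_sum I M\<^esub>k\<in>{..<n}. inclusion I M (l k) (x (l k))) i = x i" if i: "i \<in> I" for i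
  proof -
    interpret Mi: left_module A "M i" using assms(2) i .
    obtain j where j: "j < n" "l j = i" using assms(3) i by (auto simp: bij_betw_def)
    have inj: "i = l k \<longleftrightarrow> j = k" if "k < n" for k 
      using assms(3) j that by (auto simp: bij_betw_def inj_on_def)
    have "(\<Oplus>\<^bsub>direct_sum I M\<^esub>k\<in>{..<n}. inclusion I M (l k) (x (l k))) i
        = (\<Oplus>\<^bsub>M i\<^esub>k\<in>{..<n}. inclusion I M (l k) (x (l k)) i)"
      by (rule linear_map_of_finsum[OF left_moduleD(2)[OF DS] Mi.M.abelian_group_axioms linear_map_projection[OF i] cl])
    also have "\<dots> = (\<Oplus>\<^bsub>M i\<^esub>k\<in>{..<n}. if j = k then x i else \<zero>\<^bsub>M i\<^esub>)"
    proof (rule Mi.M.finsum_cong')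
      fix k assume "k \<in> {..<n}"
      then show "inclusion I M (l k) (x (l k)) i = (if j = k then x i else \<zero>\<^bsub>M i\<^esub>)"
        using i inj[of k] by (cases "j = k") (auto simp: inclusion_def)
    qed (use x i in \<open>auto simp: PiE_iff\<close>)
    also have "\<dots> = x i"
      by (rule finsum_delta[OF Mi.M.abelian_monoid_axioms j(1)]) (use x i in \<open>auto simp: PiE_iff\<close>)
    finally show ?thesis .
  qed
  moreover have "(\<Oplus>\<^bsub>direct_sum I M\<^esub>k\<in>{..<n}. inclusion I M (l k) (x (l k))) \<in> carrier (direct_sum I M)"
  proof -
    interpret D: left_module A "direct_sum I M" by (rule DS)
    show ?thesis using cl by (intro D.M.finsum_closed) auto
  qed
  ultimately show ?thesis using x
    by (intro extensionalityI[of _ I]) (auto simp: PiE_def)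
qed

section \<open>Maps factoring through a family of modules\<close>

text \<open>
  These maps form an ideal of the category of modules, and the identity of \<open>M\<close> belongs to it exactly
  if \<open>M\<close> is a direct summand of a finite direct sum of members of the family. Working with the ideal instead of with
  direct summands replaces constructions of objects by composition and addition of maps.
\<close>

inductive factors_through ::
    "('a, 'q) ring_scheme \<Rightarrow> 'i set \<Rightarrow> ('i \<Rightarrow> ('a, 'z) module) \<Rightarrow> ('a, 'm) module \<Rightarrow> ('a, 'n) module
      \<Rightarrow> ('m \<Rightarrow> 'n) \<Rightarrow> bool"
  for A I Z M N where
  zero: "(\<And>x. x \<in> carrier M \<Longrightarrow> h x = \<zero>\<^bsub>N\<^esub>) \<Longrightarrow> factors_through A I Z M N h"
| step: "factors_through A I Z M N h \<Longrightarrow> l \<in> I \<Longrightarrow> linear_map A M (Z l) a \<Longrightarrow> linear_map A (Z l) N b \<Longrightarrow>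
    (\<And>x. x \<in> carrier M \<Longrightarrow> h' x = h x \<oplus>\<^bsub>N\<^esub> b (a x)) \<Longrightarrow> factors_through A I Z M N h'"

lemma factors_linear:
  assumes "factors_through A I Z M N h" "left_module A M" "left_module A N"
  shows "linear_map A M N h"
  using assms(1)
proof induction
  case (zero h)
  then show ?case using linear_map_cong[OF assms(2) linear_map_const_zero[OF assms(3)]] by blast
next
  case (step h l a b h')
  show ?case
    by (rule linear_map_cong[OF assms(2) linear_map_add[OF assms(3) step(6) linear_map_comp[OF step(4,3)]] step(5)])
qed

lemma factors_cong:
  assumes "factors_through A I Z M N h" "\<And>x. x \<in> carrier M \<Longrightarrow> h' x = h x"
  shows "factors_through A I Z M N h'"
  using assms by cases (auto intro: factors_through.intros)

lemma factors_single:
  assumes "left_module A N" "l \<in> I" "linear_map A M (Z l) a" "linear_map A (Z l) N b"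
  shows "factors_through A I Z M N (\<lambda>x. b (a x))"
proof -
  interpret left_module A N by fact
  have zero: "factors_through A I Z M N (\<lambda>x. \<zero>\<^bsub>N\<^esub>)" by (rule factors_through.zero) simp
  show ?thesis
  proof (rule factors_through.step[OF zero assms(2-4)])
  fix x assume "x \<in> carrier M"
  then show "b (a x) = \<zero>\<^bsub>N\<^esub> \<oplus>\<^bsub>N\<^esub> b (a x)"
    using assms(3,4) by (simp add: linear_map_closed)
  qed
qed

lemma factors_add:
  assumes "left_module A M" "left_module A N" "factors_through A I Z M N f" "factors_through A I Z M N g"
  shows "factors_through A I Z M N (\<lambda>x. f x \<oplus>\<^bsub>N\<^esub> g x)"
  using assms(4)
proof induction
  case (zero h)
  interpret left_module A N by fact
  show ?case using zero factors_linear[OF assms(3,1,2)]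
    by (intro factors_cong[OF assms(3)]) (simp add: linear_map_closed)
next
  case (step h l a b h')
  interpret left_module A N by fact
  show ?case
  proof (rule factors_through.step[OF step.IH step.hyps(2-4)])
    fix x assume "x \<in> carrier M"
    then show "f x \<oplus>\<^bsub>N\<^esub> h' x = f x \<oplus>\<^bsub>N\<^esub> h x \<oplus>\<^bsub>N\<^esub> b (a x)"
      using step linear_map_closed[OF factors_linear[OF assms(3,1,2)]]
        linear_map_closed[OF factors_linear[OF step.hyps(1) assms(1,2)]]
      by (simp add: M.a_assoc linear_map_closed)
  qed
qed

lemma factors_comp_left:
  assumes "left_module A M" "left_module A N" "left_module A L" "factors_through A I Z M N h" "linear_map A N L f"
  shows "factors_through A I Z M L (\<lambda>x. f (h x))"
  using assms(4)
proof induction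
  case (zero h)
  then show ?case using assms by (intro factors_through.zero) (auto simp: linear_map_zero left_moduleD)
next
  case (step h l a b h')
  show ?case
  proof (rule factors_through.step[OF step.IH step.hyps(2,3) linear_map_comp[OF assms(5) step.hyps(4)]])
    fix x assume "x \<in> carrier M"
    then show "f (h' x) = f (h x) \<oplus>\<^bsub>L\<^esub> f (b (a x))"
      using step linear_map_closed[OF factors_linear[OF step.hyps(1) assms(1,2)]] assms(5)
      by (simp add: linear_map_plus linear_map_closed)
  qed
qed

lemma factors_comp_right:
  assumes "factors_through A I Z M N h" "linear_map A L M f"
  shows "factors_through A I Z L N (\<lambda>x. h (f x))"
  using assms(1)
proof induction
  case (zero h)
  then show ?case using assms by (intro factors_through.zero) (simp add: linear_map_closed)
next
  case (step h l a b h')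
  show ?case
    by (rule factors_through.step[OF step.IH step.hyps(2) linear_map_comp[OF step.hyps(3) assms(2)] step.hyps(4)])
       (use step assms in \<open>simp add: linear_map_closed\<close>)
qed

lemma factors_trans:
  assumes "left_module A M" "left_module A N" "factors_through A I Z M N h"
    and "\<And>l b. l \<in> I \<Longrightarrow> linear_map A (Z l) N b \<Longrightarrow> factors_through A J W (Z l) N b"
  shows "factors_through A J W M N h"
  using assms(3)
proof induction
  case (zero h)
  then show ?case by (rule factors_through.zero)
next
  case (step h l a b h')
  have "factors_through A J W M N (\<lambda>x. b (a x))"
    by (rule factors_comp_right[OF assms(4)[OF step.hyps(2,4)] step.hyps(3)])
  from factors_add[OF assms(1,2) step.IH this] show ?case
    by (rule factors_cong) (use step in auto)
qed

lemma factors_trans_id: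
  assumes "left_module A M" "left_module A N" "\<And>l. l \<in> I \<Longrightarrow> left_module A (Z l)"
    and "factors_through A I Z M N h" "\<And>l. l \<in> I \<Longrightarrow> factors_through A J W (Z l) (Z l) (\<lambda>x. x)"
  shows "factors_through A J W M N h"
  by (rule factors_trans[OF assms(1,2,4)])
     (use factors_comp_left[OF assms(3) assms(3) assms(2) assms(5)] in blast)

lemma factors_mono:
  assumes "factors_through A I Z M N h" "I \<subseteq> J"
  shows "factors_through A J Z M N h"
  using assms(1) by induction (use assms(2) in \<open>auto intro: factors_through.intros\<close>)

lemma factors_family:
  assumes "abelian_monoid N" "factors_through A I Z M N h"
  shows "\<exists>(n::nat) l a b. (\<forall>k<n. l k \<in> I \<and> linear_map A M (Z (l k)) (a k) \<and> linear_map A (Z (l k)) N (b k)) \<and>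
    (\<forall>x\<in>carrier M. h x = (\<Oplus>\<^bsub>N\<^esub>k\<in>{..<n}. b k (a k x)))"
  using assms(2)
proof induction
  case (zero h)
  interpret abelian_monoid N by fact
  show ?case using zero by (intro exI[of _ 0]) auto
next
  case (step h l a b h')
  interpret abelian_monoid N by fact
  obtain n :: nat and l' a' b' where
    1: "\<forall>k<n. l' k \<in> I \<and> linear_map A M (Z (l' k)) (a' k) \<and> linear_map A (Z (l' k)) N (b' k)" and
    2: "\<forall>x\<in>carrier M. h x = (\<Oplus>\<^bsub>N\<^esub>k\<in>{..<n}. b' k (a' k x))"
    using step.IH by (elim exE conjE)
  define l2 a2 b2 where defs: "l2 = l'(n := l)" "a2 = a'(n := a)" "b2 = b'(n := b)"
  have 3: "l2 k \<in> I \<and> linear_map A M (Z (l2 k)) (a2 k) \<and> linear_map A (Z (l2 k)) N (b2 k)" if "k < Suc n" for k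
    using 1 step.hyps that by (cases "k = n") (auto simp: defs)
  moreover have "h' x = (\<Oplus>\<^bsub>N\<^esub>k\<in>{..<Suc n}. b2 k (a2 k x))" if x: "x \<in> carrier M" for x
  proof -
    have cl: "b2 k (a2 k x) \<in> carrier N" if "k < Suc n" for k using 3[OF that] x by (meson linear_map_closed)
    then have "(\<Oplus>\<^bsub>N\<^esub>k\<in>{..<Suc n}. b2 k (a2 k x)) = (\<Oplus>\<^bsub>N\<^esub>k\<in>{..<n}. b2 k (a2 k x)) \<oplus>\<^bsub>N\<^esub> b2 n (a2 n x)"
      by (intro finsum_lessThan_Suc abelian_monoid_axioms)
    also have "(\<Oplus>\<^bsub>N\<^esub>k\<in>{..<n}. b2 k (a2 k x)) = (\<Oplus>\<^bsub>N\<^esub>k\<in>{..<n}. b' k (a' k x))"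
    proof (rule finsum_cong')
      show "(\<lambda>k. b' k (a' k x)) \<in> {..<n} \<rightarrow> carrier N"
      proof
        fix k assume "k \<in> {..<n}"
        then show "b' k (a' k x) \<in> carrier N" using cl[of k] by (auto simp: defs)
      qed
    qed (auto simp: defs)
    finally show ?thesis using step.hyps(5)[OF x] 2 x by (simp add: defs)
  qed
  ultimately show ?case by blast
qed

lemma factors_finsum:
  assumes M: "left_module A M" and N: "left_module A N"
    and "\<And>k. k < (n::nat) \<Longrightarrow> factors_through A I Z M N (f k)"
  shows "factors_through A I Z M N (\<lambda>x. \<Oplus>\<^bsub>N\<^esub>k\<in>{..<n}. f k x)"
  using assms(3)
proof (induction n)
  case 0
  interpret left_module A N by fact
  show ?case by (rule factors_through.zero) simp
next
  case (Suc n)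
  have "factors_through A I Z M N (\<lambda>x. (\<Oplus>\<^bsub>N\<^esub>k\<in>{..<n}. f k x) \<oplus>\<^bsub>N\<^esub> f n x)"
    using Suc by (intro factors_add[OF M N]) auto
  then show ?case
  proof (rule factors_cong)
    fix x assume "x \<in> carrier M"
    then show "(\<Oplus>\<^bsub>N\<^esub>k\<in>{..<Suc n}. f k x) = (\<Oplus>\<^bsub>N\<^esub>k\<in>{..<n}. f k x) \<oplus>\<^bsub>N\<^esub> f n x"
      using linear_map_closed[OF factors_linear[OF Suc.prems M N]]
      by (intro finsum_lessThan_Suc left_moduleD(3)[OF N])
  qed
qed

lemma factors_of_direct_summand_copies:
  assumes A: "ring A" and M: "left_module A M" and N: "left_module A N"
    and "direct_summand A N (copies n M)"
  shows "factors_through A {()} (\<lambda>_. M) N N (\<lambda>x. x)"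
proof -
  obtain i p where i: "i \<in> mod_hom A N (copies n M)" and p: "p \<in> mod_hom A (copies n M) N"
    and pi: "\<forall>x\<in>carrier N. p (i x) = x" using assms(4) by (auto simp: direct_summand_def)
  let ?D = "direct_sum {..<n} (\<lambda>_. M)"
  have D: "left_module A ?D" by (rule left_module_direct_sum[OF A M])
  note il = mod_hom_linear[OF i, unfolded copies_def] and pl = mod_hom_linear[OF p, unfolded copies_def]
  have "factors_through A {()} (\<lambda>_. M) N N (\<lambda>x. \<Oplus>\<^bsub>N\<^esub>k\<in>{..<n}. p (inclusion {..<n} (\<lambda>_. M) k (i x k)))"
  proof (rule factors_finsum[OF N N])
    fix k assume k: "k < n"
    show "factors_through A {()} (\<lambda>_. M) N N (\<lambda>x. p (inclusion {..<n} (\<lambda>_. M) k (i x k)))"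
    proof (rule factors_single[OF N])
      show "linear_map A N M (\<lambda>x. i x k)"
        by (rule linear_map_comp[OF linear_map_projection il]) (use k in simp)
      show "linear_map A M N (\<lambda>y. p (inclusion {..<n} (\<lambda>_. M) k y))"
        by (rule linear_map_comp[OF pl linear_map_inclusion[of "{..<n}" A "\<lambda>_. M" k, OF M]])
    qed simp
  qed
  then show ?thesis
  proof (rule factors_cong)
    fix x assume x: "x \<in> carrier N"
    have ix: "i x \<in> carrier ?D" using linear_map_closed[OF il x] .
    have "x = p (i x)" using pi x by simp
    also have "i x = (\<Oplus>\<^bsub>?D\<^esub>k\<in>{..<n}. inclusion {..<n} (\<lambda>_. M) k (i x k))"
      using direct_sum_expansion[OF A, of "{..<n}" "\<lambda>_. M" "\<lambda>k. k" n "i x"] M ix by (auto simp: bij_betw_def)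
    also have "p \<dots> = (\<Oplus>\<^bsub>N\<^esub>k\<in>{..<n}. p (inclusion {..<n} (\<lambda>_. M) k (i x k)))"
    proof (rule linear_map_of_finsum[OF left_moduleD(2)[OF D] left_moduleD(2)[OF N] pl])
      fix k assume "k < n"
      then show "inclusion {..<n} (\<lambda>_. M) k (i x k) \<in> carrier ?D"
        using linear_map_closed[OF linear_map_inclusion[of "{..<n}" A "\<lambda>_. M" k, OF M]] ix by (auto simp: PiE_iff)
    qed
    finally show "x = (\<Oplus>\<^bsub>N\<^esub>k\<in>{..<n}. p (inclusion {..<n} (\<lambda>_. M) k (i x k)))" .
  qed
qed

lemma direct_summand_copies_of_factors:
  assumes A: "ring A" and M: "left_module A M" and N: "left_module A N"
    and "factors_through A {()} (\<lambda>_. M) N N (\<lambda>x. x)"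
  shows "\<exists>n. direct_summand A N (copies n M)"
proof -
  obtain n :: nat and a b where
    1: "\<forall>k<n. () \<in> {()} \<and> linear_map A N M (a k) \<and> linear_map A M N (b k)" and
    2: "\<forall>x\<in>carrier N. x = (\<Oplus>\<^bsub>N\<^esub>k\<in>{..<n}. b k (a k x))"
    using factors_family[OF left_moduleD(3)[OF N] assms(4)] by auto
  have C: "left_module A (copies n M)" unfolding copies_def by (rule left_module_direct_sum[OF A M])
  define i where "i = (\<lambda>x. \<lambda>k\<in>{..<n}. a k x)"
  define p where "p = (\<lambda>y. \<Oplus>\<^bsub>N\<^esub>k\<in>{..<n}. b k (y k))"
  have i: "linear_map A N (copies n M) i"
    unfolding i_def copies_def by (rule linear_map_into_direct_sum) (use 1 in auto)
  have p: "linear_map A (copies n M) N p"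
    unfolding p_def copies_def by (rule linear_map_from_direct_sum[OF A]) (use 1 M N in auto)
  interpret N: left_module A N by fact
  have pix: "p (i x) = x" if "x \<in> carrier N" for x
  proof -
    have "x = (\<Oplus>\<^bsub>N\<^esub>k\<in>{..<n}. b k (a k x))" using 2 that by blast
    also have "\<dots> = p (i x)" unfolding p_def i_def
      by (rule N.M.finsum_cong') (use that 1 in \<open>auto simp: linear_map_closed[of A N M] linear_map_closed[of A M N]\<close>)
    finally show ?thesis by simp
  qed
  show ?thesis unfolding direct_summand_def
    by (rule exI[of _ n], rule bexI[OF _ linear_map_restrict[OF N i]], rule bexI[OF _ linear_map_restrict[OF C p]])
       (use pix linear_map_closed[OF i] in auto)
qed

text \<open>
  The identity of \<open>N\<close> is a sum of \<open>n\<close> composites through \<open>M\<close> exactly if the maps into \<open>M\<close>, taken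
  together as a map into \<open>M\<^sup>n\<close>, are split by the maps out of \<open>M\<close>.
\<close>

lemma direct_summand_copies_iff:
  assumes "ring A" "left_module A M" "left_module A N"
  shows "(\<exists>n. direct_summand A N (copies n M)) \<longleftrightarrow> factors_through A {()} (\<lambda>_. M) N N (\<lambda>x. x)"
  using factors_of_direct_summand_copies[OF assms] direct_summand_copies_of_factors[OF assms] by blast

lemma factors_direct_sum_summands:
  assumes A: "ring A" and I: "finite I" and M: "\<And>i. i \<in> I \<Longrightarrow> left_module A (M i)"
  shows "factors_through A I M (direct_sum I M) (direct_sum I M) (\<lambda>x. x)"
proof -
  obtain l and n :: nat where l: "bij_betw l {..<n} I" 
    using ex_bij_betw_nat_finite[OF I] by (auto simp: atLeast0LessThan)
  have D: "left_module A (direct_sum I M)" by (rule left_module_direct_sum[OF A M])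
  have "factors_through A I M (direct_sum I M) (direct_sum I M)
      (\<lambda>x. \<Oplus>\<^bsub>direct_sum I M\<^esub>k\<in>{..<n}. inclusion I M (l k) (x (l k)))"
  proof (rule factors_finsum[OF D D])
    fix k assume "k < n"
    then have lk: "l k \<in> I" using l by (auto simp: bij_betw_def)
    show "factors_through A I M (direct_sum I M) (direct_sum I M) (\<lambda>x. inclusion I M (l k) (x (l k)))"
    proof (rule factors_single[where Z = M, OF D lk])
      show "linear_map A (direct_sum I M) (M (l k)) (\<lambda>x. x (l k))" by (rule linear_map_projection[OF lk])
      show "linear_map A (M (l k)) (direct_sum I M) (inclusion I M (l k))" by (rule linear_map_inclusion[OF M])
    qed
  qed
  then show ?thesis
  proof (rule factors_cong)
    fix x assume x: "x \<in> carrier (direct_sum I M)"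
    show "x = (\<Oplus>\<^bsub>direct_sum I M\<^esub>k\<in>{..<n}. inclusion I M (l k) (x (l k)))"
      by (rule direct_sum_expansion[symmetric, OF A M l x])
  qed
qed

lemma factors_summand_direct_sum:
  assumes M: "\<And>i. i \<in> I \<Longrightarrow> left_module A (M i)" and i: "i \<in> I"
  shows "factors_through A {()} (\<lambda>_. direct_sum I M) (M i) (M i) (\<lambda>x. x)"
proof -
  have "factors_through A {()} (\<lambda>_. direct_sum I M) (M i) (M i) (\<lambda>x. (inclusion I M i x) i)"
    by (rule factors_single[OF M[OF i]])
       (use linear_map_inclusion[OF M] linear_map_projection[OF i] in auto)
  then show ?thesis by (rule factors_cong) (use i in \<open>auto simp: inclusion_def\<close>)
qed

section \<open>Lifting maps from projective modules\<close>

lemma fg_projectiveD: "fg_projective A P \<Longrightarrow> left_module A P"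
  by (simp add: fg_projective_def)

lemma regular_module_simps [simp]:
  "carrier (regular_module A) = carrier A" "\<zero>\<^bsub>regular_module A\<^esub> = \<zero>\<^bsub>A\<^esub>"
  "add (regular_module A) = add A" "smult (regular_module A) = mult A"
  by (simp_all add: regular_module_def)

lemma left_module_regular:
  assumes "ring A" shows "left_module A (regular_module A)"
proof -
  interpret A: ring A by fact
  have "abelian_group (regular_module A)"
    by (rule abelian_groupI) (auto simp: A.a_ac intro: A.l_neg intro!: bexI[of _ "\<ominus>\<^bsub>A\<^esub> x" for x])
  then show ?thesis
    by (intro left_module.intro left_module_axioms.intro A.ring_axioms)
       (auto simp: A.l_distr A.r_distr A.m_assoc)
qed

lemma linear_map_from_regular:
  assumes "left_module A M" "m \<in> carrier M"
  shows "linear_map A (regular_module A) M (\<lambda>a. a \<odot>\<^bsub>M\<^esub> m)"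
proof -
  interpret left_module A M by fact
  show ?thesis using assms(2) by (auto intro!: linear_mapI simp: smult_closed smult_l_distr smult_assoc)
qed

text \<open>
  The identity of \<open>P\<close> is a sum of composites \<open>b k \<circ> a k\<close> through the regular module. A lift is found
  by lifting the images of the elements \<open>b k 1\<close> and using the \<open>a k\<close> as coefficient functions.
\<close>

lemma fg_projective_lift:
  assumes P: "fg_projective A P" and M: "left_module A M" and D: "left_module A D"
    and q: "linear_map A M D q" "q ` carrier M = carrier D" and s: "linear_map A P D s"
  obtains t where "linear_map A P M t" "\<And>x. x \<in> carrier P \<Longrightarrow> q (t x) = s x"
proof -
  let ?R = "regular_module A"
  have PP: "left_module A P" using P by (rule fg_projectiveD)
  have A: "ring A" by (rule left_moduleD(1)[OF PP])
  interpret A: ring A by fact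
  have R: "left_module A ?R" by (rule left_module_regular[OF A])
  have "factors_through A {()} (\<lambda>_. ?R) P P (\<lambda>x. x)"
    using P unfolding fg_projective_def direct_summand_copies_iff[OF A R PP] by blast
  from factors_family[OF left_moduleD(3)[OF PP] this] obtain n :: nat and a b where
    ab: "\<forall>k<n. linear_map A P ?R (a k) \<and> linear_map A ?R P (b k)" and
    sum: "\<forall>x\<in>carrier P. x = (\<Oplus>\<^bsub>P\<^esub>k\<in>{..<n}. b k (a k x))"
    by auto
  define m where "m k = inv_into (carrier M) q (s (b k \<one>\<^bsub>A\<^esub>))" for k
  have sb: "s (b k \<one>\<^bsub>A\<^esub>) \<in> carrier D" if "k < n" for k
    using ab that linear_map_closed[OF s] linear_map_closed[of A ?R P "b k"] by auto
  have m: "m k \<in> carrier M" "q (m k) = s (b k \<one>\<^bsub>A\<^esub>)" if "k < n" for k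
    using sb[OF that] unfolding m_def q(2)[symmetric] by (auto simp: inv_into_into f_inv_into_f)
  have lin: "linear_map A P M (\<lambda>x. a k x \<odot>\<^bsub>M\<^esub> m k)" if "k < n" for k
    using linear_map_comp[OF linear_map_from_regular[OF M m(1)[OF that]]] ab that by blast
  define t where "t x = (\<Oplus>\<^bsub>M\<^esub>k\<in>{..<n}. a k x \<odot>\<^bsub>M\<^esub> m k)" for x
  have "linear_map A P M t" unfolding t_def by (rule linear_map_finsum[OF PP M lin])
  moreover have "q (t x) = s x" if x: "x \<in> carrier P" for x
  proof -
    have ax: "a k x \<in> carrier A" if "k < n" for k
      using ab that x linear_map_closed[of A P ?R "a k"] by auto
    have bx: "b k (a k x) \<in> carrier P" if "k < n" for k
      using ab that ax[OF that] linear_map_closed[of A ?R P "b k"] by auto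
    have b1: "b k \<one>\<^bsub>A\<^esub> \<in> carrier P" if "k < n" for k
      using ab that linear_map_closed[of A ?R P "b k"] by auto
    have "q (t x) = (\<Oplus>\<^bsub>D\<^esub>k\<in>{..<n}. q (a k x \<odot>\<^bsub>M\<^esub> m k))"
      unfolding t_def using linear_map_closed[OF lin] x
      by (intro linear_map_of_finsum[OF left_moduleD(2)[OF M] left_moduleD(2)[OF D] q(1)]) auto
    also have "\<dots> = (\<Oplus>\<^bsub>D\<^esub>k\<in>{..<n}. s (b k (a k x)))"
    proof (rule abelian_monoid.finsum_cong'[OF left_moduleD(3)[OF D]])
      fix k assume "k \<in> {..<n}"
      then have k: "k < n" by simp
      have "q (a k x \<odot>\<^bsub>M\<^esub> m k) = a k x \<odot>\<^bsub>D\<^esub> s (b k \<one>\<^bsub>A\<^esub>)"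
        using linear_map_scale[OF q(1) ax[OF k] m(1)[OF k]] m(2)[OF k] by simp
      also have "\<dots> = s (a k x \<odot>\<^bsub>P\<^esub> b k \<one>\<^bsub>A\<^esub>)"
        using linear_map_scale[OF s ax[OF k] b1[OF k]] by simp
      also have "a k x \<odot>\<^bsub>P\<^esub> b k \<one>\<^bsub>A\<^esub> = b k (a k x)"
        using linear_map_scale[of A ?R P "b k" "a k x" "\<one>\<^bsub>A\<^esub>"] ab k ax[OF k] by simp
      finally show "q (a k x \<odot>\<^bsub>M\<^esub> m k) = s (b k (a k x))" .
    qed (use bx linear_map_closed[OF s] in auto)
    also have "\<dots> = s (\<Oplus>\<^bsub>P\<^esub>k\<in>{..<n}. b k (a k x))"
      using bx by (intro linear_map_of_finsum[symmetric, OF left_moduleD(2)[OF PP] left_moduleD(2)[OF D] s]) auto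
    also have "\<dots> = s x" using sum x by simp
    finally show ?thesis .
  qed
  ultimately show ?thesis using that by blast
qed

section \<open>Extending maps from the kernel of a surjection\<close>

text \<open>
  If \<open>g\<close> is a surjection from a projective module, this says that \<open>Ext\<^sup>1(D, N) = 0\<close>. The form of
  the condition makes sense for every surjection \<open>g\<close>, and this is how it is applied: for arbitrary
  \<open>g\<close> it says that \<open>Hom(M, N) \<rightarrow> Hom(ker g, N)\<close> is surjective.
\<close>

definition kernel_maps_extend ::
    "('a, 'q) ring_scheme \<Rightarrow> ('a, 'm) module \<Rightarrow> ('a, 'd) module \<Rightarrow> ('m \<Rightarrow> 'd) \<Rightarrow> ('a, 'n) module \<Rightarrow> bool" where
  "kernel_maps_extend A M D g N \<longleftrightarrow>
     (\<forall>f. linear_map A (M\<lparr>carrier := a_kernel M D g\<rparr>) N f \<longrightarrow>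
        (\<exists>h. linear_map A M N h \<and> (\<forall>x\<in>a_kernel M D g. h x = f x)))"

lemma kernel_maps_extendE:
  assumes "kernel_maps_extend A M D g N" "linear_map A (M\<lparr>carrier := a_kernel M D g\<rparr>) N f"
  obtains h where "linear_map A M N h" "\<And>x. x \<in> a_kernel M D g \<Longrightarrow> h x = f x"
  using assms by (auto simp: kernel_maps_extend_def)

definition presentation ::
    "('a, 'q) ring_scheme \<Rightarrow> ('a, 'p) module \<Rightarrow> ('a, 'd) module \<Rightarrow> ('p \<Rightarrow> 'd) \<Rightarrow> bool" where
  "presentation A P D e \<longleftrightarrow> fg_projective A P \<and> linear_map A P D e \<and> e ` carrier P = carrier D"

lemma presentationD:
  assumes "presentation A P D e"
  shows "fg_projective A P" "left_module A P" "linear_map A P D e" "e ` carrier P = carrier D"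
  using assms by (auto simp: presentation_def fg_projective_def)

text \<open>
  The vanishing of \<open>Ext\<^sup>1\<close> in the first variable, passed from the modules \<open>Z l\<close> to a direct summand
  \<open>D\<close> of a finite sum of them, and from projective presentations to an arbitrary surjection onto \<open>D\<close>.
  With the identity of \<open>D\<close> written as \<open>\<Sum> p k \<circ> i k\<close>, the maps \<open>p k \<circ> e (l k)\<close> lift along \<open>g\<close> to maps
  \<open>r k\<close> into \<open>M\<close>, and \<open>f \<circ> r k\<close> extends from the kernel of \<open>e (l k)\<close> to a map \<open>s k\<close>. If \<open>y k\<close> lifts
  \<open>i k (g m)\<close>, then \<open>m - \<Sum> r k (y k)\<close> lies in the kernel of \<open>g\<close>, and
  \<open>f (m - \<Sum> r k (y k)) + \<Sum> s k (y k)\<close> does not depend on the choice of the \<open>y k\<close>.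
\<close>

lemma kernel_maps_extend_transfer:
  fixes Z :: "'i \<Rightarrow> ('a, 'z) module" and P :: "'i \<Rightarrow> ('a, 'p) module"
  assumes M: "left_module A M" and D: "left_module A D" and N: "left_module A N"
    and Z: "\<And>l. l \<in> I \<Longrightarrow> left_module A (Z l)"
    and pres: "\<And>l. l \<in> I \<Longrightarrow> presentation A (P l) (Z l) (e l)"
    and ext: "\<And>l. l \<in> I \<Longrightarrow> kernel_maps_extend A (P l) (Z l) (e l) N"
    and g: "linear_map A M D g" "g ` carrier M = carrier D"
    and D_id: "factors_through A I Z D D (\<lambda>x. x)"
  shows "kernel_maps_extend A M D g N"
  unfolding kernel_maps_extend_def
proof (intro allI impI)
  fix f assume f: "linear_map A (M\<lparr>carrier := a_kernel M D g\<rparr>) N f"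
  let ?K = "a_kernel M D g"
  interpret M: left_module A M by fact
  interpret D: left_module A D by fact
  interpret N: left_module A N by fact
  have A: "ring A" by (rule left_moduleD(1)[OF M])
  have K: "submodule ?K A M" by (rule submodule_kernel[OF M D g(1)])
  have KM: "left_module A (M\<lparr>carrier := ?K\<rparr>)" by (rule left_module_submodule[OF M K])
  note GM = left_moduleD(2)[OF M] and GD = left_moduleD(2)[OF D] and GN = left_moduleD(2)[OF N]
    and GK = left_moduleD(2)[OF KM]
  obtain n :: nat and l i p where
    ip: "\<forall>k<n. l k \<in> I \<and> linear_map A D (Z (l k)) (i k) \<and> linear_map A (Z (l k)) D (p k)" and
    sum: "\<forall>x\<in>carrier D. x = (\<Oplus>\<^bsub>D\<^esub>k\<in>{..<n}. p k (i k x))"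
    using factors_family[OF left_moduleD(3)[OF D] D_id] by auto
  have lI: "l k \<in> I" if "k < n" for k using ip that by blast
  have i: "linear_map A D (Z (l k)) (i k)" if "k < n" for k using ip that by blast
  have p: "linear_map A (Z (l k)) D (p k)" if "k < n" for k using ip that by blast
  have PP: "left_module A (P (l k))" if "k < n" for k using presentationD(2)[OF pres[OF lI[OF that]]] .
  have el: "linear_map A (P (l k)) (Z (l k)) (e (l k))" "e (l k) ` carrier (P (l k)) = carrier (Z (l k))" if "k < n" for k
    using presentationD(3,4)[OF pres[OF lI[OF that]]] .
  have "\<exists>r. linear_map A (P (l k)) M r \<and> (\<forall>y\<in>carrier (P (l k)). g (r y) = p k (e (l k) y))" if k: "k < n" for k
    using fg_projective_lift[OF presentationD(1)[OF pres[OF lI[OF k]]] M D g linear_map_comp[OF p[OF k] el(1)[OF k]]]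
    by metis
  then obtain r where r: "\<And>k. k < n \<Longrightarrow> linear_map A (P (l k)) M (r k)"
    and gr: "\<And>k y. k < n \<Longrightarrow> y \<in> carrier (P (l k)) \<Longrightarrow> g (r k y) = p k (e (l k) y)"
    by metis
  let ?L = "\<lambda>k. a_kernel (P (l k)) (Z (l k)) (e (l k))"
  have rK: "r k y \<in> ?K" if "k < n" "y \<in> ?L k" for k y
    using that gr[OF that(1)] linear_map_closed[OF r[OF that(1)]]
      linear_map_zero[OF left_moduleD(2)[OF Z[OF lI[OF that(1)]]] GD p[OF that(1)]] by (simp add: a_kernel_eq)
  have "\<exists>s. linear_map A (P (l k)) N s \<and> (\<forall>y\<in>?L k. s y = f (r k y))" if k: "k < n" for k
  proof -
    have sub: "?L k \<subseteq> carrier (P (l k))" by (auto simp: a_kernel_eq)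
    have "linear_map A ((P (l k))\<lparr>carrier := ?L k\<rparr>) (M\<lparr>carrier := ?K\<rparr>) (r k)"
      by (rule linear_map_into_submodule[OF linear_map_submodule[OF r[OF k] sub]]) (use rK[OF k] in simp)
    from linear_map_comp[OF f this] show ?thesis
      using ext[OF lI[OF k]] unfolding kernel_maps_extend_def by blast
  qed
  then obtain s where s: "\<And>k. k < n \<Longrightarrow> linear_map A (P (l k)) N (s k)"
    and sf: "\<And>k y. k < n \<Longrightarrow> y \<in> ?L k \<Longrightarrow> s k y = f (r k y)"
    by metis
  let ?E = "direct_sum {..<n} (\<lambda>k. P (l k))"
  have E: "left_module A ?E" by (rule left_module_direct_sum[OF A]) (use PP in auto)
  interpret E: left_module A ?E by (rule E)
  note GE = left_moduleD(2)[OF E]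
  define R where "R y = (\<Oplus>\<^bsub>M\<^esub>k\<in>{..<n}. r k (y k))" for y
  define S where "S y = (\<Oplus>\<^bsub>N\<^esub>k\<in>{..<n}. s k (y k))" for y
  have R: "linear_map A ?E M R" unfolding R_def by (rule linear_map_from_direct_sum[OF A PP M r])
  have S: "linear_map A ?E N S" unfolding S_def by (rule linear_map_from_direct_sum[OF A PP N s])
  define lifts where "lifts m y \<longleftrightarrow> y \<in> carrier ?E \<and> (\<forall>k<n. e (l k) (y k) = i k (g m))" for m y
  have gR: "g (R y) = g m" if "lifts m y" "m \<in> carrier M" for m y
  proof -
    have yk: "y k \<in> carrier (P (l k))" if "k < n" for k using \<open>lifts m y\<close> that by (auto simp: lifts_def PiE_iff)
    have gm: "g m \<in> carrier D" using linear_map_closed[OF g(1)] that(2) by blast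
    have "g (R y) = (\<Oplus>\<^bsub>D\<^esub>k\<in>{..<n}. g (r k (y k)))"
      unfolding R_def using linear_map_closed[OF r yk] by (intro linear_map_of_finsum[OF GM GD g(1)]) auto
    also have "\<dots> = (\<Oplus>\<^bsub>D\<^esub>k\<in>{..<n}. p k (i k (g m)))"
    proof (rule D.M.finsum_cong')
      fix k assume "k \<in> {..<n}"
      then show "g (r k (y k)) = p k (i k (g m))" using gr[OF _ yk] \<open>lifts m y\<close> by (auto simp: lifts_def)
    qed (use linear_map_closed[OF p] linear_map_closed[OF i gm] in auto)
    also have "\<dots> = g m" using sum gm by simp
    finally show ?thesis .
  qed
  have RK: "m \<ominus>\<^bsub>M\<^esub> R y \<in> ?K" if "lifts m y" "m \<in> carrier M" for m y
    using gR[OF that] linear_map_diff[OF GM GD g(1)] linear_map_closed[OF R] linear_map_closed[OF g(1)] that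
    by (simp add: a_kernel_eq lifts_def D.M.minus_eq_zero_iff)
  have fc: "f x \<in> carrier N" if "x \<in> ?K" for x using linear_map_closed[OF f] that by simp
  \<comment> \<open>The submodule generated by the images of the kernels lies in the kernel of \<open>g\<close>, where \<open>f\<close> is defined.\<close>
  have SR: "S z = f (R z)" "R z \<in> ?K" if z: "z \<in> carrier ?E" "\<forall>k<n. e (l k) (z k) = \<zero>\<^bsub>Z (l k)\<^esub>" for z
  proof -
    have zk: "z k \<in> ?L k" if "k < n" for k using z that by (auto simp: a_kernel_eq PiE_iff)
    have eq: "(\<Oplus>\<^bsub>M\<lparr>carrier := ?K\<rparr>\<^esub>k\<in>{..<n}. r k (z k)) = R z"
      unfolding R_def by (rule finsum_submodule[OF M K]) (use rK zk in auto)
    interpret KM: left_module A "M\<lparr>carrier := ?K\<rparr>" by (rule KM)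
    have "(\<Oplus>\<^bsub>M\<lparr>carrier := ?K\<rparr>\<^esub>k\<in>{..<n}. r k (z k)) \<in> carrier (M\<lparr>carrier := ?K\<rparr>)"
      by (rule KM.M.finsum_closed) (use rK zk in auto)
    then show "R z \<in> ?K" unfolding eq by simp
    have "f (R z) = (\<Oplus>\<^bsub>N\<^esub>k\<in>{..<n}. f (r k (z k)))"
      unfolding eq[symmetric] by (rule linear_map_of_finsum[OF GK GN f]) (use rK zk in auto)
    also have "\<dots> = S z" unfolding S_def
      by (rule N.M.finsum_cong') (use sf zk fc rK in auto)
    finally show "S z = f (R z)" by simp
  qed
  define val where "val m y = f (m \<ominus>\<^bsub>M\<^esub> R y) \<oplus>\<^bsub>N\<^esub> S y" for m y
  have fp: "f (x \<oplus>\<^bsub>M\<^esub> y) = f x \<oplus>\<^bsub>N\<^esub> f y" if "x \<in> ?K" "y \<in> ?K" for x y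
    using linear_map_plus[OF f] that by simp
  \<comment> \<open>Two lifts differ by an element of the direct sum of the kernels, on which \<open>S\<close> and \<open>f \<circ> R\<close> agree.\<close>
  have val_unique: "val m y = val m y'" if m: "m \<in> carrier M" and y: "lifts m y" and y': "lifts m y'" for m y y'
  proof -
    let ?z = "y \<ominus>\<^bsub>?E\<^esub> y'"
    have yE: "y \<in> carrier ?E" "y' \<in> carrier ?E" using y y' by (auto simp: lifts_def)
    have zE: "?z \<in> carrier ?E" using yE by (rule E.M.minus_closed)
    have "e (l k) (?z k) = \<zero>\<^bsub>Z (l k)\<^esub>" if k: "k < n" for k
    proof -
      have lin: "linear_map A ?E (Z (l k)) (\<lambda>y. e (l k) (y k))"
        using linear_map_comp[OF el(1)[OF k] linear_map_projection[of k "{..<n}" A "\<lambda>k. P (l k)"]] k by simp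
      interpret Zk: left_module A "Z (l k)" using Z[OF lI[OF k]] .
      have "e (l k) (?z k) = e (l k) (y k) \<ominus>\<^bsub>Z (l k)\<^esub> e (l k) (y' k)"
        by (rule linear_map_diff[OF GE Zk.M.abelian_group_axioms lin yE])
      also have "\<dots> = \<zero>\<^bsub>Z (l k)\<^esub>"
        using y y' k linear_map_closed[OF lin yE(1)] by (simp add: lifts_def Zk.M.minus_eq_zero_iff)
      finally show ?thesis .
    qed
    then have z: "S ?z = f (R ?z)" "R ?z \<in> ?K" using SR[OF zE] by auto
    have Rc: "R y \<in> carrier M" "R y' \<in> carrier M" using linear_map_closed[OF R] yE by auto
    have Sc: "S y \<in> carrier N" "S y' \<in> carrier N" using linear_map_closed[OF S] yE by auto
    have Rz: "R ?z = R y \<ominus>\<^bsub>M\<^esub> R y'" by (rule linear_map_diff[OF GE GM R yE])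
    have Sz: "S ?z = S y \<ominus>\<^bsub>N\<^esub> S y'" by (rule linear_map_diff[OF GE GN S yE])
    have "m \<ominus>\<^bsub>M\<^esub> R y' = (m \<ominus>\<^bsub>M\<^esub> R y) \<oplus>\<^bsub>M\<^esub> R ?z"
      unfolding Rz using m Rc by (simp add: M.M.minus_eq M.M.a_assoc M.M.r_neg1)
    then have "f (m \<ominus>\<^bsub>M\<^esub> R y') = f (m \<ominus>\<^bsub>M\<^esub> R y) \<oplus>\<^bsub>N\<^esub> (S y \<ominus>\<^bsub>N\<^esub> S y')"
      using fp[OF RK[OF y m] z(2)] z(1) Sz by simp
    then show ?thesis unfolding val_def
      using fc[OF RK[OF y m]] Sc by (simp add: N.M.a_assoc N.M.minus_add_cancel)
  qed
  define c where "c m = (\<lambda>k\<in>{..<n}. inv_into (carrier (P (l k))) (e (l k)) (i k (g m)))" for m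
  have c: "lifts m (c m)" if m: "m \<in> carrier M" for m
  proof -
    have "i k (g m) \<in> e (l k) ` carrier (P (l k))" if "k < n" for k
      using linear_map_closed[OF i[OF that] linear_map_closed[OF g(1) m]] el(2)[OF that] by simp
    then show ?thesis by (auto simp: lifts_def c_def inv_into_into f_inv_into_f)
  qed
  have cE: "c m \<in> carrier ?E" if "m \<in> carrier M" for m using c[OF that] by (simp only: lifts_def)
  define h where "h m = val m (c m)" for m
  have hv: "h m = val m y" if "m \<in> carrier M" "lifts m y" for m y
    unfolding h_def using val_unique[OF that(1) c[OF that(1)] that(2)] .
  have "linear_map A M N h"
  proof (rule linear_mapI, goal_cases)
    case (1 m)
    then show ?case unfolding h_def val_def
      using fc[OF RK[OF c[OF 1] 1]] linear_map_closed[OF S cE[OF 1]] by simp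
  next
    case (2 m m')
    let ?y = "c m \<oplus>\<^bsub>?E\<^esub> c m'"
    note yE = cE[OF 2(1)] cE[OF 2(2)]
    have Rc: "R (c m) \<in> carrier M" "R (c m') \<in> carrier M" using linear_map_closed[OF R] yE by auto
    have Sc: "S (c m) \<in> carrier N" "S (c m') \<in> carrier N" using linear_map_closed[OF S] yE by auto
    have "lifts (m \<oplus>\<^bsub>M\<^esub> m') ?y"
      unfolding lifts_def
    proof (intro conjI allI impI)
      show "?y \<in> carrier ?E" using yE by (rule E.M.a_closed)
      fix k assume k: "k < n"
      have "e (l k) (?y k) = e (l k) (c m k) \<oplus>\<^bsub>Z (l k)\<^esub> e (l k) (c m' k)"
        using linear_map_plus[OF el(1)[OF k]] yE k by (simp add: PiE_iff)
      then show "e (l k) (?y k) = i k (g (m \<oplus>\<^bsub>M\<^esub> m'))"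
        using c[OF 2(1)] c[OF 2(2)] k linear_map_plus[OF i[OF k]] linear_map_plus[OF g(1) 2] linear_map_closed[OF g(1)] 2
        by (simp add: lifts_def)
    qed
    then have "h (m \<oplus>\<^bsub>M\<^esub> m') = val (m \<oplus>\<^bsub>M\<^esub> m') ?y" using 2 by (intro hv) auto
    also have "\<dots> = f ((m \<ominus>\<^bsub>M\<^esub> R (c m)) \<oplus>\<^bsub>M\<^esub> (m' \<ominus>\<^bsub>M\<^esub> R (c m'))) \<oplus>\<^bsub>N\<^esub> (S (c m) \<oplus>\<^bsub>N\<^esub> S (c m'))"
    proof -
      have "(m \<oplus>\<^bsub>M\<^esub> m') \<ominus>\<^bsub>M\<^esub> R ?y = (m \<ominus>\<^bsub>M\<^esub> R (c m)) \<oplus>\<^bsub>M\<^esub> (m' \<ominus>\<^bsub>M\<^esub> R (c m'))"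
        unfolding linear_map_plus[OF R yE] using 2 Rc by (simp add: M.M.minus_eq M.M.minus_add M.M.a_ac)
      then show ?thesis unfolding val_def linear_map_plus[OF S yE] by simp
    qed
    also have "\<dots> = h m \<oplus>\<^bsub>N\<^esub> h m'"
      unfolding h_def val_def fp[OF RK[OF c[OF 2(1)] 2(1)] RK[OF c[OF 2(2)] 2(2)]]
      using fc[OF RK[OF c[OF 2(1)] 2(1)]] fc[OF RK[OF c[OF 2(2)] 2(2)]] Sc by (simp add: N.M.a_ac)
    finally show ?case .
  next
    case (3 a m)
    let ?y = "a \<odot>\<^bsub>?E\<^esub> c m"
    note yE = cE[OF 3(2)]
    have Rc: "R (c m) \<in> carrier M" using linear_map_closed[OF R] yE by auto
    have Sc: "S (c m) \<in> carrier N" using linear_map_closed[OF S] yE by auto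
    have am: "a \<odot>\<^bsub>M\<^esub> m \<in> carrier M" using 3 by (rule M.smult_closed)
    have "lifts (a \<odot>\<^bsub>M\<^esub> m) ?y"
      unfolding lifts_def
    proof (intro conjI allI impI)
      show "?y \<in> carrier ?E" using 3(1) yE by (rule E.smult_closed)
      fix k assume k: "k < n"
      have "e (l k) (?y k) = a \<odot>\<^bsub>Z (l k)\<^esub> e (l k) (c m k)"
        using linear_map_scale[OF el(1)[OF k] 3(1)] yE k by (simp add: PiE_iff)
      then show "e (l k) (?y k) = i k (g (a \<odot>\<^bsub>M\<^esub> m))"
        using c[OF 3(2)] k linear_map_scale[OF i[OF k] 3(1)] linear_map_scale[OF g(1) 3] linear_map_closed[OF g(1)] 3
        by (simp add: lifts_def)
    qed
    then have "h (a \<odot>\<^bsub>M\<^esub> m) = val (a \<odot>\<^bsub>M\<^esub> m) ?y" using am by (intro hv) auto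
    also have "\<dots> = f (a \<odot>\<^bsub>M\<^esub> (m \<ominus>\<^bsub>M\<^esub> R (c m))) \<oplus>\<^bsub>N\<^esub> a \<odot>\<^bsub>N\<^esub> S (c m)"
    proof -
      have "(a \<odot>\<^bsub>M\<^esub> m) \<ominus>\<^bsub>M\<^esub> R ?y = a \<odot>\<^bsub>M\<^esub> (m \<ominus>\<^bsub>M\<^esub> R (c m))"
        unfolding linear_map_scale[OF R 3(1) yE] using 3 Rc
        by (simp add: M.M.minus_eq M.smult_r_distr M.smult_minus_right)
      then show ?thesis unfolding val_def linear_map_scale[OF S 3(1) yE] by simp
    qed
    also have "\<dots> = a \<odot>\<^bsub>N\<^esub> h m"
    proof -
      have "f (a \<odot>\<^bsub>M\<^esub> (m \<ominus>\<^bsub>M\<^esub> R (c m))) = a \<odot>\<^bsub>N\<^esub> f (m \<ominus>\<^bsub>M\<^esub> R (c m))"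
        using linear_map_scale[OF f 3(1)] RK[OF c[OF 3(2)] 3(2)] by simp
      then show ?thesis unfolding h_def val_def
        using fc[OF RK[OF c[OF 3(2)] 3(2)]] Sc 3(1) by (simp add: N.smult_r_distr)
    qed
    finally show ?case .
  qed
  moreover have "h x = f x" if x: "x \<in> ?K" for x
  proof -
    have xM: "x \<in> carrier M" "g x = \<zero>\<^bsub>D\<^esub>" using x by (auto simp: a_kernel_eq)
    have "lifts x \<zero>\<^bsub>?E\<^esub>"
      unfolding lifts_def
    proof (intro conjI allI impI)
      fix k assume k: "k < n"
      show "e (l k) (\<zero>\<^bsub>?E\<^esub> k) = i k (g x)"
        using linear_map_zero[OF left_moduleD(2)[OF PP[OF k]] left_moduleD(2)[OF Z[OF lI[OF k]]] el(1)[OF k]]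
          linear_map_zero[OF GD left_moduleD(2)[OF Z[OF lI[OF k]]] i[OF k]] xM k by simp
    qed (rule E.M.zero_closed)
    then have "h x = val x \<zero>\<^bsub>?E\<^esub>" using xM by (intro hv)
    also have "val x \<zero>\<^bsub>?E\<^esub> = f x"
    proof -
      have "x \<ominus>\<^bsub>M\<^esub> \<zero>\<^bsub>M\<^esub> = x"
      using M.M.minus_add_cancel[of x "\<zero>\<^bsub>M\<^esub>"] M.M.minus_closed[of x "\<zero>\<^bsub>M\<^esub>"] xM by simp
      then show ?thesis unfolding val_def linear_map_zero[OF GE GM R] linear_map_zero[OF GE GN S]
        using fc[OF x] by simp
    qed
    finally show ?thesis .
  qed
  ultimately show "\<exists>h. linear_map A M N h \<and> (\<forall>x\<in>?K. h x = f x)" by blast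
qed

text \<open>
  Of each composite \<open>b \<circ> a\<close> only the factor \<open>a\<close> is defined on the kernel and has to be extended.
\<close>

lemma factors_through_extends:
  assumes N: "left_module A N" and KM: "left_module A (M\<lparr>carrier := a_kernel M D g\<rparr>)"
    and f: "factors_through A I Z (M\<lparr>carrier := a_kernel M D g\<rparr>) N f"
    and ext: "\<And>l. l \<in> I \<Longrightarrow> kernel_maps_extend A M D g (Z l)"
  shows "\<exists>h. factors_through A I Z M N h \<and> (\<forall>x\<in>a_kernel M D g. h x = f x)"
  using f
proof induction
  case (zero f)
  show ?case
    by (rule exI[of _ "\<lambda>_. \<zero>\<^bsub>N\<^esub>"]) (use zero in \<open>auto intro: factors_through.zero\<close>)
next
  case (step f l a b f')
  obtain h where h: "factors_through A I Z M N h" "\<forall>x\<in>a_kernel M D g. h x = f x" using step.IH by blast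
  obtain a' where a': "linear_map A M (Z l) a'" "\<And>x. x \<in> a_kernel M D g \<Longrightarrow> a' x = a x"
    using kernel_maps_extendE[OF ext[OF step.hyps(2)] step.hyps(3)] by blast
  have "factors_through A I Z M N (\<lambda>x. h x \<oplus>\<^bsub>N\<^esub> b (a' x))"
    by (rule factors_through.step[OF h(1) step.hyps(2) a'(1) step.hyps(4)]) simp
  then show ?case
    by (rule exI[of _ "\<lambda>x. h x \<oplus>\<^bsub>N\<^esub> b (a' x)", OF conjI]) (use h(2) a'(2) step.hyps(5) in auto)
qed

lemma kernel_maps_extend_into_summand:
  assumes N: "left_module A N" and N_id: "factors_through A I Z N N (\<lambda>x. x)"
    and M: "left_module A M" and D: "left_module A D" and g: "linear_map A M D g"
    and ext: "\<And>l. l \<in> I \<Longrightarrow> kernel_maps_extend A M D g (Z l)"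
  shows "kernel_maps_extend A M D g N"
  unfolding kernel_maps_extend_def
proof (intro allI impI)
  fix f assume f: "linear_map A (M\<lparr>carrier := a_kernel M D g\<rparr>) N f"
  have "left_module A (M\<lparr>carrier := a_kernel M D g\<rparr>)"
    by (rule left_module_submodule[OF M submodule_kernel[OF M D g]])
  from factors_through_extends[OF N this factors_comp_right[OF N_id f] ext]
  show "\<exists>h. linear_map A M N h \<and> (\<forall>x\<in>a_kernel M D g. h x = f x)"
    using factors_linear[OF _ M N] by blast
qed

text \<open>
  Exactness of \<open>Ext\<^sup>1(D, L) \<rightarrow> Ext\<^sup>1(D, N) \<rightarrow> Ext\<^sup>1(D, X)\<close> in the middle: extend the image of \<open>f\<close> in \<open>X\<close>,
  lift the extension to \<open>N\<close> by projectivity, and correct by an extension of the difference, which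
  takes values in \<open>L\<close>.
\<close>

lemma kernel_maps_extend_extension:
  assumes P: "presentation A P D e" and D: "left_module A D"
    and L: "left_module A L" and N: "left_module A N" and X: "left_module A X"
    and j: "linear_map A L N j" "inj_on j (carrier L)" "j ` carrier L = a_kernel N X q"
    and q: "linear_map A N X q" "q ` carrier N = carrier X"
    and ext: "kernel_maps_extend A P D e L" "kernel_maps_extend A P D e X"
  shows "kernel_maps_extend A P D e N"
  unfolding kernel_maps_extend_def
proof (intro allI impI)
  let ?K = "a_kernel P D e"
  fix f assume f: "linear_map A (P\<lparr>carrier := ?K\<rparr>) N f"
  note PP = presentationD(2)[OF P]
  have K: "submodule ?K A P" by (rule submodule_kernel[OF PP D presentationD(3)[OF P]])
  have KM: "left_module A (P\<lparr>carrier := ?K\<rparr>)" by (rule left_module_submodule[OF PP K])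
  interpret N: left_module A N by fact
  interpret X: left_module A X by fact
  obtain h where h: "linear_map A P X h" "\<And>x. x \<in> ?K \<Longrightarrow> h x = q (f x)"
    using kernel_maps_extendE[OF ext(2) linear_map_comp[OF q(1) f]] by blast
  obtain t where t: "linear_map A P N t" "\<And>x. x \<in> carrier P \<Longrightarrow> q (t x) = h x"
    using fg_projective_lift[OF presentationD(1)[OF P] N X q h(1)] by blast
  have tK: "linear_map A (P\<lparr>carrier := ?K\<rparr>) N t" by (rule linear_map_submodule[OF t(1)]) (auto simp: a_kernel_eq)
  have d: "linear_map A (P\<lparr>carrier := ?K\<rparr>) N (\<lambda>x. f x \<ominus>\<^bsub>N\<^esub> t x)"
    by (rule linear_map_sub[OF N f tK])
  have dK: "f x \<ominus>\<^bsub>N\<^esub> t x \<in> j ` carrier L" if x: "x \<in> ?K" for x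
  proof -
    have c: "f x \<in> carrier N" "t x \<in> carrier N" "q (f x) \<in> carrier X" using linear_map_closed[OF f] linear_map_closed[OF tK] linear_map_closed[OF q(1)] x by auto
    then have "q (f x \<ominus>\<^bsub>N\<^esub> t x) = \<zero>\<^bsub>X\<^esub>"
      using linear_map_diff[OF left_moduleD(2)[OF N] left_moduleD(2)[OF X] q(1) c(1,2)] t(2)[of x] h(2)[OF x] x
      by (simp add: X.M.minus_eq_zero_iff a_kernel_eq)
    then show ?thesis unfolding j(3) using c by (simp add: a_kernel_eq)
  qed
  define v where "v x = inv_into (carrier L) j (f x \<ominus>\<^bsub>N\<^esub> t x)" for x
  have v: "j (v x) = f x \<ominus>\<^bsub>N\<^esub> t x" if "x \<in> ?K" for x
    using f_inv_into_f[OF dK[OF that]] by (simp add: v_def)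
  have "linear_map A (P\<lparr>carrier := ?K\<rparr>) (N\<lparr>carrier := j ` carrier L\<rparr>) (\<lambda>x. f x \<ominus>\<^bsub>N\<^esub> t x)"
    by (rule linear_map_into_submodule[OF d]) (use dK in simp)
  from linear_map_comp[OF linear_map_inverse[OF L j(1,2)] this]
  have "linear_map A (P\<lparr>carrier := ?K\<rparr>) L v" unfolding v_def .
  from kernel_maps_extendE[OF ext(1) this] obtain w where
    w: "linear_map A P L w" "\<And>x. x \<in> ?K \<Longrightarrow> w x = v x" by blast
  have "linear_map A P N (\<lambda>x. j (w x) \<oplus>\<^bsub>N\<^esub> t x)"
    by (rule linear_map_add[OF N linear_map_comp[OF j(1) w(1)] t(1)])
  moreover have "j (w x) \<oplus>\<^bsub>N\<^esub> t x = f x" if "x \<in> ?K" for x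
    using w(2)[OF that] v[OF that] linear_map_closed[OF f] linear_map_closed[OF tK] that
    by (simp add: N.M.minus_add_cancel)
  ultimately show "\<exists>h. linear_map A P N h \<and> (\<forall>x\<in>?K. h x = f x)" by blast
qed

section \<open>Quotients\<close>

text \<open>
  The axioms descend along a surjection that respects the operations; inverses are images of inverses.
\<close>

lemma left_module_surjective_image:
  assumes M: "left_module A M" and p: "linear_map A M Q p" "p ` carrier M = carrier Q" "p \<zero>\<^bsub>M\<^esub> = \<zero>\<^bsub>Q\<^esub>"
  shows "left_module A Q"
proof -
  interpret left_module A M by fact
  have lift: "\<exists>y\<in>carrier M. x = p y" if "x \<in> carrier Q" for x using that p(2) by auto
  have c: "p x \<in> carrier Q" if "x \<in> carrier M" for x using linear_map_closed[OF p(1) that] .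
  have add: "p x \<oplus>\<^bsub>Q\<^esub> p y = p (x \<oplus>\<^bsub>M\<^esub> y)" if "x \<in> carrier M" "y \<in> carrier M" for x y
    using linear_map_plus[OF p(1) that] by simp
  have sc: "a \<odot>\<^bsub>Q\<^esub> p x = p (a \<odot>\<^bsub>M\<^esub> x)" if "a \<in> carrier A" "x \<in> carrier M" for a x
    using linear_map_scale[OF p(1) that] by simp
  have "abelian_group Q"
  proof (rule abelian_groupI, goal_cases)
    case (1 x y) then show ?case using lift[OF 1(1)] lift[OF 1(2)] c add by auto
  next
    case 2 then show ?case using c[of "\<zero>\<^bsub>M\<^esub>"] p(3) by simp
  next
    case (3 x y z) then show ?case using lift[OF 3(1)] lift[OF 3(2)] lift[OF 3(3)] add M.a_assoc by auto
  next
    case (4 x y) then show ?case using lift[OF 4(1)] lift[OF 4(2)] add M.a_comm by auto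
  next
    case (5 x) then show ?case using lift[OF 5] add[of "\<zero>\<^bsub>M\<^esub>"] p(3) by auto
  next
    case (6 x)
    then obtain y where y: "y \<in> carrier M" "x = p y" using lift by blast
    then have "p (\<ominus>\<^bsub>M\<^esub> y) \<oplus>\<^bsub>Q\<^esub> x = \<zero>\<^bsub>Q\<^esub>" using add p(3) by (simp add: M.l_neg)
    then show ?case using c y by (meson M.a_inv_closed)
  qed
  then show ?thesis
  proof (intro left_module.intro left_module_axioms.intro A.ring_axioms, goal_cases)
    case (2 a x) then show ?case using lift[OF 2(3)] sc c smult_closed by auto
  next
    case (3 a b x) then show ?case using lift[OF 3(4)] sc add smult_closed smult_l_distr by auto
  next
    case (4 a x y) then show ?case using lift[OF 4(3)] lift[OF 4(4)] sc add smult_closed smult_r_distr by auto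
  next
    case (5 a b x) then show ?case using lift[OF 5(4)] sc smult_closed smult_assoc by auto
  next
    case (6 x) then show ?case using lift[OF 6(2)] sc smult_one by auto
  qed
qed

lemma quotient_module_simps [simp]:
  "carrier (quotient_module M H) = a_rcosets\<^bsub>M\<^esub> H" "\<zero>\<^bsub>quotient_module M H\<^esub> = H"
  "add (quotient_module M H) = (\<lambda>C D. C <+>\<^bsub>M\<^esub> D)"
  "smult (quotient_module M H) = (\<lambda>a C. \<Union>c\<in>C. H +>\<^bsub>M\<^esub> (a \<odot>\<^bsub>M\<^esub> c))"
  by (simp_all add: quotient_module_def)

lemma abelian_subgroup_submodule:
  assumes "left_module A M" "submodule H A M"
  shows "abelian_subgroup H M"
  using abelian_subgroupI3[OF additive_subgroupI[OF submodule.axioms(1)[OF assms(2)]] left_moduleD(2)[OF assms(1)]] .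

lemma projection_to_quotient:
  assumes M: "left_module A M" and H: "submodule H A M"
  shows "linear_map A M (quotient_module M H) (\<lambda>x. H +>\<^bsub>M\<^esub> x)" (is ?lin)
    and "(\<lambda>x. H +>\<^bsub>M\<^esub> x) ` carrier M = carrier (quotient_module M H)" (is ?surj)
    and "left_module A (quotient_module M H)" (is ?mod)
    and "a_kernel M (quotient_module M H) (\<lambda>x. H +>\<^bsub>M\<^esub> x) = H" (is ?ker)
proof -
  interpret M: left_module A M by fact
  interpret H: abelian_subgroup H M by (rule abelian_subgroup_submodule[OF M H])
  note HD = submoduleD[OF M H]
  have HM: "x \<in> carrier M" if "x \<in> H" for x using HD(1) that by blast
  have sm: "(\<Union>c\<in>H +>\<^bsub>M\<^esub> x. H +>\<^bsub>M\<^esub> (a \<odot>\<^bsub>M\<^esub> c)) = H +>\<^bsub>M\<^esub> (a \<odot>\<^bsub>M\<^esub> x)"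
    if a: "a \<in> carrier A" and x: "x \<in> carrier M" for a x
  proof -
    have "H +>\<^bsub>M\<^esub> (a \<odot>\<^bsub>M\<^esub> c) = H +>\<^bsub>M\<^esub> (a \<odot>\<^bsub>M\<^esub> x)" if c: "c \<in> H +>\<^bsub>M\<^esub> x" for c
    proof -
      obtain h where h: "h \<in> H" "c = h \<oplus>\<^bsub>M\<^esub> x" using c by (auto simp: a_r_coset_def')
      have "a \<odot>\<^bsub>M\<^esub> c = (a \<odot>\<^bsub>M\<^esub> h) \<oplus>\<^bsub>M\<^esub> (a \<odot>\<^bsub>M\<^esub> x)"
        using M.smult_r_distr[OF a HM[OF h(1)] x] h(2) by simp
      then have "a \<odot>\<^bsub>M\<^esub> c \<in> H +>\<^bsub>M\<^esub> (a \<odot>\<^bsub>M\<^esub> x)"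
        using HD(5)[OF a h(1)] by (auto simp: a_r_coset_def')
      then show ?thesis
        using M.M.a_repr_independence[OF _ M.smult_closed[OF a x] H.a_subgroup] by blast
    qed
    moreover have "x \<in> H +>\<^bsub>M\<^esub> x" using M.M.a_rcosI[OF HD(2,1) x] x by simp
    ultimately show ?thesis by blast
  qed
  show lin: ?lin
    by (rule linear_mapI) (use sm M.M.a_rcosetsI[OF HD(1)] H.a_rcos_sum in auto)
  show surj: ?surj by (auto simp: A_RCOSETS_def')
  show ?mod
    by (rule left_module_surjective_image[OF M lin surj]) (use HD(1) in simp)
  have mem: "x \<in> H +>\<^bsub>M\<^esub> x" if "x \<in> carrier M" for x
    using M.M.a_rcosI[OF HD(2,1) that] that by simp
  show ?ker
  proof (intro equalityI subsetI)
    fix x assume "x \<in> a_kernel M (quotient_module M H) (\<lambda>x. H +>\<^bsub>M\<^esub> x)"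
    then show "x \<in> H" using mem[of x] by (auto simp: a_kernel_eq)
  next
    fix x assume "x \<in> H"
    then show "x \<in> a_kernel M (quotient_module M H) (\<lambda>x. H +>\<^bsub>M\<^esub> x)"
      using M.M.a_coset_join2[OF HM H.a_subgroup] HM by (auto simp: a_kernel_eq)
  qed
qed

section \<open>Vanishing of the first extension group\<close>

text \<open>
  A map on the kernel of the augmentation \<open>e\<close>, composed with the first differential, is a cocycle of
  degree one. A one-element quotient makes every cocycle a coboundary, that is, the composite of the
  differential with a map defined on \<open>P 0\<close>, and the latter map is the extension.
\<close>

lemma kernel_maps_extend_of_has_Ext:
  fixes R :: "('r, 'z) ring_scheme" and A :: "('r, 'a) module" and M :: "('a, 'm) module" and N :: "('a, 'n) module"
  assumes M: "left_module A M" and N: "left_module A N"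
    and Ext: "has_Ext R A M N 1 E" and E: "carrier E = {z}"
  obtains P :: "('a, nat \<Rightarrow> 'a) module" and e where "presentation A P M e" "kernel_maps_extend A P M e N"
proof -
  obtain P :: "nat \<Rightarrow> ('a, nat \<Rightarrow> 'a) module" and d e where
    res: "projective_resolution A M P d e" and
    iso: "mod_isomorphic R (quotient_module ((hom_module A (P 1) N)\<lparr>carrier := cocycles A P d N 1\<rparr>)
             (coboundaries A P d N 1)) E"
    using Ext unfolding has_Ext_def by blast
  have proj: "fg_projective A (P i)" for i using res by (simp add: projective_resolution_def)
  have PM: "left_module A (P i)" for i using fg_projectiveD[OF proj] .
  have e: "linear_map A (P 0) M e" "e ` carrier (P 0) = carrier M"
    using res by (auto simp: projective_resolution_def mod_hom_linear)
  have d: "linear_map A (P (Suc i)) (P i) (d i)" for i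
    using res by (auto simp: projective_resolution_def mod_hom_linear)
  have d0: "d 0 ` carrier (P 1) = a_kernel (P 0) M e" 
    and d1: "d 1 ` carrier (P 2) = a_kernel (P 1) (P 0) (d 0)"
    using res by (auto simp: projective_resolution_def numeral_2_eq_2)
  let ?K = "a_kernel (P 0) M e"
  let ?Q = "(hom_module A (P 1) N)\<lparr>carrier := cocycles A P d N 1\<rparr>" and ?B = "coboundaries A P d N 1"
  interpret N: left_module A N by fact
  interpret P1: left_module A "P 1" by (rule PM)
  have zero_bd: "zero_hom (P 1) N \<in> ?B"
  proof -
    have "restrict (\<lambda>_. \<zero>\<^bsub>N\<^esub>) (carrier (P 0)) \<in> mod_hom A (P 0) N"
      by (rule linear_map_restrict[OF PM linear_map_const_zero[OF N]])
    moreover have "zero_hom (P 1) N = compose (carrier (P 1)) (restrict (\<lambda>_. \<zero>\<^bsub>N\<^esub>) (carrier (P 0))) (d 0)"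
      using linear_map_closed[OF d[of 0]] by (auto simp: zero_hom_def compose_def fun_eq_iff)
    ultimately show ?thesis by auto
  qed
  \<comment> \<open>All cosets coincide; adding the zero map, which is a coboundary, shows that \<open>c\<close> lies in its own
    coset, hence in that of the zero map.\<close>
  have cocycle_bd: "c \<in> ?B" if c: "c \<in> cocycles A P d N 1" for c
  proof -
    obtain \<phi> where "bij_betw \<phi> (carrier (quotient_module ?Q ?B)) (carrier E)"
      using iso by (auto simp: mod_isomorphic_def mod_iso_def)
    then have inj: "inj_on \<phi> (a_rcosets\<^bsub>?Q\<^esub> ?B)" "\<phi> ` (a_rcosets\<^bsub>?Q\<^esub> ?B) = {z}"
      unfolding bij_betw_def by (simp_all add: E)
    have rc: "?B +>\<^bsub>?Q\<^esub> x \<in> a_rcosets\<^bsub>?Q\<^esub> ?B" if "x \<in> cocycles A P d N 1" for x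
      using that by (auto simp: A_RCOSETS_def')
    have zc: "zero_hom (P 1) N \<in> cocycles A P d N 1"
      using linear_map_restrict[OF PM linear_map_const_zero[OF N, of "P 1"]] linear_map_closed[OF d[of 1]]
      by (auto simp: cocycles_def zero_hom_def compose_def fun_eq_iff numeral_2_eq_2)
    have ch: "x \<in> carrier (P 1) \<rightarrow>\<^sub>E carrier N" if "x \<in> cocycles A P d N 1" for x
      using that by (auto simp: cocycles_def mod_hom_def)
    have add0: "zero_hom (P 1) N \<oplus>\<^bsub>?Q\<^esub> c = c"
      using ch[OF c] by (auto simp: hom_module_def zero_hom_def fun_eq_iff PiE_iff extensional_def)
    have "\<phi> (?B +>\<^bsub>?Q\<^esub> c) = \<phi> (?B +>\<^bsub>?Q\<^esub> zero_hom (P 1) N)"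
      using imageI[OF rc[OF c], of \<phi>] imageI[OF rc[OF zc], of \<phi>] unfolding inj(2) by simp
    then have eq: "?B +>\<^bsub>?Q\<^esub> c = ?B +>\<^bsub>?Q\<^esub> zero_hom (P 1) N"
      by (rule inj_onD[OF inj(1) _ rc[OF c] rc[OF zc]])
    have "zero_hom (P 1) N \<oplus>\<^bsub>?Q\<^esub> c \<in> ?B +>\<^bsub>?Q\<^esub> c"
      unfolding a_r_coset_def' by (rule UN_I[OF zero_bd]) simp
    then have "c \<in> ?B +>\<^bsub>?Q\<^esub> c" unfolding add0 .
    then obtain b where b: "b \<in> ?B" "c = b \<oplus>\<^bsub>?Q\<^esub> zero_hom (P 1) N"
      unfolding eq by (auto simp: a_r_coset_def')
    have bh: "b \<in> carrier (P 1) \<rightarrow>\<^sub>E carrier N"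
    proof -
      obtain u where u: "u \<in> mod_hom A (P 0) N" "b = compose (carrier (P 1)) u (d 0)" using b(1) by auto
      then show ?thesis using linear_map_closed[OF mod_hom_linear[OF u(1)]] linear_map_closed[OF d[of 0]]
        by (auto simp: compose_def)
    qed
    have "b \<oplus>\<^bsub>?Q\<^esub> zero_hom (P 1) N = b"
      using bh by (auto simp: hom_module_def zero_hom_def fun_eq_iff PiE_iff extensional_def)
    then show ?thesis using b by simp
  qed
  have "kernel_maps_extend A (P 0) M e N"
    unfolding kernel_maps_extend_def
  proof (intro allI impI)
    fix f assume f: "linear_map A ((P 0)\<lparr>carrier := ?K\<rparr>) N f"
    have KM: "left_module A ((P 0)\<lparr>carrier := ?K\<rparr>)"
      by (rule left_module_submodule[OF PM submodule_kernel[OF PM M e(1)]])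
    have dK: "linear_map A (P 1) ((P 0)\<lparr>carrier := ?K\<rparr>) (d 0)"
      by (rule linear_map_into_submodule) (use d[of 0] d0 in auto)
    define c where "c = restrict (\<lambda>x. f (d 0 x)) (carrier (P 1))"
    have c: "c \<in> mod_hom A (P 1) N" unfolding c_def by (rule linear_map_restrict[OF PM linear_map_comp[OF f dK]])
    have "compose (carrier (P 2)) c (d 1) = zero_hom (P 2) N"
    proof -
      have "c (d 1 x) = \<zero>\<^bsub>N\<^esub>" if x: "x \<in> carrier (P 2)" for x
      proof -
        have "d 1 x \<in> a_kernel (P 1) (P 0) (d 0)" using d1 x by blast
        then have "d 1 x \<in> carrier (P 1)" "d 0 (d 1 x) = \<zero>\<^bsub>P 0\<^esub>" by (auto simp: a_kernel_eq)
        then show ?thesis unfolding c_def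
          using linear_map_zero[OF left_moduleD(2)[OF KM] left_moduleD(2)[OF N] f] by simp
      qed
      then show ?thesis by (auto simp: compose_def zero_hom_def fun_eq_iff)
    qed
    then have "c \<in> cocycles A P d N 1" using c by (simp add: cocycles_def numeral_2_eq_2)
    from cocycle_bd[OF this] obtain h where h: "h \<in> mod_hom A (P 0) N" "c = compose (carrier (P 1)) h (d 0)" by auto
    have "h x = f x" if x: "x \<in> ?K" for x
    proof -
      obtain y where y: "y \<in> carrier (P 1)" "x = d 0 y" using x d0 by blast
      have "c y = h (d 0 y)" using h(2) y(1) by (simp add: compose_def)
      then show ?thesis using y by (simp add: c_def)
    qed
    then show "\<exists>h. linear_map A (P 0) N h \<and> (\<forall>x\<in>?K. h x = f x)" using mod_hom_linear[OF h(1)] by blast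
  qed
  moreover have "presentation A (P 0) M e" using proj e by (simp add: presentation_def)
  ultimately show ?thesis using that by blast
qed

section \<open>Filtered modules\<close>

text \<open>
  The quotient \<open>D\<close> of \<open>L\<close> by \<open>K\<close> is given by a surjection rather than as a module of cosets, so
  that \<open>q\<close> can be composed with other maps.
\<close>

definition summand_layer ::
    "('a, 'q) ring_scheme \<Rightarrow> 'i set \<Rightarrow> ('i \<Rightarrow> ('a, 'z) module) \<Rightarrow> ('a, 'm) module \<Rightarrow> 'm set \<Rightarrow> 'm set \<Rightarrow> bool" where
  "summand_layer A I Z X K L \<longleftrightarrow>
     (\<exists>(D :: ('a, 'm set) module) q. left_module A D \<and> linear_map A (X\<lparr>carrier := L\<rparr>) D q \<and>
        q ` L = carrier D \<and> a_kernel (X\<lparr>carrier := L\<rparr>) D q = K \<and> factors_through A I Z D D (\<lambda>x. x))"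

definition summand_filtration ::
    "('a, 'q) ring_scheme \<Rightarrow> 'i set \<Rightarrow> ('i \<Rightarrow> ('a, 'z) module) \<Rightarrow> ('a, 'm) module \<Rightarrow> nat \<Rightarrow> (nat \<Rightarrow> 'm set) \<Rightarrow> bool" where
  "summand_filtration A I Z X n F \<longleftrightarrow> left_module A X \<and> F 0 = {\<zero>\<^bsub>X\<^esub>} \<and> F n = carrier X \<and>
     (\<forall>i\<le>n. submodule (F i) A X) \<and> (\<forall>i<n. summand_layer A I Z X (F i) (F (Suc i)))"

lemma summand_filtration_stepE:
  assumes "summand_filtration A I Z (X :: ('a, 'm) module) n F" "i < n"
  obtains D :: "('a, 'm set) module" and q where "left_module A D"
    "linear_map A (X\<lparr>carrier := F (Suc i)\<rparr>) D q" "q ` F (Suc i) = carrier D"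
    "a_kernel (X\<lparr>carrier := F (Suc i)\<rparr>) D q = F i" "factors_through A I Z D D (\<lambda>x. x)"
proof -
  have "summand_layer A I Z X (F i) (F (Suc i))"
    using assms by (simp add: summand_filtration_def)
  then show ?thesis unfolding summand_layer_def using that by (elim exE conjE)
qed

lemma summand_filtrationD:
  assumes "summand_filtration A I Z X n F"
  shows "left_module A X" "F 0 = {\<zero>\<^bsub>X\<^esub>}" "F n = carrier X"
    "\<And>i. i \<le> n \<Longrightarrow> submodule (F i) A X" "\<And>i. i \<le> n \<Longrightarrow> left_module A (X\<lparr>carrier := F i\<rparr>)"
proof -
  show X: "left_module A X" and "F 0 = {\<zero>\<^bsub>X\<^esub>}" "F n = carrier X" and
    sub: "\<And>i. i \<le> n \<Longrightarrow> submodule (F i) A X" using assms by (simp_all add: summand_filtration_def)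
  show "\<And>i. i \<le> n \<Longrightarrow> left_module A (X\<lparr>carrier := F i\<rparr>)" by (rule left_module_submodule[OF X sub])
qed

lemma kernel_maps_extend_into_filtered:
  fixes Y :: "('a, 'y) module"
  assumes fil: "summand_filtration A I Z Y n F"
    and P: "presentation A P D e" and D: "left_module A D"
    and ext: "\<And>l. l \<in> I \<Longrightarrow> kernel_maps_extend A P D e (Z l)"
  shows "kernel_maps_extend A P D e Y"
proof -
  note fD = summand_filtrationD[OF fil]
  note PP = presentationD(2)[OF P]
  have "kernel_maps_extend A P D e (Y\<lparr>carrier := F i\<rparr>)" if "i \<le> n" for i
    using that
  proof (induction i)
    case 0
    interpret Y0: left_module A "Y\<lparr>carrier := F 0\<rparr>" using fD(5) by blast
    show ?case unfolding kernel_maps_extend_def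
    proof (intro allI impI)
      fix f assume f: "linear_map A (P\<lparr>carrier := a_kernel P D e\<rparr>) (Y\<lparr>carrier := F 0\<rparr>) f"
      show "\<exists>h. linear_map A P (Y\<lparr>carrier := F 0\<rparr>) h \<and> (\<forall>x\<in>a_kernel P D e. h x = f x)"
        using linear_map_closed[OF f] linear_map_const_zero[OF Y0.left_module_axioms, of P] fD(2)
        by (intro exI[of _ "\<lambda>_. \<zero>\<^bsub>Y\<^esub>"]) auto
    qed
  next
    case (Suc i)
    obtain Q :: "('a, 'y set) module" and q where Q: "left_module A Q"
      "linear_map A (Y\<lparr>carrier := F (Suc i)\<rparr>) Q q" "q ` F (Suc i) = carrier Q"
      "a_kernel (Y\<lparr>carrier := F (Suc i)\<rparr>) Q q = F i" "factors_through A I Z Q Q (\<lambda>x. x)"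
      by (rule summand_filtration_stepE[OF fil, of i]) (use Suc.prems in auto)
    have sub: "F i \<subseteq> F (Suc i)" using Q(4) by (auto simp: a_kernel_eq)
    have extQ: "kernel_maps_extend A P D e Q"
      by (rule kernel_maps_extend_into_summand[OF Q(1) Q(5) PP D presentationD(3)[OF P] ext])
    have L: "left_module A (Y\<lparr>carrier := F i\<rparr>)" and N: "left_module A (Y\<lparr>carrier := F (Suc i)\<rparr>)"
      using fD(5) Suc.prems by auto
    show ?case
    proof (rule kernel_maps_extend_extension[OF P D L N Q(1) _ _ _ Q(2) _ _ extQ])
      show "linear_map A (Y\<lparr>carrier := F i\<rparr>) (Y\<lparr>carrier := F (Suc i)\<rparr>) (\<lambda>x. x)"
        using sub by (auto simp: linear_map_def)
      show "inj_on (\<lambda>x. x) (carrier (Y\<lparr>carrier := F i\<rparr>))" by simp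
      show "(\<lambda>x. x) ` carrier (Y\<lparr>carrier := F i\<rparr>) = a_kernel (Y\<lparr>carrier := F (Suc i)\<rparr>) Q q"
        unfolding Q(4) by simp
      show "q ` carrier (Y\<lparr>carrier := F (Suc i)\<rparr>) = carrier Q" using Q(3) by simp
      show "kernel_maps_extend A P D e (Y\<lparr>carrier := F i\<rparr>)" using Suc by simp
    qed
  qed
  from this[of n] show ?thesis by (simp add: fD(3) carrier_update_self)
qed

text \<open>
  The extension is built in steps, along the preimages under \<open>g\<close> of the members of the filtration:
  the quotient of consecutive preimages is a layer of \<open>X\<close>.
\<close>

lemma kernel_maps_extend_over_filtered:
  fixes X :: "('a, 'y) module"
  assumes fil: "summand_filtration A I Z X n F"
    and M: "left_module A M" and N: "left_module A N"
    and Z: "\<And>l. l \<in> I \<Longrightarrow> left_module A (Z l)"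
    and pres: "\<And>l. l \<in> I \<Longrightarrow> presentation A (P l) (Z l) (e l)"
    and ext: "\<And>l. l \<in> I \<Longrightarrow> kernel_maps_extend A (P l) (Z l) (e l) N"
    and g: "linear_map A M X g" "g ` carrier M = carrier X"
  shows "kernel_maps_extend A M X g N"
  unfolding kernel_maps_extend_def
proof (intro allI impI)
  fix f assume f: "linear_map A (M\<lparr>carrier := a_kernel M X g\<rparr>) N f"
  note fD = summand_filtrationD[OF fil]
  let ?M = "\<lambda>i. {x \<in> carrier M. g x \<in> F i}"
  have M0: "a_kernel M X g = ?M 0" using fD(2) by (auto simp: a_kernel_eq)
  have "\<exists>h. linear_map A (M\<lparr>carrier := ?M i\<rparr>) N h \<and> (\<forall>x\<in>a_kernel M X g. h x = f x)" if "i \<le> n" for i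
    using that
  proof (induction i)
    case 0
    show ?case using f unfolding M0 by blast
  next
    case (Suc i)
    then have "i \<le> n" by simp
    from Suc.IH[OF this] obtain h where
      h: "linear_map A (M\<lparr>carrier := ?M i\<rparr>) N h" "\<forall>x\<in>a_kernel M X g. h x = f x" by blast
    obtain Q :: "('a, 'y set) module" and q where Q: "left_module A Q"
      "linear_map A (X\<lparr>carrier := F (Suc i)\<rparr>) Q q" "q ` F (Suc i) = carrier Q"
      "a_kernel (X\<lparr>carrier := F (Suc i)\<rparr>) Q q = F i" "factors_through A I Z Q Q (\<lambda>x. x)"
      by (rule summand_filtration_stepE[OF fil, of i]) (use Suc.prems in auto)
    let ?N = "M\<lparr>carrier := ?M (Suc i)\<rparr>"
    have NM: "left_module A ?N"
      by (rule left_module_submodule[OF M submodule_preimage[OF M fD(1) g(1) fD(4)]]) (use Suc.prems in simp)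
    have gl: "linear_map A ?N (X\<lparr>carrier := F (Suc i)\<rparr>) g"
      by (rule linear_map_into_submodule[OF linear_map_submodule[OF g(1)]]) auto
    have img: "(\<lambda>x. q (g x)) ` carrier ?N = carrier Q"
    proof -
      have "F (Suc i) \<subseteq> g ` carrier M"
        using submoduleD(1)[OF fD(1) fD(4)[OF Suc.prems]] g(2) by simp
      then have "g ` ?M (Suc i) = F (Suc i)" by blast
      then have "q ` (g ` ?M (Suc i)) = carrier Q" using Q(3) by simp
      then show ?thesis by (simp add: image_image)
    qed
    have ker: "a_kernel ?N Q (\<lambda>x. q (g x)) = ?M i"
    proof -
      have "F i = {y \<in> F (Suc i). q y = \<zero>\<^bsub>Q\<^esub>}" using Q(4) by (simp add: a_kernel_eq)
      then show ?thesis unfolding a_kernel_eq by simp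
    qed
    have extN: "kernel_maps_extend A ?N Q (\<lambda>x. q (g x)) N"
      by (rule kernel_maps_extend_transfer[OF NM Q(1) N Z pres ext linear_map_comp[OF Q(2) gl] img Q(5)])
    have "linear_map A (?N\<lparr>carrier := a_kernel ?N Q (\<lambda>x. q (g x))\<rparr>) N h" using h(1) unfolding ker by simp
    from kernel_maps_extendE[OF extN this] obtain h' where
      h': "linear_map A ?N N h'" "\<And>x. x \<in> ?M i \<Longrightarrow> h' x = h x" unfolding ker by blast
    have "\<zero>\<^bsub>X\<^esub> \<in> F i" using submoduleD(2)[OF fD(1) fD(4)[of i]] Suc.prems by simp
    then have sub: "x \<in> ?M i" if "x \<in> a_kernel M X g" for x using that by (simp add: a_kernel_eq)
    have "\<forall>x\<in>a_kernel M X g. h' x = f x" using h'(2)[OF sub] h(2) by simp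
    then show ?case using h'(1) by blast
  qed
  from this[OF order_refl] obtain h where
    h: "linear_map A (M\<lparr>carrier := ?M n\<rparr>) N h" "\<forall>x\<in>a_kernel M X g. h x = f x" by blast
  have "?M n = carrier M" using linear_map_closed[OF g(1)] fD(3) by auto
  then have "M\<lparr>carrier := ?M n\<rparr> = M" by (simp add: carrier_update_self)
  then show "\<exists>h. linear_map A M N h \<and> (\<forall>x\<in>a_kernel M X g. h x = f x)" using h by (intro exI[of _ h]) simp
qed

text \<open>
  Induction along the filtration. The factorisation of the restriction of \<open>h\<close> to \<open>F i\<close> extends to
  \<open>F (Suc i)\<close>, because the maps into the modules \<open>W j\<close> extend. The difference between \<open>h\<close> and this
  extension is a map on the layer, where the factorisation comes from the modules \<open>Z l\<close>.
\<close>

lemma factors_of_filtered: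
  fixes X :: "('a, 'y) module"
  assumes fil: "summand_filtration A I Z X n F"
    and N: "left_module A N"
    and Z: "\<And>l. l \<in> I \<Longrightarrow> left_module A (Z l)"
    and W: "\<And>j. j \<in> J \<Longrightarrow> left_module A (W j)"
    and pres: "\<And>l. l \<in> I \<Longrightarrow> presentation A (P l) (Z l) (e l)"
    and ext: "\<And>l j. l \<in> I \<Longrightarrow> j \<in> J \<Longrightarrow> kernel_maps_extend A (P l) (Z l) (e l) (W j)"
    and fac: "\<And>l b. l \<in> I \<Longrightarrow> linear_map A (Z l) N b \<Longrightarrow> factors_through A J W (Z l) N b"
    and h: "linear_map A X N h"
  shows "factors_through A J W X N h"
proof -
  note fD = summand_filtrationD[OF fil]
  interpret N: left_module A N by fact
  have "factors_through A J W (X\<lparr>carrier := F i\<rparr>) N h" if "i \<le> n" for i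
    using that
  proof (induction i)
    case 0
    show ?case
      by (rule factors_through.zero)
         (use fD(2) linear_map_zero[OF left_moduleD(2)[OF fD(1)] left_moduleD(2)[OF N] h] in auto)
  next
    case (Suc i)
    then have IH: "factors_through A J W (X\<lparr>carrier := F i\<rparr>) N h" by simp
    obtain Q :: "('a, 'y set) module" and q where Q: "left_module A Q"
      "linear_map A (X\<lparr>carrier := F (Suc i)\<rparr>) Q q" "q ` F (Suc i) = carrier Q"
      "a_kernel (X\<lparr>carrier := F (Suc i)\<rparr>) Q q = F i" "factors_through A I Z Q Q (\<lambda>x. x)"
      by (rule summand_filtration_stepE[OF fil, of i]) (use Suc.prems in auto)
    let ?X = "X\<lparr>carrier := F (Suc i)\<rparr>"
    have XM: "left_module A ?X" and XL: "left_module A (X\<lparr>carrier := F i\<rparr>)" using fD(5) Suc.prems by auto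
    have surj: "q ` carrier ?X = carrier Q" using Q(3) by simp
    have extQ: "kernel_maps_extend A ?X Q q (W j)" if "j \<in> J" for j
      by (rule kernel_maps_extend_transfer[OF XM Q(1) W[OF that] Z pres ext[OF _ that] Q(2) surj Q(5)])
    have "\<exists>h'. factors_through A J W ?X N h' \<and> (\<forall>x\<in>a_kernel ?X Q q. h' x = h x)"
      by (rule factors_through_extends[OF N _ _ extQ]) (use XL IH Q(4) in auto)
    then obtain h' where h': "factors_through A J W ?X N h'" "\<And>x. x \<in> F i \<Longrightarrow> h' x = h x"
      unfolding Q(4) by blast
    have h'l: "linear_map A ?X N h'" by (rule factors_linear[OF h'(1) XM N])
    have hl: "linear_map A ?X N h"
      by (rule linear_map_submodule[OF h submoduleD(1)[OF fD(1) fD(4)]]) (use Suc.prems in simp)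
    have kill: "h x \<ominus>\<^bsub>N\<^esub> h' x = \<zero>\<^bsub>N\<^esub>" if "x \<in> a_kernel ?X Q q" for x
    proof -
      have "x \<in> F i" "x \<in> carrier ?X" using that Q(4) by (auto simp: a_kernel_eq)
      then show ?thesis using h'(2)[of x] linear_map_closed[OF hl, of x] by (simp add: N.M.minus_eq_zero_iff)
    qed
    obtain u where u: "linear_map A Q N u" "\<And>x. x \<in> carrier ?X \<Longrightarrow> u (q x) = h x \<ominus>\<^bsub>N\<^esub> h' x"
      using factor_over_surjection[OF XM Q(1) N Q(2) surj linear_map_sub[OF N hl h'l] kill] by blast
    have "factors_through A J W Q N u"
      by (rule factors_trans[OF Q(1) N factors_comp_left[OF Q(1) Q(1) N Q(5) u(1)] fac])
    from factors_add[OF XM N factors_comp_right[OF this Q(2)] h'(1)]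
    show ?case
    proof (rule factors_cong)
      fix x assume x: "x \<in> carrier ?X"
      show "h x = u (q x) \<oplus>\<^bsub>N\<^esub> h' x"
        unfolding u(2)[OF x] using linear_map_closed[OF hl x] linear_map_closed[OF h'l x]
        by (simp add: N.M.minus_add_cancel)
    qed
  qed
  from this[of n] show ?thesis by (simp add: fD(3) carrier_update_self)
qed

section \<open>Tensor products with finitely generated projectives\<close>

lemma tensor_free_simps [simp]:
  "carrier (tensor_free M U) = {c. Poly_Mapping.keys c \<subseteq> carrier M \<times> carrier U}"
  "\<zero>\<^bsub>tensor_free M U\<^esub> = 0" "add (tensor_free M U) = (+)"
  "smult (tensor_free M U) = (\<lambda>a. frag_extend (\<lambda>(x, u). frag_of (a \<odot>\<^bsub>M\<^esub> x, u)))"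
  by (simp_all add: tensor_free_def)

lemma abelian_group_tensor_free: "abelian_group (tensor_free M U)"
proof (rule abelian_groupI, goal_cases)
  case (1 x y) then show ?case using keys_add[of x y] by auto
next
  case (6 x) then show ?case by (intro bexI[of _ "- x"]) auto
qed auto

lemma uminus_tensor_free:
  assumes "x \<in> carrier (tensor_free M U)" shows "\<ominus>\<^bsub>tensor_free M U\<^esub> x = - x"
proof -
  interpret abelian_group "tensor_free M U" by (rule abelian_group_tensor_free)
  show ?thesis by (rule minus_equality) (use assms in auto)
qed

lemma tensor_subgroupI:
  assumes "S \<subseteq> carrier (tensor_free M U)" "0 \<in> S" "\<And>x. x \<in> S \<Longrightarrow> - x \<in> S" "\<And>x y. x \<in> S \<Longrightarrow> y \<in> S \<Longrightarrow> x + y \<in> S"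
  shows "subgroup S (add_monoid (tensor_free M U))"
proof -
  interpret abelian_group "tensor_free M U" by (rule abelian_group_tensor_free)
  have inv: "inv\<^bsub>add_monoid (tensor_free M U)\<^esub> x = - x" if "x \<in> S" for x
    using uminus_tensor_free[of x M U] that assms(1) unfolding a_inv_def by blast
  show ?thesis using assms inv by (auto intro!: subgroup.intro)
qed

lemma tensor_relationsE:
  assumes "c \<in> tensor_relations R A M U"
  obtains (left) x y u where "x \<in> carrier M" "y \<in> carrier M" "u \<in> carrier U"
      "c = frag_of (x \<oplus>\<^bsub>M\<^esub> y, u) - frag_of (x, u) - frag_of (y, u)"
    | (right) x u v where "x \<in> carrier M" "u \<in> carrier U" "v \<in> carrier U"
      "c = frag_of (x, u \<oplus>\<^bsub>U\<^esub> v) - frag_of (x, u) - frag_of (x, v)"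
    | (balance) r x u where "r \<in> carrier R" "x \<in> carrier M" "u \<in> carrier U"
      "c = frag_of ((r \<odot>\<^bsub>A\<^esub> \<one>\<^bsub>A\<^esub>) \<odot>\<^bsub>M\<^esub> x, u) - frag_of (x, r \<odot>\<^bsub>U\<^esub> u)"
  using assms unfolding tensor_relations_def by blast

lemma tensor_free_diff_closed:
  assumes "c \<in> carrier (tensor_free M U)" "c' \<in> carrier (tensor_free M U)"
  shows "c - c' \<in> carrier (tensor_free M U)"
  using keys_diff[of c c'] assms by auto

lemma tensor_relations_subset:
  assumes M: "left_module A M" and U: "left_module R U" and A: "assoc_algebra R A"
  shows "tensor_relations R A M U \<subseteq> carrier (tensor_free M U)"
proof
  interpret M: left_module A M by fact
  interpret U: left_module R U by fact
  interpret AA: assoc_algebra R A by fact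
  have g: "frag_of (x, u) \<in> carrier (tensor_free M U)" if "x \<in> carrier M" "u \<in> carrier U" for x u
    using that by simp
  fix c assume "c \<in> tensor_relations R A M U"
  then show "c \<in> carrier (tensor_free M U)"
  proof (cases rule: tensor_relationsE)
    case (left x y u)
    then show ?thesis by (simp only: tensor_free_diff_closed g M.M.a_closed)
  next
    case (right x u v)
    then show ?thesis by (simp only: tensor_free_diff_closed g U.M.a_closed)
  next
    case (balance r x u)
    have "(r \<odot>\<^bsub>A\<^esub> \<one>\<^bsub>A\<^esub>) \<odot>\<^bsub>M\<^esub> x \<in> carrier M" "r \<odot>\<^bsub>U\<^esub> u \<in> carrier U"
      using balance AA.smult_closed M.smult_closed U.smult_closed by auto
    then show ?thesis using balance by (simp only: tensor_free_diff_closed g)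
  qed
qed

lemma (in assoc_algebra) scalar_mult:
  "r \<in> carrier R \<Longrightarrow> s \<in> carrier R \<Longrightarrow> (r \<odot> \<one>) \<otimes> (s \<odot> \<one>) = (r \<otimes>\<^bsub>R\<^esub> s) \<odot> \<one>"
  by (simp add: smult_mult_left smult_closed smult_assoc)

lemma (in assoc_algebra) scalar_central:
  "r \<in> carrier R \<Longrightarrow> a \<in> carrier A \<Longrightarrow> (r \<odot> \<one>) \<otimes> a = a \<otimes> (r \<odot> \<one>)"
  by (simp add: smult_mult_left smult_mult_right)

lemma tensor_relations_stable:
  assumes M: "left_module A M" and U: "left_module R U" and A: "assoc_algebra R A" and a: "a \<in> carrier A"
    and c: "c \<in> tensor_relations R A M U"
  shows "frag_extend (\<lambda>(x, u). frag_of (a \<odot>\<^bsub>M\<^esub> x, u)) c \<in> tensor_relations R A M U"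
proof -
  interpret M: left_module A M by fact
  interpret U: left_module R U by fact
  interpret AA: assoc_algebra R A by fact
  let ?e = "frag_extend (\<lambda>(x, u). frag_of (a \<odot>\<^bsub>M\<^esub> x, u))"
  from c show ?thesis
  proof (cases rule: tensor_relationsE)
    case 1: (left x y u)
    then have "?e c = frag_of (a \<odot>\<^bsub>M\<^esub> x \<oplus>\<^bsub>M\<^esub> a \<odot>\<^bsub>M\<^esub> y, u) - frag_of (a \<odot>\<^bsub>M\<^esub> x, u) - frag_of (a \<odot>\<^bsub>M\<^esub> y, u)"
      using a by (simp add: frag_extend_diff M.smult_r_distr)
    moreover have "a \<odot>\<^bsub>M\<^esub> x \<in> carrier M" "a \<odot>\<^bsub>M\<^esub> y \<in> carrier M" using 1 a M.smult_closed by auto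
    ultimately show ?thesis using 1(3) unfolding tensor_relations_def by blast
  next
    case 2: (right x u v)
    then have "?e c = frag_of (a \<odot>\<^bsub>M\<^esub> x, u \<oplus>\<^bsub>U\<^esub> v) - frag_of (a \<odot>\<^bsub>M\<^esub> x, u) - frag_of (a \<odot>\<^bsub>M\<^esub> x, v)"
      by (simp add: frag_extend_diff)
    moreover have "a \<odot>\<^bsub>M\<^esub> x \<in> carrier M" using 2 a M.smult_closed by auto
    ultimately show ?thesis using 2(2,3) unfolding tensor_relations_def by blast
  next
    case 3: (balance r x u)
    have r1: "r \<odot>\<^bsub>A\<^esub> \<one>\<^bsub>A\<^esub> \<in> carrier A" using 3 AA.smult_closed by simp
    have "a \<odot>\<^bsub>M\<^esub> ((r \<odot>\<^bsub>A\<^esub> \<one>\<^bsub>A\<^esub>) \<odot>\<^bsub>M\<^esub> x) = (r \<odot>\<^bsub>A\<^esub> \<one>\<^bsub>A\<^esub>) \<odot>\<^bsub>M\<^esub> (a \<odot>\<^bsub>M\<^esub> x)"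
      using 3 a r1 AA.scalar_central[OF 3(1) a] M.smult_assoc by metis
    then have "?e c = frag_of ((r \<odot>\<^bsub>A\<^esub> \<one>\<^bsub>A\<^esub>) \<odot>\<^bsub>M\<^esub> (a \<odot>\<^bsub>M\<^esub> x), u) - frag_of (a \<odot>\<^bsub>M\<^esub> x, r \<odot>\<^bsub>U\<^esub> u)"
      using 3 by (simp add: frag_extend_diff)
    moreover have "a \<odot>\<^bsub>M\<^esub> x \<in> carrier M" using 3 a M.smult_closed by auto
    ultimately show ?thesis using 3(1,3) unfolding tensor_relations_def by blast
  qed
qed

text \<open>
  Modules isomorphic to a tensor product are considered, instead of the tensor product itself, because
  the layers of a filtration are only given up to isomorphism.
\<close>

lemma tensor_parametrisation:
  fixes M :: "('a, 'm) module" and D :: "('a, 'd) module"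
  assumes M: "left_module A M" and U: "left_module R U" and A: "assoc_algebra R A" and D: "left_module A D"
    and iso: "mod_isomorphic A D (tensor R A M U)"
  obtains G where
    "\<And>c. c \<in> carrier (tensor_free M U) \<Longrightarrow> G c \<in> carrier D"
    "\<And>c c'. \<lbrakk>c \<in> carrier (tensor_free M U); c' \<in> carrier (tensor_free M U)\<rbrakk> \<Longrightarrow> G (c + c') = G c \<oplus>\<^bsub>D\<^esub> G c'"
    "\<And>d. d \<in> carrier D \<Longrightarrow> \<exists>c\<in>carrier (tensor_free M U). G c = d"
    "\<And>c. c \<in> carrier (tensor_free M U) \<Longrightarrow>
      G c = \<zero>\<^bsub>D\<^esub> \<longleftrightarrow> c \<in> generate (add_monoid (tensor_free M U)) (tensor_relations R A M U)"
    "\<And>a x u. \<lbrakk>a \<in> carrier A; x \<in> carrier M; u \<in> carrier U\<rbrakk> \<Longrightarrow> G (frag_of (a \<odot>\<^bsub>M\<^esub> x, u)) = a \<odot>\<^bsub>D\<^esub> G (frag_of (x, u))"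
proof -
  interpret M: left_module A M by fact
  interpret D: left_module A D by fact
  let ?F = "tensor_free M U"
  let ?rel = "tensor_relations R A M U"
  let ?H = "generate (add_monoid ?F) ?rel"
  let ?T = "tensor R A M U"
  interpret F: abelian_group ?F by (rule abelian_group_tensor_free)
  note relF = tensor_relations_subset[OF M U A]
  have Hsub: "subgroup ?H (add_monoid ?F)"
    using group.generate_is_subgroup[OF F.a_group] relF by simp
  interpret H: abelian_subgroup ?H ?F
    by (rule abelian_subgroupI3[OF additive_subgroupI[OF Hsub] F.abelian_group_axioms])
  have HF: "?H \<subseteq> carrier ?F" by (rule H.a_subset)
  have T: "carrier ?T = a_rcosets\<^bsub>?F\<^esub> ?H" "add ?T = (\<lambda>C C'. C <+>\<^bsub>?F\<^esub> C')"
    "smult ?T = (\<lambda>a C. \<Union>c\<in>C. ?H +>\<^bsub>?F\<^esub> (a \<odot>\<^bsub>?F\<^esub> c))"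
    by (simp_all add: tensor_def)
  have stable: "a \<odot>\<^bsub>?F\<^esub> c \<in> ?H" if a: "a \<in> carrier A" and c: "c \<in> ?H" for a c
  proof -
    let ?e = "frag_extend (\<lambda>(x, u). frag_of (a \<odot>\<^bsub>M\<^esub> x, u))"
    let ?S = "{c \<in> carrier ?F. ?e c \<in> ?H}"
    have neg: "- x \<in> ?H" if "x \<in> ?H" for x
    proof -
      have "x \<in> carrier ?F" using HF that by blast
      then show ?thesis using H.a_inv_closed[OF that] uminus_tensor_free[of x M U] by simp
    qed
    have "subgroup ?S (add_monoid ?F)"
    proof (rule tensor_subgroupI)
      show "0 \<in> ?S" using H.zero_closed by simp
      show "- x \<in> ?S" if "x \<in> ?S" for x using that neg by (simp add: frag_extend_minus)
      show "x + y \<in> ?S" if "x \<in> ?S" "y \<in> ?S" for x y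
        using that H.a_closed[of "?e x" "?e y"] F.a_closed[of x y] by (simp add: frag_extend_add)
    qed auto
    moreover have "?rel \<subseteq> ?S"
      using relF tensor_relations_stable[OF M U A a] generate.incl[of _ ?rel "add_monoid ?F"] by blast
    ultimately have "?H \<subseteq> ?S" using group.generate_subgroup_incl[OF F.a_group] by blast
    then show ?thesis using c by auto
  qed
  have eq: "?H +>\<^bsub>?F\<^esub> c = ?H +>\<^bsub>?F\<^esub> c'" if "c \<in> ?H +>\<^bsub>?F\<^esub> c'" "c' \<in> carrier ?F" for c c'
    using F.a_repr_independence[OF that Hsub] by simp
  obtain f where f: "f \<in> mod_hom A D ?T" "bij_betw f (carrier D) (carrier ?T)"
    using iso by (auto simp: mod_isomorphic_def mod_iso_def)
  note fl = mod_hom_linear[OF f(1)]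
  have inj: "inj_on f (carrier D)" and img: "f ` carrier D = a_rcosets\<^bsub>?F\<^esub> ?H"
    using f(2) T(1) by (auto simp: bij_betw_def)
  define G where "G c = inv_into (carrier D) f (?H +>\<^bsub>?F\<^esub> c)" for c
  have cos: "?H +>\<^bsub>?F\<^esub> c \<in> f ` carrier D" if "c \<in> carrier ?F" for c
    using that F.a_rcosetsI[OF HF] img by blast
  have Gc: "G c \<in> carrier D" and fG: "f (G c) = ?H +>\<^bsub>?F\<^esub> c" if "c \<in> carrier ?F" for c
    unfolding G_def by (rule inv_into_into[OF cos[OF that]], rule f_inv_into_f[OF cos[OF that]])
  have G1: "G (c + c') = G c \<oplus>\<^bsub>D\<^esub> G c'" if c: "c \<in> carrier ?F" "c' \<in> carrier ?F" for c c'
  proof (rule inj_onD[OF inj])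
    have "c + c' \<in> carrier ?F" using F.a_closed[OF c] by simp
    then show "G (c + c') \<in> carrier D" "f (G (c + c')) = f (G c \<oplus>\<^bsub>D\<^esub> G c')"
      using Gc fG[OF c(1)] fG[OF c(2)] fG[of "c + c'"] linear_map_plus[OF fl Gc[OF c(1)] Gc[OF c(2)]]
        H.a_rcos_sum[OF c] by (simp_all add: T(2))
  qed (use Gc c in auto)
  have G0: "G 0 = \<zero>\<^bsub>D\<^esub>"
    using G1[of 0 0] Gc[of 0] by simp
  have "G c = \<zero>\<^bsub>D\<^esub> \<longleftrightarrow> c \<in> ?H" if c: "c \<in> carrier ?F" for c
  proof -
    have "G c = G 0 \<longleftrightarrow> ?H +>\<^bsub>?F\<^esub> c = ?H +>\<^bsub>?F\<^esub> 0"
      using fG[OF c] fG[of 0] inj_onD[OF inj _ Gc[OF c] Gc[of 0]] by auto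
    also have "?H +>\<^bsub>?F\<^esub> 0 = ?H" using F.a_coset_add_zero[OF HF] by simp
    also have "?H +>\<^bsub>?F\<^esub> c = ?H \<longleftrightarrow> c \<in> ?H"
      using F.a_coset_join1[OF _ c Hsub] F.a_coset_join2[OF c Hsub] by blast
    finally show ?thesis unfolding G0 .
  qed
  moreover have "\<exists>c\<in>carrier ?F. G c = d" if d: "d \<in> carrier D" for d
  proof -
    obtain c where c: "c \<in> carrier ?F" "f d = ?H +>\<^bsub>?F\<^esub> c"
      using img d unfolding A_RCOSETS_def' by blast
    then have "f (G c) = f d" using fG by simp
    then show ?thesis using inj_onD[OF inj _ Gc[OF c(1)] d] c(1) by blast
  qed
  moreover have "G (frag_of (a \<odot>\<^bsub>M\<^esub> x, u)) = a \<odot>\<^bsub>D\<^esub> G (frag_of (x, u))"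
    if a: "a \<in> carrier A" and x: "x \<in> carrier M" and u: "u \<in> carrier U" for a x u
  proof (rule inj_onD[OF inj])
    let ?c = "frag_of (x, u)" and ?ac = "frag_of (a \<odot>\<^bsub>M\<^esub> x, u)"
    have c: "?c \<in> carrier ?F" "?ac \<in> carrier ?F" using a x u M.smult_closed by auto
    \<comment> \<open>Scalar multiplication on the free group is not additive in the scalar, but it respects the
      relations, which suffices for cosets of generators.\<close>
    have one: "?H +>\<^bsub>?F\<^esub> (a \<odot>\<^bsub>?F\<^esub> y) = ?H +>\<^bsub>?F\<^esub> ?ac" if y: "y \<in> ?H +>\<^bsub>?F\<^esub> ?c" for y
    proof (rule eq[OF _ c(2)])
      obtain h where h: "h \<in> ?H" "y = h + ?c" using y by (auto simp: a_r_coset_def')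
      have "a \<odot>\<^bsub>?F\<^esub> y = a \<odot>\<^bsub>?F\<^esub> h + ?ac" using h(2) by (simp add: frag_extend_add)
      then show "a \<odot>\<^bsub>?F\<^esub> y \<in> ?H +>\<^bsub>?F\<^esub> ?ac" using F.a_rcosI[OF stable[OF a h(1)] HF c(2)] by simp
    qed
    have ne: "?c \<in> ?H +>\<^bsub>?F\<^esub> ?c" using F.a_rcosI[OF H.zero_closed HF c(1)] by simp
    have "f (a \<odot>\<^bsub>D\<^esub> G ?c) = (\<Union>y\<in>?H +>\<^bsub>?F\<^esub> ?c. ?H +>\<^bsub>?F\<^esub> (a \<odot>\<^bsub>?F\<^esub> y))"
      using linear_map_scale[OF fl a Gc[OF c(1)]] fG[OF c(1)] by (simp add: T(3))
    also have "\<dots> = ?H +>\<^bsub>?F\<^esub> ?ac" using one ne by blast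
    finally show "f (G ?ac) = f (a \<odot>\<^bsub>D\<^esub> G ?c)" using fG[OF c(2)] by simp
    show "G ?ac \<in> carrier D" "a \<odot>\<^bsub>D\<^esub> G ?c \<in> carrier D" using Gc c a D.smult_closed by auto
  qed
  ultimately show ?thesis using that Gc G1 by blast
qed

text \<open>
  These are the maps that correspond to \<open>A\<close>-linear maps from \<open>M \<otimes>\<^sub>R U\<close> to \<open>N\<close>.
\<close>

definition balanced_map ::
    "('r, 'z) ring_scheme \<Rightarrow> ('r, 'a) module \<Rightarrow> ('a, 'm) module \<Rightarrow> ('r, 'u) module \<Rightarrow> ('a, 'n) module
      \<Rightarrow> ('m \<Rightarrow> 'u \<Rightarrow> 'n) \<Rightarrow> bool" where
  "balanced_map R A M U N t \<longleftrightarrow>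
     (\<forall>x\<in>carrier M. \<forall>u\<in>carrier U. t x u \<in> carrier N) \<and>
     (\<forall>x\<in>carrier M. \<forall>y\<in>carrier M. \<forall>u\<in>carrier U. t (x \<oplus>\<^bsub>M\<^esub> y) u = t x u \<oplus>\<^bsub>N\<^esub> t y u) \<and>
     (\<forall>x\<in>carrier M. \<forall>u\<in>carrier U. \<forall>v\<in>carrier U. t x (u \<oplus>\<^bsub>U\<^esub> v) = t x u \<oplus>\<^bsub>N\<^esub> t x v) \<and>
     (\<forall>r\<in>carrier R. \<forall>x\<in>carrier M. \<forall>u\<in>carrier U. t ((r \<odot>\<^bsub>A\<^esub> \<one>\<^bsub>A\<^esub>) \<odot>\<^bsub>M\<^esub> x) u = t x (r \<odot>\<^bsub>U\<^esub> u)) \<and>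
     (\<forall>a\<in>carrier A. \<forall>x\<in>carrier M. \<forall>u\<in>carrier U. t (a \<odot>\<^bsub>M\<^esub> x) u = a \<odot>\<^bsub>N\<^esub> t x u)"

lemma balanced_mapD:
  assumes "balanced_map R A M U N t"
  shows "\<And>x u. x \<in> carrier M \<Longrightarrow> u \<in> carrier U \<Longrightarrow> t x u \<in> carrier N"
    and "\<And>x y u. x \<in> carrier M \<Longrightarrow> y \<in> carrier M \<Longrightarrow> u \<in> carrier U \<Longrightarrow> t (x \<oplus>\<^bsub>M\<^esub> y) u = t x u \<oplus>\<^bsub>N\<^esub> t y u"
    and "\<And>x u v. x \<in> carrier M \<Longrightarrow> u \<in> carrier U \<Longrightarrow> v \<in> carrier U \<Longrightarrow> t x (u \<oplus>\<^bsub>U\<^esub> v) = t x u \<oplus>\<^bsub>N\<^esub> t x v"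
    and "\<And>r x u. r \<in> carrier R \<Longrightarrow> x \<in> carrier M \<Longrightarrow> u \<in> carrier U \<Longrightarrow>
      t ((r \<odot>\<^bsub>A\<^esub> \<one>\<^bsub>A\<^esub>) \<odot>\<^bsub>M\<^esub> x) u = t x (r \<odot>\<^bsub>U\<^esub> u)"
    and "\<And>a x u. a \<in> carrier A \<Longrightarrow> x \<in> carrier M \<Longrightarrow> u \<in> carrier U \<Longrightarrow> t (a \<odot>\<^bsub>M\<^esub> x) u = a \<odot>\<^bsub>N\<^esub> t x u"
  using assms unfolding balanced_map_def by blast+

text \<open>
  The kernel of the extension is a subgroup containing the defining relations of the tensor product.
\<close>

lemma free_extension:
  fixes N :: "('a, 'n) module" and t :: "'m \<Rightarrow> 'u \<Rightarrow> 'n"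
  assumes M: "left_module A M" and U: "left_module R U" and A: "assoc_algebra R A" and N: "left_module A N"
    and t: "balanced_map R A M U N t"
  obtains \<phi> where
    "\<And>c. c \<in> carrier (tensor_free M U) \<Longrightarrow> \<phi> c \<in> carrier N"
    "\<And>c c'. \<lbrakk>c \<in> carrier (tensor_free M U); c' \<in> carrier (tensor_free M U)\<rbrakk> \<Longrightarrow> \<phi> (c + c') = \<phi> c \<oplus>\<^bsub>N\<^esub> \<phi> c'"
    "\<And>c c'. \<lbrakk>c \<in> carrier (tensor_free M U); c' \<in> carrier (tensor_free M U)\<rbrakk> \<Longrightarrow> \<phi> (c - c') = \<phi> c \<ominus>\<^bsub>N\<^esub> \<phi> c'"
    "\<And>x u. \<lbrakk>x \<in> carrier M; u \<in> carrier U\<rbrakk> \<Longrightarrow> \<phi> (frag_of (x, u)) = t x u"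
    "\<And>c. c \<in> generate (add_monoid (tensor_free M U)) (tensor_relations R A M U) \<Longrightarrow> \<phi> c = \<zero>\<^bsub>N\<^esub>"
proof -
  interpret M: left_module A M by fact
  interpret U: left_module R U by fact
  interpret N: left_module A N by fact
  interpret AA: assoc_algebra R A by fact
  let ?F = "tensor_free M U"
  let ?rel = "tensor_relations R A M U"
  interpret F: abelian_group ?F by (rule abelian_group_tensor_free)
  note tD = balanced_mapD[OF t]
  have fr: "frag_of (x, u) \<in> carrier ?F" if "x \<in> carrier M" "u \<in> carrier U" for x u using that by simp
  have im: "(\<lambda>(x, u). t x u) ` (carrier M \<times> carrier U) \<subseteq> carrier (add_monoid N)" using tD(1) by auto
  obtain \<phi> where h: "\<phi> \<in> hom (free_Abelian_group (carrier M \<times> carrier U)) (add_monoid N)"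
    "\<And>x. x \<in> carrier M \<times> carrier U \<Longrightarrow> \<phi> (frag_of x) = (\<lambda>(x, u). t x u) x"
    by (rule comm_group.free_Abelian_group_universal[OF N.M.a_comm_group im]) (rule that)
  have \<phi>c: "\<phi> c \<in> carrier N" if "c \<in> carrier ?F" for c
    using hom_in_carrier[OF h(1), of c] that by simp
  have \<phi>a: "\<phi> (c + c') = \<phi> c \<oplus>\<^bsub>N\<^esub> \<phi> c'" if "c \<in> carrier ?F" "c' \<in> carrier ?F" for c c'
    using hom_mult[OF h(1), of c c'] that by simp
  have \<phi>g: "\<phi> (frag_of (x, u)) = t x u" if "x \<in> carrier M" "u \<in> carrier U" for x u
    using h(2)[of "(x, u)"] that by simp
  have \<phi>0: "\<phi> 0 = \<zero>\<^bsub>N\<^esub>" using \<phi>a[of 0 0] \<phi>c[of 0] by simp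
  have \<phi>d: "\<phi> (c - c') = \<phi> c \<ominus>\<^bsub>N\<^esub> \<phi> c'" if c: "c \<in> carrier ?F" "c' \<in> carrier ?F" for c c'
  proof -
    have "\<phi> c = \<phi> (c - c') \<oplus>\<^bsub>N\<^esub> \<phi> c'" using \<phi>a[OF tensor_free_diff_closed[OF c] c(2)] by simp
    then show ?thesis
      using \<phi>c[OF tensor_free_diff_closed[OF c]] \<phi>c[OF c(2)] by (simp add: N.M.minus_eq N.M.a_assoc N.M.r_neg)
  qed
  let ?S = "{c \<in> carrier ?F. \<phi> c = \<zero>\<^bsub>N\<^esub>}"
  have "subgroup ?S (add_monoid ?F)"
  proof (rule tensor_subgroupI)
    show "0 \<in> ?S" using \<phi>0 by simp
    show "- x \<in> ?S" if "x \<in> ?S" for x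
      using that \<phi>d[of 0 x] \<phi>0 by (simp add: N.M.minus_eq_zero_iff)
    show "x + y \<in> ?S" if "x \<in> ?S" "y \<in> ?S" for x y
      using that \<phi>a[of x y] F.a_closed[of x y] by simp
  qed auto
  moreover have "?rel \<subseteq> ?S"
  proof
    fix c assume c: "c \<in> ?rel"
    then have cF: "c \<in> carrier ?F" using tensor_relations_subset[OF M U A] by blast
    from c have "\<phi> c = \<zero>\<^bsub>N\<^esub>"
    proof (cases rule: tensor_relationsE)
      case 1: (left x y u)
      have "\<phi> c = \<phi> (frag_of (x \<oplus>\<^bsub>M\<^esub> y, u)) \<ominus>\<^bsub>N\<^esub> \<phi> (frag_of (x, u)) \<ominus>\<^bsub>N\<^esub> \<phi> (frag_of (y, u))"
        unfolding 1(4) using 1 by (simp only: \<phi>d tensor_free_diff_closed fr M.M.a_closed)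
      also have "\<dots> = (t x u \<oplus>\<^bsub>N\<^esub> t y u) \<ominus>\<^bsub>N\<^esub> t x u \<ominus>\<^bsub>N\<^esub> t y u"
        using 1 by (simp add: \<phi>g tD(2))
      finally show ?thesis using N.M.add_minus_both[OF tD(1)[OF 1(1,3)] tD(1)[OF 1(2,3)]] by simp
    next
      case 2: (right x u v)
      have "\<phi> c = \<phi> (frag_of (x, u \<oplus>\<^bsub>U\<^esub> v)) \<ominus>\<^bsub>N\<^esub> \<phi> (frag_of (x, u)) \<ominus>\<^bsub>N\<^esub> \<phi> (frag_of (x, v))"
        unfolding 2(4) using 2 by (simp only: \<phi>d tensor_free_diff_closed fr U.M.a_closed)
      also have "\<dots> = (t x u \<oplus>\<^bsub>N\<^esub> t x v) \<ominus>\<^bsub>N\<^esub> t x u \<ominus>\<^bsub>N\<^esub> t x v"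
        using 2 by (simp add: \<phi>g tD(3))
      finally show ?thesis using N.M.add_minus_both[OF tD(1)[OF 2(1,2)] tD(1)[OF 2(1,3)]] by simp
    next
      case 3: (balance r x u)
      have rx: "(r \<odot>\<^bsub>A\<^esub> \<one>\<^bsub>A\<^esub>) \<odot>\<^bsub>M\<^esub> x \<in> carrier M" "r \<odot>\<^bsub>U\<^esub> u \<in> carrier U"
        using 3 AA.smult_closed M.smult_closed U.smult_closed by auto
      have "\<phi> c = \<phi> (frag_of ((r \<odot>\<^bsub>A\<^esub> \<one>\<^bsub>A\<^esub>) \<odot>\<^bsub>M\<^esub> x, u)) \<ominus>\<^bsub>N\<^esub> \<phi> (frag_of (x, r \<odot>\<^bsub>U\<^esub> u))"
        unfolding 3(4) by (rule \<phi>d[OF fr fr]) (use 3 rx in auto)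
      then show ?thesis
        using \<phi>g[OF rx(1) 3(3)] \<phi>g[OF 3(2) rx(2)] tD(1)[OF rx(1) 3(3)] tD(4)[OF 3(1-3)]
        by (simp add: N.M.minus_eq_zero_iff)
    qed
    then show "c \<in> ?S" using cF by blast
  qed
  ultimately have "generate (add_monoid ?F) ?rel \<subseteq> ?S"
    using group.generate_subgroup_incl[OF F.a_group] by blast
  then have "\<phi> c = \<zero>\<^bsub>N\<^esub>" if "c \<in> generate (add_monoid ?F) ?rel" for c using that by blast
  with \<phi>c \<phi>a \<phi>d \<phi>g show ?thesis by (rule that)
qed

text \<open>
  Uniqueness is only stated for maps from \<open>D\<close> to itself, the case in which a composite has to be
  recognised as the identity.
\<close>

lemma tensor_universal_property:
  fixes M :: "('a, 'm) module" and U :: "('r, 'u) module" and D :: "('a, 'd) module"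
  assumes M: "left_module A M" and U: "left_module R U" and A: "assoc_algebra R A" and D: "left_module A D"
    and iso: "mod_isomorphic A D (tensor R A M U)"
  obtains \<tau> where "balanced_map R A M U D \<tau>"
    "\<And>f g d. \<lbrakk>linear_map A D D f; linear_map A D D g;
      \<forall>x\<in>carrier M. \<forall>u\<in>carrier U. f (\<tau> x u) = g (\<tau> x u); d \<in> carrier D\<rbrakk> \<Longrightarrow> f d = g d"
    "\<And>(N :: ('a, 'n) module) t. \<lbrakk>left_module A N; balanced_map R A M U N t\<rbrakk> \<Longrightarrow>
      \<exists>h. linear_map A D N h \<and> (\<forall>x\<in>carrier M. \<forall>u\<in>carrier U. h (\<tau> x u) = t x u)"
proof -
  interpret M: left_module A M by fact
  interpret U: left_module R U by fact
  interpret D: left_module A D by fact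
  interpret AA: assoc_algebra R A by fact
  let ?F = "tensor_free M U"
  let ?rel = "tensor_relations R A M U"
  let ?H = "generate (add_monoid ?F) ?rel"
  interpret F: abelian_group ?F by (rule abelian_group_tensor_free)
  obtain G where Gc: "\<And>c. c \<in> carrier ?F \<Longrightarrow> G c \<in> carrier D"
    and G1: "\<And>c c'. \<lbrakk>c \<in> carrier ?F; c' \<in> carrier ?F\<rbrakk> \<Longrightarrow> G (c + c') = G c \<oplus>\<^bsub>D\<^esub> G c'"
    and Gs: "\<And>d. d \<in> carrier D \<Longrightarrow> \<exists>c\<in>carrier ?F. G c = d"
    and GH: "\<And>c. c \<in> carrier ?F \<Longrightarrow> G c = \<zero>\<^bsub>D\<^esub> \<longleftrightarrow> c \<in> ?H"
    and Gsc: "\<And>a x u. \<lbrakk>a \<in> carrier A; x \<in> carrier M; u \<in> carrier U\<rbrakk> \<Longrightarrow>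
      G (frag_of (a \<odot>\<^bsub>M\<^esub> x, u)) = a \<odot>\<^bsub>D\<^esub> G (frag_of (x, u))"
    by (rule tensor_parametrisation[OF M U A D iso]) (rule that)
  have G0: "G 0 = \<zero>\<^bsub>D\<^esub>" using G1[of 0 0] Gc[of 0] by simp
  have Fd: "c - c' \<in> carrier ?F" if "c \<in> carrier ?F" "c' \<in> carrier ?F" for c c'
    by (rule tensor_free_diff_closed[OF that])
  have Gd: "G (c - c') = G c \<ominus>\<^bsub>D\<^esub> G c'" if c: "c \<in> carrier ?F" "c' \<in> carrier ?F" for c c'
  proof -
    have "G c = G (c - c') \<oplus>\<^bsub>D\<^esub> G c'" using G1[OF Fd[OF c] c(2)] by simp
    then show "G (c - c') = G c \<ominus>\<^bsub>D\<^esub> G c'"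
      using Gc[OF Fd[OF c]] Gc[OF c(2)] by (simp add: D.M.minus_eq D.M.a_assoc D.M.r_neg)
  qed
  have fr: "frag_of (x, u) \<in> carrier ?F" if "x \<in> carrier M" "u \<in> carrier U" for x u using that by simp
  have Geq: "G c = G c'" if c: "c \<in> carrier ?F" "c' \<in> carrier ?F" and r: "c - c' \<in> ?rel" for c c'
  proof -
    have "G (c - c') = \<zero>\<^bsub>D\<^esub>" using GH[OF Fd[OF c]] generate.incl[OF r, of "add_monoid ?F"] by blast
    then show ?thesis using Gd[OF c] Gc[OF c(1)] Gc[OF c(2)] by (simp add: D.M.minus_eq_zero_iff)
  qed
  define \<tau> where "\<tau> x u = G (frag_of (x, u))" for x u
  have bal: "balanced_map R A M U D \<tau>"
    unfolding balanced_map_def \<tau>_def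
  proof (intro conjI ballI)
    fix x u assume "x \<in> carrier M" "u \<in> carrier U"
    then show "G (frag_of (x, u)) \<in> carrier D" by (intro Gc fr)
  next
    fix x y u assume xy: "x \<in> carrier M" "y \<in> carrier M" and u: "u \<in> carrier U"
    have "frag_of (x \<oplus>\<^bsub>M\<^esub> y, u) - frag_of (x, u) - frag_of (y, u) \<in> ?rel"
      using xy u unfolding tensor_relations_def by blast
    then have "G (frag_of (x \<oplus>\<^bsub>M\<^esub> y, u)) = G (frag_of (x, u) + frag_of (y, u))"
      using F.a_closed[OF fr[OF xy(1) u] fr[OF xy(2) u]]
      by (intro Geq fr M.M.a_closed xy u) (simp_all add: diff_diff_eq)
    then show "G (frag_of (x \<oplus>\<^bsub>M\<^esub> y, u)) = G (frag_of (x, u)) \<oplus>\<^bsub>D\<^esub> G (frag_of (y, u))"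
      using G1[OF fr[OF xy(1) u] fr[OF xy(2) u]] by simp
  next
    fix x u v assume x: "x \<in> carrier M" and uv: "u \<in> carrier U" "v \<in> carrier U"
    have "frag_of (x, u \<oplus>\<^bsub>U\<^esub> v) - frag_of (x, u) - frag_of (x, v) \<in> ?rel"
      using x uv unfolding tensor_relations_def by blast
    then have "G (frag_of (x, u \<oplus>\<^bsub>U\<^esub> v)) = G (frag_of (x, u) + frag_of (x, v))"
      using F.a_closed[OF fr[OF x uv(1)] fr[OF x uv(2)]]
      by (intro Geq fr U.M.a_closed x uv) (simp_all add: diff_diff_eq)
    then show "G (frag_of (x, u \<oplus>\<^bsub>U\<^esub> v)) = G (frag_of (x, u)) \<oplus>\<^bsub>D\<^esub> G (frag_of (x, v))"
      using G1[OF fr[OF x uv(1)] fr[OF x uv(2)]] by simp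
  next
    fix r x u assume rxu: "r \<in> carrier R" "x \<in> carrier M" "u \<in> carrier U"
    have r1: "r \<odot>\<^bsub>A\<^esub> \<one>\<^bsub>A\<^esub> \<in> carrier A" using rxu(1) AA.smult_closed by simp
    show "G (frag_of ((r \<odot>\<^bsub>A\<^esub> \<one>\<^bsub>A\<^esub>) \<odot>\<^bsub>M\<^esub> x, u)) = G (frag_of (x, r \<odot>\<^bsub>U\<^esub> u))"
    proof (rule Geq)
      show "frag_of ((r \<odot>\<^bsub>A\<^esub> \<one>\<^bsub>A\<^esub>) \<odot>\<^bsub>M\<^esub> x, u) - frag_of (x, r \<odot>\<^bsub>U\<^esub> u) \<in> ?rel"
        using rxu unfolding tensor_relations_def by blast
    qed (intro fr M.smult_closed U.smult_closed r1 rxu)+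
  qed (rule Gsc)
  have ind: "Q d" if d: "d \<in> carrier D" and Q0: "Q \<zero>\<^bsub>D\<^esub>"
    and Qd: "\<And>x y. \<lbrakk>x \<in> carrier D; y \<in> carrier D; Q x; Q y\<rbrakk> \<Longrightarrow> Q (x \<ominus>\<^bsub>D\<^esub> y)"
    and Qg: "\<And>x u. \<lbrakk>x \<in> carrier M; u \<in> carrier U\<rbrakk> \<Longrightarrow> Q (\<tau> x u)" for Q d
  proof -
    obtain c where c: "c \<in> carrier ?F" "G c = d" using Gs[OF d] by blast
    have "Q (G c)"
    proof (rule free_Abelian_group_induct[of c "carrier M \<times> carrier U"])
      show "Q (G (x - y))" if "Poly_Mapping.keys x \<subseteq> carrier M \<times> carrier U" "Poly_Mapping.keys y \<subseteq> carrier M \<times> carrier U"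
          "Q (G x)" "Q (G y)" for x y
      proof -
        have F: "x \<in> carrier ?F" "y \<in> carrier ?F" using that by auto
        show ?thesis unfolding Gd[OF F] by (intro Qd Gc F that)
      qed
    qed (use c G0 Q0 Qg in \<open>auto simp: \<tau>_def\<close>)
    then show ?thesis using c by simp
  qed
  have unique: "f d = g d" if f: "linear_map A D D f" and g: "linear_map A D D g"
    and fg: "\<forall>x\<in>carrier M. \<forall>u\<in>carrier U. f (\<tau> x u) = g (\<tau> x u)" and d: "d \<in> carrier D" for f g d
  proof (rule ind[OF d, where Q = "\<lambda>d. f d = g d"])
    note DG = D.M.abelian_group_axioms
    show "f \<zero>\<^bsub>D\<^esub> = g \<zero>\<^bsub>D\<^esub>" using linear_map_zero[OF DG DG f] linear_map_zero[OF DG DG g] by simp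
    show "f (x \<ominus>\<^bsub>D\<^esub> y) = g (x \<ominus>\<^bsub>D\<^esub> y)" if "x \<in> carrier D" "y \<in> carrier D" "f x = g x" "f y = g y" for x y
      using linear_map_diff[OF DG DG f that(1,2)] linear_map_diff[OF DG DG g that(1,2)] that by simp
  qed (use fg in blast)
  have exists: "\<exists>h. linear_map A D N h \<and> (\<forall>x\<in>carrier M. \<forall>u\<in>carrier U. h (\<tau> x u) = t x u)"
    if N: "left_module A N" and t: "balanced_map R A M U N t" for N :: "('a, 'n) module" and t
  proof -
    interpret N: left_module A N by fact
    note tD = balanced_mapD[OF t]
    obtain \<phi> where \<phi>c: "\<And>c. c \<in> carrier ?F \<Longrightarrow> \<phi> c \<in> carrier N"
      and \<phi>a: "\<And>c c'. \<lbrakk>c \<in> carrier ?F; c' \<in> carrier ?F\<rbrakk> \<Longrightarrow> \<phi> (c + c') = \<phi> c \<oplus>\<^bsub>N\<^esub> \<phi> c'"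
      and \<phi>d: "\<And>c c'. \<lbrakk>c \<in> carrier ?F; c' \<in> carrier ?F\<rbrakk> \<Longrightarrow> \<phi> (c - c') = \<phi> c \<ominus>\<^bsub>N\<^esub> \<phi> c'"
      and \<phi>g: "\<And>x u. \<lbrakk>x \<in> carrier M; u \<in> carrier U\<rbrakk> \<Longrightarrow> \<phi> (frag_of (x, u)) = t x u"
      and \<phi>H: "\<And>c. c \<in> ?H \<Longrightarrow> \<phi> c = \<zero>\<^bsub>N\<^esub>"
      by (rule free_extension[OF M U A N t]) (rule that)
    define h where "h d = \<phi> (SOME c. c \<in> carrier ?F \<and> G c = d)" for d
    have hG: "h (G c) = \<phi> c" if c: "c \<in> carrier ?F" for c
    proof -
      let ?c = "SOME c'. c' \<in> carrier ?F \<and> G c' = G c"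
      have c': "?c \<in> carrier ?F" "G ?c = G c"
        using someI[of "\<lambda>c'. c' \<in> carrier ?F \<and> G c' = G c" c] c by auto
      have "G (?c - c) = \<zero>\<^bsub>D\<^esub>" using Gd[OF c'(1) c] c'(2) Gc[OF c] by (simp add: D.M.minus_eq_zero_iff)
      then have "?c - c \<in> ?H" by (rule iffD1[OF GH[OF Fd[OF c'(1) c]]])
      from \<phi>H[OF this] have "\<phi> ?c \<ominus>\<^bsub>N\<^esub> \<phi> c = \<zero>\<^bsub>N\<^esub>" unfolding \<phi>d[OF c'(1) c] .
      then show ?thesis using N.M.minus_eq_zero_iff[OF \<phi>c[OF c'(1)] \<phi>c[OF c]] by (simp add: h_def)
    qed
    have hc: "h d \<in> carrier N" if d: "d \<in> carrier D" for d
    proof -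
      obtain c where c: "c \<in> carrier ?F" "G c = d" using Gs[OF d] by blast
      show ?thesis using hG[OF c(1)] \<phi>c[OF c(1)] c(2) by simp
    qed
    have hadd: "h (x \<oplus>\<^bsub>D\<^esub> y) = h x \<oplus>\<^bsub>N\<^esub> h y" if xy: "x \<in> carrier D" "y \<in> carrier D" for x y
    proof -
      obtain c where c: "c \<in> carrier ?F" "G c = x" using Gs[OF xy(1)] by blast
      obtain c' where c': "c' \<in> carrier ?F" "G c' = y" using Gs[OF xy(2)] by blast
      have "c + c' \<in> carrier ?F" using F.a_closed[OF c(1) c'(1)] by simp
      from hG[OF this] show ?thesis
        using G1[OF c(1) c'(1)] hG[OF c(1)] hG[OF c'(1)] \<phi>a[OF c(1) c'(1)] c(2) c'(2) by simp
    qed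
    have h0: "h \<zero>\<^bsub>D\<^esub> = \<zero>\<^bsub>N\<^esub>" using hadd[of "\<zero>\<^bsub>D\<^esub>" "\<zero>\<^bsub>D\<^esub>"] hc[of "\<zero>\<^bsub>D\<^esub>"] by simp
    have hd: "h (x \<ominus>\<^bsub>D\<^esub> y) = h x \<ominus>\<^bsub>N\<^esub> h y" if xy: "x \<in> carrier D" "y \<in> carrier D" for x y
    proof -
      have "h x = h (x \<ominus>\<^bsub>D\<^esub> y) \<oplus>\<^bsub>N\<^esub> h y"
        using hadd[OF D.M.minus_closed[OF xy] xy(2)] xy by (simp add: D.M.minus_add_cancel)
      then show ?thesis using hc[OF D.M.minus_closed[OF xy]] hc[OF xy(2)]
        by (simp add: N.M.minus_eq N.M.a_assoc N.M.r_neg)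
    qed
    have h\<tau>: "h (\<tau> x u) = t x u" if "x \<in> carrier M" "u \<in> carrier U" for x u
      using hG[OF fr[OF that]] \<phi>g[OF that] by (simp add: \<tau>_def)
    have "linear_map A D N h"
    proof (rule linear_mapI)
      fix a d assume a: "a \<in> carrier A" and d: "d \<in> carrier D"
      show "h (a \<odot>\<^bsub>D\<^esub> d) = a \<odot>\<^bsub>N\<^esub> h d"
      proof (rule ind[OF d, where Q = "\<lambda>d. h (a \<odot>\<^bsub>D\<^esub> d) = a \<odot>\<^bsub>N\<^esub> h d"])
        show "h (a \<odot>\<^bsub>D\<^esub> \<zero>\<^bsub>D\<^esub>) = a \<odot>\<^bsub>N\<^esub> h \<zero>\<^bsub>D\<^esub>"
          using a h0 by (simp add: D.smult_zero_right N.smult_zero_right)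
      next
        fix x y assume xy: "x \<in> carrier D" "y \<in> carrier D"
          and eq: "h (a \<odot>\<^bsub>D\<^esub> x) = a \<odot>\<^bsub>N\<^esub> h x" "h (a \<odot>\<^bsub>D\<^esub> y) = a \<odot>\<^bsub>N\<^esub> h y"
        have "a \<odot>\<^bsub>D\<^esub> (x \<ominus>\<^bsub>D\<^esub> y) = a \<odot>\<^bsub>D\<^esub> x \<ominus>\<^bsub>D\<^esub> a \<odot>\<^bsub>D\<^esub> y"
          using a xy by (simp add: D.M.minus_eq D.smult_r_distr D.smult_minus_right)
        then have "h (a \<odot>\<^bsub>D\<^esub> (x \<ominus>\<^bsub>D\<^esub> y)) = a \<odot>\<^bsub>N\<^esub> h x \<ominus>\<^bsub>N\<^esub> a \<odot>\<^bsub>N\<^esub> h y"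
          using hd[OF D.smult_closed[OF a xy(1)] D.smult_closed[OF a xy(2)]] eq by simp
        then show "h (a \<odot>\<^bsub>D\<^esub> (x \<ominus>\<^bsub>D\<^esub> y)) = a \<odot>\<^bsub>N\<^esub> h (x \<ominus>\<^bsub>D\<^esub> y)"
          unfolding hd[OF xy]
          using a hc[OF xy(1)] hc[OF xy(2)] by (simp add: N.M.minus_eq N.smult_r_distr N.smult_minus_right)
      next
        fix x u assume xu: "x \<in> carrier M" "u \<in> carrier U"
        have ax: "a \<odot>\<^bsub>M\<^esub> x \<in> carrier M" using a xu M.smult_closed by blast
        show "h (a \<odot>\<^bsub>D\<^esub> \<tau> x u) = a \<odot>\<^bsub>N\<^esub> h (\<tau> x u)"
          using balanced_mapD(5)[OF bal a xu] tD(5)[OF a xu] h\<tau>[OF ax xu(2)] h\<tau>[OF xu] by simp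
      qed
    qed (use hadd hc in auto)
    then show ?thesis using h\<tau> by blast
  qed
  show ?thesis
  proof (rule that[of \<tau>])
    show "f d = g d" if "linear_map A D D f" "linear_map A D D g"
      "\<forall>x\<in>carrier M. \<forall>u\<in>carrier U. f (\<tau> x u) = g (\<tau> x u)" "d \<in> carrier D" for f g d
      by (rule unique[OF that])
  qed (fact bal, rule exists)
qed

text \<open>
  If the identity of \<open>U\<close> is \<open>u = \<Sum> \<alpha> k u \<cdot> e k\<close> with linear forms \<open>\<alpha> k\<close>, then
  \<open>x \<otimes> u = \<Sum> (\<alpha> k u \<cdot> x) \<otimes> e k\<close>. Thus the identity of \<open>M \<otimes> U\<close> is the sum of the composites of
  \<open>x \<otimes> u \<mapsto> \<alpha> k u \<cdot> x\<close> with \<open>x \<mapsto> x \<otimes> e k\<close>, and \<open>M \<otimes> U\<close> is a direct summand of a power of \<open>M\<close>.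
\<close>

lemma factors_of_tensor:
  fixes M :: "('a, 'm) module" and D :: "('a, 'd) module"
  assumes M: "left_module A M" and U: "fg_projective R U" and A: "assoc_algebra R A" and D: "left_module A D"
    and iso: "mod_isomorphic A D (tensor R A M U)"
  shows "factors_through A {()} (\<lambda>_. M) D D (\<lambda>x. x)"
proof -
  note UM = fg_projectiveD[OF U]
  interpret M: left_module A M by fact
  interpret U: left_module R U by (rule UM)
  interpret D: left_module A D by fact
  interpret AA: assoc_algebra R A by fact
  let ?R = "regular_module R"
  obtain \<tau> where \<tau>: "balanced_map R A M U D \<tau>"
    and unique: "\<And>f g d. \<lbrakk>linear_map A D D f; linear_map A D D g;
      \<forall>x\<in>carrier M. \<forall>u\<in>carrier U. f (\<tau> x u) = g (\<tau> x u); d \<in> carrier D\<rbrakk> \<Longrightarrow> f d = g d"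
    and univ: "\<And>(N :: ('a, 'm) module) t. \<lbrakk>left_module A N; balanced_map R A M U N t\<rbrakk> \<Longrightarrow>
      \<exists>h. linear_map A D N h \<and> (\<forall>x\<in>carrier M. \<forall>u\<in>carrier U. h (\<tau> x u) = t x u)"
    by (rule tensor_universal_property[OF M UM A D iso]) (rule that)
  note \<tau>D = balanced_mapD[OF \<tau>]
  have sc: "r \<odot>\<^bsub>A\<^esub> \<one>\<^bsub>A\<^esub> \<in> carrier A" if "r \<in> carrier R" for r using that AA.smult_closed by simp
  have RM: "left_module R ?R" by (rule left_module_regular[OF left_moduleD(1)[OF UM]])
  have "factors_through R {()} (\<lambda>_. ?R) U U (\<lambda>x. x)"
    using U unfolding fg_projective_def direct_summand_copies_iff[OF left_moduleD(1)[OF UM] RM UM] by blast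
  from factors_family[OF left_moduleD(3)[OF UM] this] obtain n :: nat and \<alpha> \<beta> where
    ab: "\<forall>k<n. linear_map R U ?R (\<alpha> k) \<and> linear_map R ?R U (\<beta> k)" and
    sum: "\<forall>u\<in>carrier U. u = (\<Oplus>\<^bsub>U\<^esub>k\<in>{..<n}. \<beta> k (\<alpha> k u))"
    by auto
  have \<alpha>c: "\<alpha> k u \<in> carrier R" if "k < n" "u \<in> carrier U" for k u
    using ab that linear_map_closed[of R U ?R "\<alpha> k" u] by simp
  define e where "e k = \<beta> k \<one>\<^bsub>R\<^esub>" for k
  have e: "e k \<in> carrier U" if "k < n" for k
    using ab that linear_map_closed[of R ?R U "\<beta> k" "\<one>\<^bsub>R\<^esub>"] by (simp add: e_def)
  have \<beta>: "\<beta> k r = r \<odot>\<^bsub>U\<^esub> e k" if "k < n" "r \<in> carrier R" for k r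
    using ab that linear_map_scale[of R ?R U "\<beta> k" r "\<one>\<^bsub>R\<^esub>"] by (simp add: e_def)
  define t where "t k x u = (\<alpha> k u \<odot>\<^bsub>A\<^esub> \<one>\<^bsub>A\<^esub>) \<odot>\<^bsub>M\<^esub> x" for k x u
  have t: "balanced_map R A M U M (t k)" if k: "k < n" for k
    unfolding balanced_map_def
  proof (intro conjI ballI)
    fix x u assume "x \<in> carrier M" "u \<in> carrier U"
    then show "t k x u \<in> carrier M" unfolding t_def by (intro M.smult_closed sc \<alpha>c k)
  next
    fix x y u assume "x \<in> carrier M" "y \<in> carrier M" "u \<in> carrier U"
    then show "t k (x \<oplus>\<^bsub>M\<^esub> y) u = t k x u \<oplus>\<^bsub>M\<^esub> t k y u" by (simp add: t_def M.smult_r_distr sc \<alpha>c k)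
  next
    fix x u v assume x: "x \<in> carrier M" and uv: "u \<in> carrier U" "v \<in> carrier U"
    have "\<alpha> k (u \<oplus>\<^bsub>U\<^esub> v) = \<alpha> k u \<oplus>\<^bsub>R\<^esub> \<alpha> k v"
      using linear_map_plus[of R U ?R "\<alpha> k" u v] ab k uv by simp
    then show "t k x (u \<oplus>\<^bsub>U\<^esub> v) = t k x u \<oplus>\<^bsub>M\<^esub> t k x v"
      using x uv by (simp add: t_def AA.smult_l_distr M.smult_l_distr sc \<alpha>c k)
  next
    fix r x u assume r: "r \<in> carrier R" and xu: "x \<in> carrier M" "u \<in> carrier U"
    have "\<alpha> k (r \<odot>\<^bsub>U\<^esub> u) = r \<otimes>\<^bsub>R\<^esub> \<alpha> k u"
      using linear_map_scale[of R U ?R "\<alpha> k" r u] ab k r xu by simp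
    also have "\<dots> = \<alpha> k u \<otimes>\<^bsub>R\<^esub> r" using r \<alpha>c[OF k xu(2)] by (rule AA.R.m_comm)
    finally show "t k ((r \<odot>\<^bsub>A\<^esub> \<one>\<^bsub>A\<^esub>) \<odot>\<^bsub>M\<^esub> x) u = t k x (r \<odot>\<^bsub>U\<^esub> u)"
      using AA.scalar_mult[OF \<alpha>c[OF k xu(2)] r] M.smult_assoc[OF sc[OF \<alpha>c[OF k xu(2)]] sc[OF r] xu(1)]
      by (simp add: t_def)
  next
    fix a x u assume a: "a \<in> carrier A" and xu: "x \<in> carrier M" "u \<in> carrier U"
    show "t k (a \<odot>\<^bsub>M\<^esub> x) u = a \<odot>\<^bsub>M\<^esub> t k x u"
      using M.smult_assoc[OF sc[OF \<alpha>c[OF k xu(2)]] a xu(1)] M.smult_assoc[OF a sc[OF \<alpha>c[OF k xu(2)]] xu(1)]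
        AA.scalar_central[OF \<alpha>c[OF k xu(2)] a] by (simp add: t_def)
  qed
  define extends where "extends k h \<longleftrightarrow> linear_map A D M h \<and> (\<forall>x\<in>carrier M. \<forall>u\<in>carrier U. h (\<tau> x u) = t k x u)" for k h
  have "\<exists>h. extends k h" if "k < n" for k
    unfolding extends_def by (rule univ[OF M t[OF that]])
  then have "\<forall>k. \<exists>h. k < n \<longrightarrow> extends k h" by blast
  from choice[OF this] obtain i where i: "\<And>k. k < n \<Longrightarrow> extends k (i k)" by blast
  have il: "linear_map A D M (i k)" and i\<tau>: "\<And>x u. x \<in> carrier M \<Longrightarrow> u \<in> carrier U \<Longrightarrow> i k (\<tau> x u) = t k x u"
    if "k < n" for k
    using i[OF that] by (simp_all add: extends_def)
  have pl: "linear_map A M D (\<lambda>x. \<tau> x (e k))" if k: "k < n" for k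
    by (rule linear_mapI) (use \<tau>D e[OF k] in auto)
  define S where "S d = (\<Oplus>\<^bsub>D\<^esub>k\<in>{..<n}. \<tau> (i k d) (e k))" for d
  have Sf: "factors_through A {()} (\<lambda>_. M) D D S"
    unfolding S_def
  proof (rule factors_finsum[OF D D])
    fix k assume k: "k < n"
    show "factors_through A {()} (\<lambda>_. M) D D (\<lambda>d. \<tau> (i k d) (e k))"
      by (rule factors_single[where Z = "\<lambda>_. M", OF D singletonI il[OF k] pl[OF k]])
  qed
  have "S (\<tau> x u) = \<tau> x u" if xu: "x \<in> carrier M" "u \<in> carrier U" for x u
  proof -
    have \<beta>c: "\<beta> k (\<alpha> k u) \<in> carrier U" if "k < n" for k
      using \<beta>[OF that \<alpha>c[OF that xu(2)]] U.smult_closed[OF \<alpha>c[OF that xu(2)] e[OF that]] by simp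
    have "S (\<tau> x u) = (\<Oplus>\<^bsub>D\<^esub>k\<in>{..<n}. \<tau> x (\<beta> k (\<alpha> k u)))"
      unfolding S_def
    proof (rule D.M.finsum_cong')
      fix k assume "k \<in> {..<n}"
      then have k: "k < n" by simp
      have "\<tau> (i k (\<tau> x u)) (e k) = \<tau> ((\<alpha> k u \<odot>\<^bsub>A\<^esub> \<one>\<^bsub>A\<^esub>) \<odot>\<^bsub>M\<^esub> x) (e k)"
        using i\<tau>[OF k xu] by (simp add: t_def)
      also have "\<dots> = \<tau> x (\<alpha> k u \<odot>\<^bsub>U\<^esub> e k)" by (rule \<tau>D(4)[OF \<alpha>c[OF k xu(2)] xu(1) e[OF k]])
      finally show "\<tau> (i k (\<tau> x u)) (e k) = \<tau> x (\<beta> k (\<alpha> k u))"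
        using \<beta>[OF k \<alpha>c[OF k xu(2)]] by simp
    next
      show "(\<lambda>k. \<tau> x (\<beta> k (\<alpha> k u))) \<in> {..<n} \<rightarrow> carrier D" using \<tau>D(1)[OF xu(1)] \<beta>c by auto
    qed simp
    also have "\<dots> = \<tau> x (\<Oplus>\<^bsub>U\<^esub>k\<in>{..<n}. \<beta> k (\<alpha> k u))"
      by (rule additive_finsum[symmetric, OF U.M.abelian_group_axioms D.M.abelian_group_axioms])
         (use xu \<beta>c in \<open>auto intro: \<tau>D(1,3)\<close>)
    also have "(\<Oplus>\<^bsub>U\<^esub>k\<in>{..<n}. \<beta> k (\<alpha> k u)) = u" using sum xu(2) by simp
    finally show ?thesis .
  qed
  then have "\<forall>x\<in>carrier M. \<forall>u\<in>carrier U. S (\<tau> x u) = \<tau> x u" by blast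
  then have "S d = d" if "d \<in> carrier D" for d
    by (rule unique[OF factors_linear[OF Sf D D] linear_map_id _ that])
  then show ?thesis by (intro factors_cong[OF Sf]) simp
qed

lemma submodule_of_submodule:
  assumes X: "left_module A X" and K: "submodule K A X" and L: "submodule L A X" and sub: "K \<subseteq> L"
  shows "submodule K A (X\<lparr>carrier := L\<rparr>)"
proof -
  let ?L = "X\<lparr>carrier := L\<rparr>"
  have LM: "left_module A ?L" by (rule left_module_submodule[OF X L])
  have incl: "linear_map A ?L X (\<lambda>x. x)" by (rule linear_map_submodule[OF linear_map_id submoduleD(1)[OF X L]])
  have "\<ominus>\<^bsub>?L\<^esub> x = \<ominus>\<^bsub>X\<^esub> x" if "x \<in> K" for x
    using linear_map_uminus[OF left_moduleD(2)[OF LM] left_moduleD(2)[OF X] incl, of x] that sub by auto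
  then show ?thesis
    unfolding submodule_iff[OF LM] using submoduleD[OF X K] sub by auto
qed

lemma summand_filtration_of_filtered:
  fixes X :: "('a, 'x) module"
  assumes A: "assoc_algebra R A" and \<Delta>: "\<And>l. l \<in> I \<Longrightarrow> left_module A (\<Delta> l)"
    and X: "X \<in> filtered A (tensor_class R A I \<Delta>)"
  obtains n F where "summand_filtration A I \<Delta> X n F"
proof -
  have XM: "left_module A X" using X by (simp add: filtered_def)
  obtain n F where F: "F 0 = {\<zero>\<^bsub>X\<^esub>}" "F n = carrier X" "\<forall>i\<le>n. submodule (F i) A X"
    "\<forall>i<n. F i \<subseteq> F (Suc i) \<and> (\<exists>Z\<in>tensor_class R A I \<Delta>.
        mod_isomorphic A (quotient_module (X\<lparr>carrier := F (Suc i)\<rparr>) (F i)) Z)"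
    using X unfolding filtered_def by auto
  have "summand_layer A I \<Delta> X (F i) (F (Suc i))" if i: "i < n" for i
  proof -
    let ?L = "X\<lparr>carrier := F (Suc i)\<rparr>" and ?D = "quotient_module (X\<lparr>carrier := F (Suc i)\<rparr>) (F i)"
    have subs: "submodule (F i) A X" "submodule (F (Suc i)) A X" using F(3) i by auto
    have L: "left_module A ?L" by (rule left_module_submodule[OF XM subs(2)])
    have K: "submodule (F i) A ?L" by (rule submodule_of_submodule[OF XM subs]) (use F(4) i in blast)
    note Q = projection_to_quotient[OF L K]
    obtain Z where Z: "Z \<in> tensor_class R A I \<Delta>" "mod_isomorphic A ?D Z" using F(4) i by blast
    obtain m and U :: "('b, nat \<Rightarrow> 'b) module" where
      U: "m \<in> I" "fg_projective R U" "Z = tensor R A (\<Delta> m) U"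
      using Z(1) unfolding tensor_class_def by blast
    note fac = factors_of_tensor[OF \<Delta>[OF U(1)] U(2) A Q(3) Z(2)[unfolded U(3)]]
    have "factors_through A I \<Delta> ?D ?D (\<lambda>x. x)"
      by (rule factors_trans[OF Q(3) Q(3) fac]) (rule factors_single[where Z = \<Delta>, OF Q(3) U(1) linear_map_id])
    then show ?thesis unfolding summand_layer_def using Q by (intro exI[of _ ?D] exI conjI) auto
  qed
  then have "summand_filtration A I \<Delta> X n F" using XM F(1-3) by (simp add: summand_filtration_def)
  then show ?thesis by (rule that)
qed

section \<open>Comparison of two tilting modules\<close>

lemma short_exactD:
  assumes "short_exact A L M N f g"
  shows "left_module A L" "left_module A M" "left_module A N" "linear_map A L M f" "linear_map A M N g"
    "inj_on f (carrier L)" "f ` carrier L = a_kernel M N g" "g ` carrier M = carrier N"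
  using assms by (simp_all add: short_exact_def mod_hom_linear)

lemma extend_along_short_exact:
  assumes ex: "short_exact A L M X f g" and ext: "kernel_maps_extend A M X g N" and b: "linear_map A L N b"
  obtains h where "linear_map A M N h" "\<And>x. x \<in> carrier L \<Longrightarrow> h (f x) = b x"
proof -
  note E = short_exactD[OF ex]
  have "linear_map A (M\<lparr>carrier := a_kernel M X g\<rparr>) N (\<lambda>y. b (inv_into (carrier L) f y))"
    using linear_map_comp[OF b linear_map_inverse[OF E(1,4,6)]] unfolding E(7) .
  from kernel_maps_extendE[OF ext this] obtain h where
    h: "linear_map A M N h" "\<And>y. y \<in> a_kernel M X g \<Longrightarrow> h y = b (inv_into (carrier L) f y)" by blast
  have "h (f x) = b x" if x: "x \<in> carrier L" for x
  proof -
    have "f x \<in> a_kernel M X g" using E(7) x by blast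
    then show ?thesis using h(2) inv_into_f_f[OF E(6) x] by simp
  qed
  then show ?thesis using that h(1) by blast
qed

text \<open>
  This is the independence of \<open>Ext\<^sup>1\<close> from the chosen projective presentation. It serves to
  replace presentations that depend on both variables by one that depends on the first only.
\<close>

lemma kernel_maps_extend_change_presentation:
  assumes P: "presentation A P D e" and ext: "kernel_maps_extend A P D e N"
    and M: "left_module A M" and D: "left_module A D" and N: "left_module A N"
    and g: "linear_map A M D g" "g ` carrier M = carrier D"
  shows "kernel_maps_extend A M D g N"
proof (rule kernel_maps_extend_transfer[where I = "{()}" and Z = "\<lambda>_. D" and P = "\<lambda>_. P" and e = "\<lambda>_. e", OF M D N _ _ _ g])
  show "factors_through A {()} (\<lambda>_. D) D D (\<lambda>x. x)"
    by (rule factors_single[where Z = "\<lambda>_. D", OF D singletonI linear_map_id linear_map_id])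
qed (use D P ext in auto)

lemma summand_filtration_mono:
  fixes X :: "('a, 'x) module"
  assumes "summand_filtration A I Z X n F" "I \<subseteq> J"
  shows "summand_filtration A J Z X n F"
proof -
  have "summand_layer A J Z X K L" if layer: "summand_layer A I Z X K L" for K L
  proof -
    obtain D :: "('a, 'x set) module" and q where D: "left_module A D" "linear_map A (X\<lparr>carrier := L\<rparr>) D q"
      "q ` L = carrier D" "a_kernel (X\<lparr>carrier := L\<rparr>) D q = K" "factors_through A I Z D D (\<lambda>x. x)"
      using layer unfolding summand_layer_def by blast
    show ?thesis unfolding summand_layer_def
      by (rule exI[of _ D], rule exI[of _ q]) (use D factors_mono[OF D(5) assms(2)] in simp)
  qed
  then show ?thesis using assms(1) by (simp add: summand_filtration_def)
qed

lemma kernel_maps_extend_into_costandard_filtered: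
  fixes nabla :: "'l \<Rightarrow> ('a, 'e) module"
  assumes A: "assoc_algebra R A" and D: "left_module A D" and P: "presentation A P D e"
    and nabla: "\<And>m. m \<in> \<Lambda> \<Longrightarrow> left_module A (nabla m)"
    and ext: "\<And>m. m \<in> \<Lambda> \<Longrightarrow> kernel_maps_extend A P D e (nabla m)"
    and l: "l \<in> \<Lambda>" and I: "I \<subseteq> \<Lambda>"
    and ex: "short_exact A Y T (nabla l) f g" and Y: "Y \<in> filtered A (tensor_class R A I nabla)"
  shows "kernel_maps_extend A P D e T"
proof -
  note E = short_exactD[OF ex]
  obtain n F where fil: "summand_filtration A I nabla Y n F"
    by (rule summand_filtration_of_filtered[OF A nabla Y]) (use I that in auto)
  have "kernel_maps_extend A P D e Y"
    by (rule kernel_maps_extend_into_filtered[OF fil P D ext]) (use I in auto)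
  then show ?thesis
    by (rule kernel_maps_extend_extension[OF P D E(1,2,3,4,6,7,5,8) _ ext[OF l]])
qed

text \<open>
  The maps \<open>u\<close> and \<open>v\<close> between \<open>T l\<close> and \<open>Q l\<close> extend the identity of \<open>\<Delta> l\<close>, so \<open>id - v \<circ> u\<close> factors
  as \<open>w \<circ> g\<close> through \<open>X l\<close>. The map \<open>w\<close> is a sum of composites through modules \<open>Q m\<close> by
  \<open>factors_of_filtered\<close>, and \<open>v \<circ> u\<close> is a composite through \<open>Q l\<close>.
\<close>

lemma identity_factors_through_tilting:
  fixes P :: "'l \<Rightarrow> ('a, 'p) module"
  assumes pres: "\<And>l. l \<in> \<Lambda> \<Longrightarrow> presentation A (P l) (\<Delta> l) (e l)"
    and T: "\<And>l. l \<in> \<Lambda> \<Longrightarrow> \<exists>f g. short_exact A (\<Delta> l) (T l) (X l) f g"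
    and Q: "\<And>l. l \<in> \<Lambda> \<Longrightarrow> \<exists>f g. short_exact A (\<Delta> l) (Q l) (X' l) f g"
    and X: "\<And>l. l \<in> \<Lambda> \<Longrightarrow> \<exists>n F. summand_filtration A \<Lambda> \<Delta> (X l) n F"
    and X': "\<And>l. l \<in> \<Lambda> \<Longrightarrow> \<exists>n F. summand_filtration A \<Lambda> \<Delta> (X' l) n F"
    and extT: "\<And>l m. l \<in> \<Lambda> \<Longrightarrow> m \<in> \<Lambda> \<Longrightarrow> kernel_maps_extend A (P l) (\<Delta> l) (e l) (T m)"
    and extQ: "\<And>l m. l \<in> \<Lambda> \<Longrightarrow> m \<in> \<Lambda> \<Longrightarrow> kernel_maps_extend A (P l) (\<Delta> l) (e l) (Q m)"
    and l: "l \<in> \<Lambda>"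
  shows "factors_through A \<Lambda> Q (T l) (T l) (\<lambda>x. x)"
proof -
  have \<Delta>M: "left_module A (\<Delta> m)" if "m \<in> \<Lambda>" for m using T[OF that] short_exactD(1) by blast
  have QM: "left_module A (Q m)" if "m \<in> \<Lambda>" for m using Q[OF that] short_exactD(2) by blast
  obtain f g where T1: "short_exact A (\<Delta> l) (T l) (X l) f g" using T[OF l] by blast
  note TE = short_exactD[OF T1]
  interpret T: left_module A "T l" by (rule TE(2))
  obtain n F where fil: "summand_filtration A \<Lambda> \<Delta> (X l) n F" using X[OF l] by blast
  obtain f' g' where Q1: "short_exact A (\<Delta> l) (Q l) (X' l) f' g'" using Q[OF l] by blast
  note QE = short_exactD[OF Q1]
  have ext_over_X': "kernel_maps_extend A (Q m) (X' m) q (T l)"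
    if m: "m \<in> \<Lambda>" and q: "linear_map A (Q m) (X' m) q" "q ` carrier (Q m) = carrier (X' m)" for m q
  proof -
    obtain n F where "summand_filtration A \<Lambda> \<Delta> (X' m) n F" using X'[OF m] by blast
    then show ?thesis
      by (rule kernel_maps_extend_over_filtered[OF _ QM[OF m] TE(2) \<Delta>M pres extT[OF _ l] q])
  qed
  have ext_over_X: "kernel_maps_extend A (T l) (X l) g (Q l)"
    by (rule kernel_maps_extend_over_filtered[OF fil TE(2) QM[OF l] \<Delta>M pres extQ[OF _ l] TE(5,8)])
  obtain u where u: "linear_map A (T l) (Q l) u" "\<And>x. x \<in> carrier (\<Delta> l) \<Longrightarrow> u (f x) = f' x"
    using extend_along_short_exact[OF T1 ext_over_X QE(4)] by blast
  obtain v where v: "linear_map A (Q l) (T l) v" "\<And>x. x \<in> carrier (\<Delta> l) \<Longrightarrow> v (f' x) = f x"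
    using extend_along_short_exact[OF Q1 ext_over_X'[OF l QE(5,8)] TE(4)] by blast
  have vu: "linear_map A (T l) (T l) (\<lambda>x. v (u x))" by (rule linear_map_comp[OF v(1) u(1)])
  have kill: "x \<ominus>\<^bsub>T l\<^esub> v (u x) = \<zero>\<^bsub>T l\<^esub>" if x: "x \<in> a_kernel (T l) (X l) g" for x
  proof -
    obtain y where y: "y \<in> carrier (\<Delta> l)" "x = f y" using x TE(7) by blast
    then have "v (u x) = x" using u(2) v(2) by simp
    then show ?thesis using linear_map_closed[OF TE(4) y(1)] y(2) by (simp add: T.M.minus_eq_zero_iff)
  qed
  obtain w where w: "linear_map A (X l) (T l) w"
    "\<And>x. x \<in> carrier (T l) \<Longrightarrow> w (g x) = x \<ominus>\<^bsub>T l\<^esub> v (u x)"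
    using factor_over_surjection[OF TE(2,3,2,5,8) linear_map_sub[OF TE(2) linear_map_id vu] kill] by blast
  \<comment> \<open>A map from a standard module to \<open>T l\<close> extends to \<open>Q m\<close>, hence factors through it.\<close>
  have fac: "factors_through A \<Lambda> Q (\<Delta> m) (T l) b" if m: "m \<in> \<Lambda>" and b: "linear_map A (\<Delta> m) (T l) b" for m b
  proof -
    obtain j q where Qm: "short_exact A (\<Delta> m) (Q m) (X' m) j q" using Q[OF m] by blast
    note E = short_exactD[OF Qm]
    obtain h where h: "linear_map A (Q m) (T l) h" "\<And>x. x \<in> carrier (\<Delta> m) \<Longrightarrow> h (j x) = b x"
      using extend_along_short_exact[OF Qm ext_over_X'[OF m E(5,8)] b] by blast
    have "factors_through A \<Lambda> Q (\<Delta> m) (T l) (\<lambda>x. h (j x))" by (rule factors_single[where Z = Q, OF TE(2) m E(4) h(1)])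
    then show ?thesis by (rule factors_cong) (use h(2) in simp)
  qed
  have "factors_through A \<Lambda> Q (X l) (T l) w"
    by (rule factors_of_filtered[OF fil TE(2) \<Delta>M QM pres extQ fac w(1)])
  from factors_add[OF TE(2,2) factors_comp_right[OF this TE(5)] factors_single[where Z = Q, OF TE(2) l u(1) v(1)]]
  show ?thesis
  proof (rule factors_cong)
    fix x assume x: "x \<in> carrier (T l)"
    show "x = w (g x) \<oplus>\<^bsub>T l\<^esub> v (u x)"
      unfolding w(2)[OF x] using x linear_map_closed[OF vu x] by (simp add: T.M.minus_add_cancel)
  qed
qed

section \<open>Additive closures\<close>

lemma factors_between_direct_sums:
  assumes A: "ring A" and fin: "finite \<Lambda>"
    and T: "\<And>l. l \<in> \<Lambda> \<Longrightarrow> left_module A (T l)" and Q: "\<And>l. l \<in> \<Lambda> \<Longrightarrow> left_module A (Q l)"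
    and fac: "\<And>l. l \<in> \<Lambda> \<Longrightarrow> factors_through A \<Lambda> Q (T l) (T l) (\<lambda>x. x)"
  shows "factors_through A {()} (\<lambda>_. direct_sum \<Lambda> Q) (direct_sum \<Lambda> T) (direct_sum \<Lambda> T) (\<lambda>x. x)"
proof -
  have TS: "left_module A (direct_sum \<Lambda> T)" by (rule left_module_direct_sum[OF A T])
  show ?thesis
  proof (rule factors_trans_id[OF TS TS T factors_direct_sum_summands[OF A fin T]])
    fix l assume l: "l \<in> \<Lambda>"
    show "factors_through A {()} (\<lambda>_. direct_sum \<Lambda> Q) (T l) (T l) (\<lambda>x. x)"
      by (rule factors_trans_id[OF T[OF l] T[OF l] Q fac[OF l] factors_summand_direct_sum[OF Q]])
  qed
qed

lemma add_closure_mono: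
  assumes M: "left_module A M" and N: "left_module A N"
    and fac: "factors_through A {()} (\<lambda>_. N) M M (\<lambda>x. x)"
  shows "add_closure A M \<subseteq> add_closure A N"
proof
  fix L assume "L \<in> add_closure A M"
  then have L: "left_module A L" "\<exists>n. direct_summand A L (copies n M)" by (auto simp: add_closure_def)
  note A = left_moduleD(1)[OF M]
  have "factors_through A {()} (\<lambda>_. M) L L (\<lambda>x. x)" using L(2) direct_summand_copies_iff[OF A M L(1)] by blast
  then have "factors_through A {()} (\<lambda>_. N) L L (\<lambda>x. x)" by (rule factors_trans_id[OF L(1) L(1) M _ fac])
  then show "L \<in> add_closure A N" using direct_summand_copies_iff[OF A N L(1)] L(1) by (auto simp: add_closure_def)
qed

section \<open>Opposite endomorphism rings\<close>

text \<open>
  This isolates the additive structure that the endomorphism ring, the modules of homomorphisms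
  and the coinduced modules have in common.
\<close>

definition pointwise_hom_group ::
    "('a, 'q) ring_scheme \<Rightarrow> ('a, 'm) module \<Rightarrow> ('a, 'n) module \<Rightarrow> ('m \<Rightarrow> 'n, 'z) ring_scheme \<Rightarrow> bool" where
  "pointwise_hom_group A M N G \<longleftrightarrow> carrier G = mod_hom A M N \<and> \<zero>\<^bsub>G\<^esub> = zero_hom M N \<and>
     (\<forall>f g. f \<oplus>\<^bsub>G\<^esub> g = (\<lambda>x\<in>carrier M. f x \<oplus>\<^bsub>N\<^esub> g x))"

lemma mod_hom_closed: "f \<in> mod_hom A M N \<Longrightarrow> x \<in> carrier M \<Longrightarrow> f x \<in> carrier N"
  by (auto simp: mod_hom_def)

lemma mod_hom_eqI:
  "f \<in> mod_hom A M N \<Longrightarrow> g \<in> mod_hom A M N \<Longrightarrow> (\<And>x. x \<in> carrier M \<Longrightarrow> f x = g x) \<Longrightarrow> f = g"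
  by (auto simp: mod_hom_iff intro: extensionalityI)

lemma mod_hom_add:
  assumes "left_module A M" "left_module A N" "f \<in> mod_hom A M N" "g \<in> mod_hom A M N"
  shows "(\<lambda>x\<in>carrier M. f x \<oplus>\<^bsub>N\<^esub> g x) \<in> mod_hom A M N"
  by (rule linear_map_restrict[OF assms(1) linear_map_add[OF assms(2)]]) (use assms mod_hom_linear in auto)

lemma mod_hom_zero:
  assumes "left_module A M" "left_module A N"
  shows "zero_hom M N \<in> mod_hom A M N"
  unfolding zero_hom_def by (rule linear_map_restrict[OF assms(1) linear_map_const_zero[OF assms(2)]])

lemma abelian_group_pointwise:
  assumes M: "left_module A M" and N: "left_module A N" and G: "pointwise_hom_group A M N G"
  shows "abelian_group G"
proof -
  interpret N: left_module A N by fact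
  have c: "carrier G = mod_hom A M N" and z: "\<zero>\<^bsub>G\<^esub> = zero_hom M N"
    and a: "f \<oplus>\<^bsub>G\<^esub> g = (\<lambda>x\<in>carrier M. f x \<oplus>\<^bsub>N\<^esub> g x)" for f g
    using G by (simp_all add: pointwise_hom_group_def)
  show ?thesis
  proof (rule abelian_groupI, goal_cases)
    case (1 f g) then show ?case unfolding a c by (rule mod_hom_add[OF M N])
  next
    case 2 then show ?case unfolding z c by (rule mod_hom_zero[OF M N])
  next
    case (3 f g h)
    then show ?case unfolding a c by (intro restrict_ext) (auto simp: mod_hom_closed N.M.a_assoc)
  next
    case (4 f g)
    then show ?case unfolding a c by (intro restrict_ext) (auto simp: mod_hom_closed N.M.a_comm)
  next
    case (5 f)
    then show ?case unfolding a c z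
      by (intro extensionalityI[of _ "carrier M"]) (auto simp: mod_hom_closed zero_hom_def mod_hom_iff)
  next
    case (6 f)
    have "restrict (\<lambda>x. \<ominus>\<^bsub>N\<^esub> f x) (carrier M) \<in> mod_hom A M N"
      by (rule linear_map_restrict[OF M linear_map_neg[OF N mod_hom_linear]]) (use 6 c in simp)
    moreover have "restrict (\<lambda>x. \<ominus>\<^bsub>N\<^esub> f x) (carrier M) \<oplus>\<^bsub>G\<^esub> f = \<zero>\<^bsub>G\<^esub>"
      unfolding a z zero_hom_def using 6 c by (intro restrict_ext) (auto simp: mod_hom_closed N.M.l_neg)
    ultimately show ?case unfolding c by blast
  qed
qed

lemma finsum_pointwise:
  assumes M: "left_module A M" and N: "left_module A N" and G: "pointwise_hom_group A M N G"
    and h: "\<And>k. k < (n::nat) \<Longrightarrow> h k \<in> mod_hom A M N" and x: "x \<in> carrier M"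
  shows "(\<Oplus>\<^bsub>G\<^esub>k\<in>{..<n}. h k) x = (\<Oplus>\<^bsub>N\<^esub>k\<in>{..<n}. h k x)"
  using G x
  by (intro additive_finsum[OF abelian_group_pointwise[OF M N G] left_moduleD(2)[OF N], of "\<lambda>f. f x"])
     (auto simp: pointwise_hom_group_def mod_hom_closed h)

lemma mod_hom_compose:
  assumes "left_module A L" "f \<in> mod_hom A L M" "g \<in> mod_hom A M N"
  shows "compose (carrier L) g f \<in> mod_hom A L N"
  unfolding compose_def
  by (rule linear_map_restrict[OF assms(1) linear_map_comp[OF mod_hom_linear[OF assms(3)] mod_hom_linear[OF assms(2)]]])

lemma mod_hom_compose_assoc:
  assumes "f \<in> mod_hom A K L"
  shows "compose (carrier K) h (compose (carrier K) g f) = compose (carrier K) (compose (carrier L) h g) f"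
  by (rule compose_assoc) (use assms in \<open>auto simp: mod_hom_def\<close>)

lemma mod_hom_compose_id:
  assumes "f \<in> mod_hom A L M"
  shows "compose (carrier L) (\<lambda>x\<in>carrier M. x) f = f" "compose (carrier L) f (\<lambda>x\<in>carrier L. x) = f"
  using assms by (auto simp: mod_hom_iff compose_def linear_map_closed intro!: extensionalityI[of _ "carrier L"])

lemma mod_hom_identity: "left_module A M \<Longrightarrow> (\<lambda>x\<in>carrier M. x) \<in> mod_hom A M M"
  by (rule linear_map_restrict[OF _ linear_map_id])

abbreviation (input) op_End :: "('r, 'a) module \<Rightarrow> ('a, 'm) module \<Rightarrow> ('r, 'm \<Rightarrow> 'm) module" where
  "op_End A M \<equiv> opposite (End_algebra A M)"

text \<open>
  \<open>Hom\<^sub>A(M, N)\<close> as a left module over the opposite endomorphism ring of \<open>M\<close>. Taking it as a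
  module makes \<open>mod_hom\<close> available for the maps out of it.
\<close>

definition hom_left :: "('a, 'q) ring_scheme \<Rightarrow> ('a, 'm) module \<Rightarrow> ('a, 'n) module \<Rightarrow> ('m \<Rightarrow> 'm, 'm \<Rightarrow> 'n) module" where
  "hom_left A M N = \<lparr>carrier = mod_hom A M N, mult = undefined, one = undefined,
     ring.zero = zero_hom M N, add = (\<lambda>f g. \<lambda>x\<in>carrier M. f x \<oplus>\<^bsub>N\<^esub> g x), smult = (\<lambda>s f. compose (carrier M) f s)\<rparr>"

lemma hom_left_simps [simp]:
  "carrier (hom_left A M N) = mod_hom A M N" "\<zero>\<^bsub>hom_left A M N\<^esub> = zero_hom M N"
  "f \<oplus>\<^bsub>hom_left A M N\<^esub> g = (\<lambda>x\<in>carrier M. f x \<oplus>\<^bsub>N\<^esub> g x)"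
  "s \<odot>\<^bsub>hom_left A M N\<^esub> f = compose (carrier M) f s"
  by (simp_all add: hom_left_def)

lemma op_End_simps [simp]:
  "carrier (op_End A M) = mod_hom A M M" "\<zero>\<^bsub>op_End A M\<^esub> = zero_hom M M"
  "f \<oplus>\<^bsub>op_End A M\<^esub> g = (\<lambda>x\<in>carrier M. f x \<oplus>\<^bsub>M\<^esub> g x)"
  "f \<otimes>\<^bsub>op_End A M\<^esub> g = compose (carrier M) g f" "\<one>\<^bsub>op_End A M\<^esub> = (\<lambda>x\<in>carrier M. x)"
  by (simp_all add: opposite_def End_algebra_def hom_module_def)

lemma pointwise_hom_left: "pointwise_hom_group A M N (hom_left A M N)"
  by (simp add: pointwise_hom_group_def)

lemma pointwise_op_End: "pointwise_hom_group A M M (op_End A M)"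
  by (simp add: pointwise_hom_group_def)

lemma compose_add_right:
  assumes "f \<in> mod_hom A L M" "f' \<in> mod_hom A L M" "g \<in> mod_hom A M N"
  shows "compose (carrier L) g (\<lambda>x\<in>carrier L. f x \<oplus>\<^bsub>M\<^esub> f' x)
    = (\<lambda>x\<in>carrier L. compose (carrier L) g f x \<oplus>\<^bsub>N\<^esub> compose (carrier L) g f' x)"
  using assms by (auto simp: compose_def mod_hom_closed linear_map_plus[OF mod_hom_linear[OF assms(3)]] intro!: restrict_ext)

lemma compose_add_left:
  assumes "f \<in> mod_hom A L M"
  shows "compose (carrier L) (\<lambda>y\<in>carrier M. g y \<oplus>\<^bsub>N\<^esub> g' y) f
    = (\<lambda>x\<in>carrier L. compose (carrier L) g f x \<oplus>\<^bsub>N\<^esub> compose (carrier L) g' f x)"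
  using assms by (auto simp: compose_def mod_hom_closed intro!: restrict_ext)

lemma ring_op_End:
  assumes M: "left_module A M" shows "ring (op_End A M)"
proof (rule ringI, goal_cases)
  case 1 show ?case by (rule abelian_group_pointwise[OF M M pointwise_op_End])
next
  case 2 show ?case
    by (rule monoidI) (auto simp: mod_hom_compose[OF M] mod_hom_identity[OF M] mod_hom_compose_id mod_hom_compose_assoc)
next
  case (3 f g h) then show ?case by (simp add: compose_add_right)
next
  case (4 f g h) then show ?case by (simp add: compose_add_left)
qed

lemma left_module_hom_left:
  assumes M: "left_module A M" and N: "left_module A N"
  shows "left_module (op_End A M) (hom_left A M N)"
proof (intro left_module.intro left_module_axioms.intro ring_op_End[OF M]
    abelian_group_pointwise[OF M N pointwise_hom_left], goal_cases)
  case (1 s f) then show ?case by (simp add: mod_hom_compose[OF M])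
next
  case (2 s t f) then show ?case by (simp add: compose_add_right)
next
  case (3 s f g) then show ?case by (simp add: compose_add_left)
next
  case (4 s t f) then show ?case by (simp add: mod_hom_compose_assoc)
next
  case (5 f) then show ?case by (simp add: mod_hom_compose_id)
qed

section \<open>Transport of structure into a given type\<close>

text \<open>
  The module structure carried over to a set of codes, on which \<open>c\<close> is inverted by \<open>inv_into\<close>.
\<close>

definition relabel :: "('m \<Rightarrow> 'u) \<Rightarrow> ('s, 'm) module \<Rightarrow> ('s, 'u) module" where
  "relabel c M = (let d = inv_into (carrier M) c in \<lparr>carrier = c ` carrier M, mult = undefined, one = undefined,
     ring.zero = c \<zero>\<^bsub>M\<^esub>, add = (\<lambda>u v. c (d u \<oplus>\<^bsub>M\<^esub> d v)), smult = (\<lambda>s u. c (s \<odot>\<^bsub>M\<^esub> d u))\<rparr>)"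

lemma relabel:
  assumes M: "left_module S M" and inj: "inj_on c (carrier M)"
  shows "carrier (relabel c M) = c ` carrier M" "linear_map S M (relabel c M) c" "left_module S (relabel c M)"
    "linear_map S (relabel c M) M (inv_into (carrier M) c)"
proof -
  show c: "carrier (relabel c M) = c ` carrier M" by (simp add: relabel_def Let_def)
  show lin: "linear_map S M (relabel c M) c"
    by (rule linear_mapI) (auto simp: relabel_def Let_def inv_into_f_f[OF inj])
  show "left_module S (relabel c M)"
    by (rule left_module_surjective_image[OF M lin]) (simp_all add: relabel_def Let_def)
  show "linear_map S (relabel c M) M (inv_into (carrier M) c)"
    using linear_map_inverse[OF M lin inj] unfolding c[symmetric] carrier_update_self .
qed

text \<open>
  An infinite type is in bijection with its square, hence can code tuples of a fixed length.
\<close>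

lemma ex_injective_tuple_code:
  "\<exists>enc :: (nat \<Rightarrow> 'u::infinite) \<Rightarrow> 'u. \<forall>f g. enc f = enc g \<longrightarrow> (\<forall>k<n. f k = g k)"
proof (induction n)
  case 0 show ?case by simp
next
  case (Suc n)
  then obtain enc :: "(nat \<Rightarrow> 'u) \<Rightarrow> 'u" where enc: "\<forall>f g. enc f = enc g \<longrightarrow> (\<forall>k<n. f k = g k)" ..
  have "\<exists>p. bij_betw p ((UNIV :: 'u set) \<times> (UNIV :: 'u set)) (UNIV :: 'u set)"
    by (rule iffD2[OF card_of_ordIso card_of_Times_same_infinite[OF infinite_UNIV]])
  then obtain pair :: "'u \<times> 'u \<Rightarrow> 'u" where "bij_betw pair (UNIV \<times> UNIV) UNIV" ..
  then have inj: "inj_on pair (UNIV \<times> UNIV)" by (rule bij_betw_imp_inj_on)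
  have pair: "p = q" if "pair p = pair q" for p q
    by (rule inj_onD[OF inj that]) simp_all
  have "\<forall>f g. pair (enc f, f n) = pair (enc g, g n) \<longrightarrow> (\<forall>k<Suc n. f k = g k)"
  proof (intro allI impI)
    fix f g :: "nat \<Rightarrow> 'u" and k assume eq: "pair (enc f, f n) = pair (enc g, g n)" and k: "k < Suc n"
    have "(enc f, f n) = (enc g, g n)" by (rule pair[OF eq])
    then have "enc f = enc g" "f n = g n" by simp_all
    then show "f k = g k" using enc k by (cases "k = n") auto
  qed
  then show ?case by (rule exI[of _ "\<lambda>f. pair (enc f, f n)"])
qed

section \<open>Coinduction along a module of homomorphisms\<close>

text \<open>
  The homomorphisms from \<open>Hom\<^sub>A(X, Y)\<close> to \<open>M\<close> over the opposite endomorphism ring of \<open>X\<close>. The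
  opposite endomorphism ring of \<open>Y\<close> acts on them because \<open>Hom\<^sub>A(X, Y)\<close> carries a commuting action
  by composition on the other side.
\<close>

definition coinduced ::
    "('r, 'a) module \<Rightarrow> ('a, 'm) module \<Rightarrow> ('a, 'n) module \<Rightarrow> ('m \<Rightarrow> 'm, 'u) module \<Rightarrow> ('n \<Rightarrow> 'n, ('m \<Rightarrow> 'n) \<Rightarrow> 'u) module" where
  "coinduced A X Y M = \<lparr>carrier = mod_hom (op_End A X) (hom_left A X Y) M, mult = undefined, one = undefined,
     ring.zero = zero_hom (hom_left A X Y) M,
     add = (\<lambda>\<phi> \<psi>. \<lambda>f\<in>mod_hom A X Y. \<phi> f \<oplus>\<^bsub>M\<^esub> \<psi> f),
     smult = (\<lambda>q \<phi>. \<lambda>f\<in>mod_hom A X Y. \<phi> (compose (carrier X) q f))\<rparr>"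

lemma coinduced_simps [simp]:
  "carrier (coinduced A X Y M) = mod_hom (op_End A X) (hom_left A X Y) M"
  "\<zero>\<^bsub>coinduced A X Y M\<^esub> = zero_hom (hom_left A X Y) M"
  "\<phi> \<oplus>\<^bsub>coinduced A X Y M\<^esub> \<psi> = (\<lambda>f\<in>mod_hom A X Y. \<phi> f \<oplus>\<^bsub>M\<^esub> \<psi> f)"
  "q \<odot>\<^bsub>coinduced A X Y M\<^esub> \<phi> = (\<lambda>f\<in>mod_hom A X Y. \<phi> (compose (carrier X) q f))"
  by (simp_all add: coinduced_def)

text \<open>
  The same \<open>code\<close> must serve all modules \<open>M\<close> at once, so that the functor below sends a module over
  the type \<open>'u\<close> to a module over the same type.
\<close>

locale coded_hom =
  fixes A :: "('r, 'a) module" and X :: "('a, 'm) module" and Y :: "('a, 'n) module"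
    and code :: "(('m \<Rightarrow> 'n) \<Rightarrow> 'u) \<Rightarrow> 'u"
  assumes X: "left_module A X" and Y: "left_module A Y"
    and inj_code: "\<And>M. left_module (op_End A X) M \<Longrightarrow> inj_on code (mod_hom (op_End A X) (hom_left A X Y) M)"
begin

abbreviation "S \<equiv> op_End A X"
abbreviation "H \<equiv> hom_left A X Y"

lemma H: "left_module S H" by (rule left_module_hom_left[OF X Y])

lemma coinduced_plus:
  assumes "\<phi> \<in> mod_hom S H M" "f \<in> mod_hom A X Y" "f' \<in> mod_hom A X Y"
  shows "\<phi> (\<lambda>x\<in>carrier X. f x \<oplus>\<^bsub>Y\<^esub> f' x) = \<phi> f \<oplus>\<^bsub>M\<^esub> \<phi> f'"
  using linear_map_plus[OF mod_hom_linear[OF assms(1)], of f f'] assms(2,3) by simp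

lemma coinduced_scale:
  assumes "\<phi> \<in> mod_hom S H M" "s \<in> mod_hom A X X" "f \<in> mod_hom A X Y"
  shows "\<phi> (compose (carrier X) f s) = s \<odot>\<^bsub>M\<^esub> \<phi> f"
  using linear_map_scale[OF mod_hom_linear[OF assms(1)], of s f] assms(2,3) by simp

lemma coinduced_closed:
  "\<phi> \<in> mod_hom S H M \<Longrightarrow> f \<in> mod_hom A X Y \<Longrightarrow> \<phi> f \<in> carrier M"
  using mod_hom_closed[of \<phi> S H M f] by simp

lemma left_module_coinduced:
  assumes M: "left_module S M"
  shows "left_module (op_End A Y) (coinduced A X Y M)"
proof -
  have pw: "pointwise_hom_group S H M (coinduced A X Y M)" by (simp add: pointwise_hom_group_def)
  show ?thesis
  proof (intro left_module.intro left_module_axioms.intro ring_op_End[OF Y] abelian_group_pointwise[OF H M pw], goal_cases)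
    case (1 q \<phi>)
    then have q: "q \<in> mod_hom A Y Y" and \<phi>: "\<phi> \<in> mod_hom S H M" by simp_all
    have "linear_map S H M (\<lambda>f. \<phi> (compose (carrier X) q f))"
    proof (rule linear_mapI, goal_cases)
      case (1 f) then show ?case using coinduced_closed[OF \<phi>] mod_hom_compose[OF X _ q] by simp
    next
      case (2 f f')
      then show ?case using coinduced_plus[OF \<phi>] mod_hom_compose[OF X _ q] by (simp add: compose_add_right[OF _ _ q])
    next
      case (3 s f)
      then show ?case using coinduced_scale[OF \<phi>, of s "compose (carrier X) q f"] mod_hom_compose[OF X _ q]
        by (simp add: mod_hom_compose_assoc)
    qed
    from linear_map_restrict[OF H this] show ?case by simp
  next
    case (2 q q' \<phi>)
    then show ?case
      by (auto intro!: restrict_ext simp: compose_add_left coinduced_plus mod_hom_compose[OF X])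
  next
    case (3 q \<phi> \<psi>)
    then show ?case by (auto intro!: restrict_ext simp: mod_hom_compose[OF X])
  next
    case (4 q q' \<phi>)
    then show ?case by (auto intro!: restrict_ext simp: mod_hom_compose[OF X] mod_hom_compose_assoc)
  next
    case (5 \<phi>)
    then have "\<phi> \<in> extensional (mod_hom A X Y)" by (simp add: mod_hom_iff)
    then show ?case by (auto intro!: extensionalityI[of _ "mod_hom A X Y"] simp: mod_hom_compose_id)
  qed
qed

definition ob :: "('m \<Rightarrow> 'm, 'u) module \<Rightarrow> ('n \<Rightarrow> 'n, 'u) module" where
  "ob M = relabel code (coinduced A X Y M)"

definition decode :: "('m \<Rightarrow> 'm, 'u) module \<Rightarrow> 'u \<Rightarrow> ('m \<Rightarrow> 'n) \<Rightarrow> 'u" where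
  "decode M = inv_into (mod_hom S H M) code"

definition mor :: "('m \<Rightarrow> 'm, 'u) module \<Rightarrow> ('m \<Rightarrow> 'm, 'u) module \<Rightarrow> ('u \<Rightarrow> 'u) \<Rightarrow> 'u \<Rightarrow> 'u" where
  "mor M N h = (\<lambda>u\<in>carrier (ob M). code (compose (mod_hom A X Y) h (decode M u)))"

lemma ob:
  assumes "left_module S M"
  shows "carrier (ob M) = code ` mod_hom S H M" "left_module (op_End A Y) (ob M)"
    "linear_map (op_End A Y) (coinduced A X Y M) (ob M) code"
    "linear_map (op_End A Y) (ob M) (coinduced A X Y M) (decode M)"
  using relabel[OF left_module_coinduced[OF assms], of code] inj_code[OF assms] by (simp_all add: ob_def decode_def)

lemma code_closed: "left_module S M \<Longrightarrow> \<phi> \<in> mod_hom S H M \<Longrightarrow> code \<phi> \<in> carrier (ob M)"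
  by (simp add: ob)

lemma decode_code: "left_module S M \<Longrightarrow> \<phi> \<in> mod_hom S H M \<Longrightarrow> decode M (code \<phi>) = \<phi>"
  by (simp add: decode_def inv_into_f_f[OF inj_code])

lemma decode_closed: "left_module S M \<Longrightarrow> u \<in> carrier (ob M) \<Longrightarrow> decode M u \<in> mod_hom S H M"
  by (simp add: decode_def ob(1) inv_into_into)

lemma code_decode: "left_module S M \<Longrightarrow> u \<in> carrier (ob M) \<Longrightarrow> code (decode M u) = u"
  by (simp add: decode_def ob(1) f_inv_into_f)

lemma compose_hom_closed:
  assumes "\<phi> \<in> mod_hom S H M" "h \<in> mod_hom S M N"
  shows "compose (mod_hom A X Y) h \<phi> \<in> mod_hom S H N"
  using mod_hom_compose[OF H assms] by simp

lemma mor_linear: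
  assumes M: "left_module S M" and N: "left_module S N" and h: "h \<in> mod_hom S M N"
  shows "mor M N h \<in> mod_hom (op_End A Y) (ob M) (ob N)"
proof -
  note hl = mod_hom_linear[OF h]
  have "linear_map (op_End A Y) (coinduced A X Y M) (coinduced A X Y N) (\<lambda>\<phi>. compose (mod_hom A X Y) h \<phi>)"
  proof (rule linear_mapI, goal_cases)
    case (1 \<phi>) then show ?case using compose_hom_closed[OF _ h] by simp
  next
    case (2 \<phi> \<psi>)
    then show ?case by (auto simp: compose_def intro!: restrict_ext linear_map_plus[OF hl] coinduced_closed)
  next
    case (3 q \<phi>)
    then show ?case by (auto simp: compose_def mod_hom_compose[OF X, unfolded compose_def] intro!: restrict_ext)
  qed
  from linear_map_comp[OF ob(3)[OF N] linear_map_comp[OF this ob(4)[OF M]]]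
  show ?thesis unfolding mor_def by (rule linear_map_restrict[OF ob(2)[OF M]])
qed

lemma mor_code:
  assumes "left_module S M" "\<phi> \<in> mod_hom S H M"
  shows "mor M N h (code \<phi>) = code (compose (mod_hom A X Y) h \<phi>)"
  using code_closed[OF assms] decode_code[OF assms] by (simp add: mor_def)

lemma functorial: "module_functor S (op_End A Y) ob mor"
  unfolding module_functor_def
proof (intro conjI allI impI, goal_cases)
  case (1 M) then show ?case by (rule ob(2))
next
  case (2 M N f) then show ?case using mor_linear by blast
next
  case (3 M)
  show ?case
  proof (rule extensionalityI[of _ "carrier (ob M)"])
    fix u assume u: "u \<in> carrier (ob M)"
    have "compose (mod_hom A X Y) (\<lambda>x\<in>carrier M. x) (decode M u) = decode M u"
      using mod_hom_compose_id(1)[OF decode_closed[OF 3 u]] by simp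
    then show "mor M M (\<lambda>x\<in>carrier M. x) u = (\<lambda>x\<in>carrier (ob M). x) u"
      using u code_decode[OF 3 u] by (simp add: mor_def)
  qed (simp_all add: mor_def)
next
  case (4 L M N f g)
  then have L: "left_module S L" and M: "left_module S M" and f: "f \<in> mod_hom S L M" by blast+
  show ?case
  proof (rule extensionalityI[of _ "carrier (ob L)"])
    fix u assume u: "u \<in> carrier (ob L)"
    let ?\<phi> = "decode L u"
    have \<phi>: "?\<phi> \<in> mod_hom S H L" by (rule decode_closed[OF L u])
    have "mor L N (compose (carrier L) g f) u = code (compose (mod_hom A X Y) (compose (carrier L) g f) ?\<phi>)"
      using u by (simp add: mor_def)
    also have "compose (mod_hom A X Y) (compose (carrier L) g f) ?\<phi>
        = compose (mod_hom A X Y) g (compose (mod_hom A X Y) f ?\<phi>)"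
      using mod_hom_compose_assoc[OF \<phi>, of g f] by simp
    also have "code \<dots> = mor M N g (mor L M f u)"
      using mor_code[OF M compose_hom_closed[OF \<phi> f]] u by (simp add: mor_def)
    finally show "mor L N (compose (carrier L) g f) u = compose (carrier (ob L)) (mor M N g) (mor L M f) u"
      using u by (simp add: compose_eq)
  qed (simp_all add: mor_def compose_def)
qed

end

text \<open>
  If the identity of \<open>Y\<close> is \<open>\<Sum> b k \<circ> a k\<close> with \<open>b k\<close> from \<open>X\<close> to \<open>Y\<close>, then every \<open>f\<close> from \<open>X\<close> to
  \<open>Y\<close> is \<open>\<Sum> b k \<circ> (a k \<circ> f)\<close>, a combination of the \<open>b k\<close> with coefficients in the endomorphism
  ring of \<open>X\<close>. A homomorphism on \<open>Hom\<^sub>A(X, Y)\<close> is thus determined by its values at the \<open>b k\<close>, and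
  it is coded by the tuple of these values.
\<close>

lemma ex_coded_hom:
  fixes A :: "('r, 'a) module" and X :: "('a, 'm) module" and Y :: "('a, 'n) module"
  assumes X: "left_module A X" and Y: "left_module A Y"
    and fac: "factors_through A {()} (\<lambda>_. X) Y Y (\<lambda>y. y)"
  shows "\<exists>code :: (('m \<Rightarrow> 'n) \<Rightarrow> 'u::infinite) \<Rightarrow> 'u. coded_hom A X Y code"
proof -
  obtain n :: nat and a b where
    ab: "\<forall>k<n. () \<in> {()} \<and> linear_map A Y X (a k) \<and> linear_map A X Y (b k)" and
    sum: "\<forall>y\<in>carrier Y. y = (\<Oplus>\<^bsub>Y\<^esub>k\<in>{..<n}. b k (a k y))"
    using factors_family[OF left_moduleD(3)[OF Y] fac] by auto
  define b' where "b' k = restrict (b k) (carrier X)" for k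
  define a' where "a' k = restrict (a k) (carrier Y)" for k
  have b': "b' k \<in> mod_hom A X Y" and a': "a' k \<in> mod_hom A Y X" if "k < n" for k
    unfolding a'_def b'_def using ab that linear_map_restrict[OF X] linear_map_restrict[OF Y] by blast+
  obtain enc :: "(nat \<Rightarrow> 'u) \<Rightarrow> 'u" where enc: "\<forall>f g. enc f = enc g \<longrightarrow> (\<forall>k<n. f k = g k)"
    using ex_injective_tuple_code by blast
  let ?S = "op_End A X" and ?H = "hom_left A X Y"
  let ?code = "\<lambda>\<phi>. enc (\<lambda>k. \<phi> (b' k))"
  have "inj_on ?code (mod_hom ?S ?H M)" if M: "left_module ?S M" for M
  proof (rule inj_onI)
    fix \<phi> \<psi> assume \<phi>: "\<phi> \<in> mod_hom ?S ?H M" and \<psi>: "\<psi> \<in> mod_hom ?S ?H M" and eq: "?code \<phi> = ?code \<psi>"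
    interpret M: left_module ?S M by fact
    have H: "left_module ?S ?H" by (rule left_module_hom_left[OF X Y])
    note HG = left_moduleD(2)[OF H] and MG = left_moduleD(2)[OF M]
    have agree: "\<phi> (b' k) = \<psi> (b' k)" if "k < n" for k using enc eq that by blast
    show "\<phi> = \<psi>"
    proof (rule mod_hom_eqI[OF \<phi> \<psi>])
      fix f assume "f \<in> carrier ?H"
      then have f: "f \<in> mod_hom A X Y" by simp
      define t where "t k = compose (carrier X) (a' k) f" for k
      have t: "t k \<in> mod_hom A X X" if "k < n" for k unfolding t_def by (rule mod_hom_compose[OF X f a'[OF that]])
      have bt: "compose (carrier X) (b' k) (t k) \<in> mod_hom A X Y" if "k < n" for k
        by (rule mod_hom_compose[OF X t[OF that] b'[OF that]])
      have "f = (\<Oplus>\<^bsub>?H\<^esub>k\<in>{..<n}. compose (carrier X) (b' k) (t k))" (is "f = ?sum")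
      proof (rule mod_hom_eqI[OF f])
        interpret H: left_module ?S ?H by (rule H)
        show "?sum \<in> mod_hom A X Y" using bt H.M.finsum_closed[of "\<lambda>k. compose (carrier X) (b' k) (t k)" "{..<n}"] by auto
        fix x assume x: "x \<in> carrier X"
        have fx: "f x \<in> carrier Y" by (rule mod_hom_closed[OF f x])
        have ax: "a k (f x) \<in> carrier X" if "k < n" for k using ab that fx linear_map_closed[of A Y X "a k"] by blast
        have "f x = (\<Oplus>\<^bsub>Y\<^esub>k\<in>{..<n}. b k (a k (f x)))" using sum fx by blast
        also have "\<dots> = (\<Oplus>\<^bsub>Y\<^esub>k\<in>{..<n}. compose (carrier X) (b' k) (t k) x)"
        proof (rule abelian_monoid.finsum_cong'[OF left_moduleD(3)[OF Y]])
          show "(\<lambda>k. compose (carrier X) (b' k) (t k) x) \<in> {..<n} \<rightarrow> carrier Y"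
            using bt x by (auto intro: mod_hom_closed)
        qed (use x fx ax in \<open>simp_all add: t_def a'_def b'_def compose_def\<close>)
        also have "\<dots> = ?sum x" by (rule finsum_pointwise[OF X Y pointwise_hom_left bt x, symmetric])
        finally show "f x = ?sum x" .
      qed
      moreover have "\<chi> ?sum = (\<Oplus>\<^bsub>M\<^esub>k\<in>{..<n}. t k \<odot>\<^bsub>M\<^esub> \<chi> (b' k))" if \<chi>: "\<chi> \<in> mod_hom ?S ?H M" for \<chi>
      proof -
        have "\<chi> ?sum = (\<Oplus>\<^bsub>M\<^esub>k\<in>{..<n}. \<chi> (compose (carrier X) (b' k) (t k)))"
          by (rule linear_map_of_finsum[OF HG MG mod_hom_linear[OF \<chi>]]) (use bt in simp)
        also have "\<dots> = (\<Oplus>\<^bsub>M\<^esub>k\<in>{..<n}. t k \<odot>\<^bsub>M\<^esub> \<chi> (b' k))"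
        proof (rule M.M.finsum_cong')
          fix k assume "k \<in> {..<n}"
          then show "\<chi> (compose (carrier X) (b' k) (t k)) = t k \<odot>\<^bsub>M\<^esub> \<chi> (b' k)"
            using linear_map_scale[OF mod_hom_linear[OF \<chi>], of "t k" "b' k"] t b' by simp
        next
          show "(\<lambda>k. t k \<odot>\<^bsub>M\<^esub> \<chi> (b' k)) \<in> {..<n} \<rightarrow> carrier M"
            using t b' mod_hom_closed[OF \<chi>] by (auto intro!: M.smult_closed)
        qed simp
        finally show ?thesis .
      qed
      moreover have "(\<Oplus>\<^bsub>M\<^esub>k\<in>{..<n}. t k \<odot>\<^bsub>M\<^esub> \<phi> (b' k)) = (\<Oplus>\<^bsub>M\<^esub>k\<in>{..<n}. t k \<odot>\<^bsub>M\<^esub> \<psi> (b' k))"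
        by (rule M.M.finsum_cong') (use agree t b' mod_hom_closed[OF \<psi>] in \<open>auto intro!: M.smult_closed\<close>)
      ultimately show "\<phi> f = \<psi> f" using \<phi> \<psi> by metis
    qed
  qed
  then have "coded_hom A X Y ?code" using X Y by (intro coded_hom.intro)
  then show ?thesis by blast
qed

section \<open>Morita equivalence\<close>

text \<open>
  Without the codes, the unit sends \<open>m\<close> to the map taking \<open>g\<close> from \<open>Y\<close> to \<open>X\<close> and \<open>f\<close> from \<open>X\<close> to
  \<open>Y\<close> to \<open>(g \<circ> f) \<cdot> m\<close>. Write the identity of \<open>X\<close> as \<open>\<Sum> d k \<circ> c k\<close>, where \<open>c k\<close> goes from \<open>X\<close> to
  \<open>Y\<close>. Then \<open>m = \<Sum> (d k \<circ> c k) \<cdot> m\<close> gives injectivity, and a map \<open>\<Phi>\<close> in the target is the image of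
  \<open>\<Sum> \<Phi> (d k) (c k)\<close>.
\<close>

lemma round_trip_natural:
  fixes A :: "('r, 'a) module" and X :: "('a, 'm) module" and Y :: "('a, 'n) module"
    and c1 :: "(('m \<Rightarrow> 'n) \<Rightarrow> 'u) \<Rightarrow> 'u" and c2 :: "(('n \<Rightarrow> 'm) \<Rightarrow> 'u) \<Rightarrow> 'u"
  assumes F: "coded_hom A X Y c1" and G: "coded_hom A Y X c2"
    and fac: "factors_through A {()} (\<lambda>_. Y) X X (\<lambda>x. x)"
  shows "naturally_isomorphic_to_id (op_End A X)
    (\<lambda>M. coded_hom.ob A Y X c2 (coded_hom.ob A X Y c1 M))
    (\<lambda>M N h. coded_hom.mor A Y X c2 (coded_hom.ob A X Y c1 M) (coded_hom.ob A X Y c1 N) (coded_hom.mor A X Y c1 M N h))"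
proof -
  interpret F: coded_hom A X Y c1 by fact
  interpret G: coded_hom A Y X c2 by fact
  let ?S = "op_End A X" and ?T = "op_End A Y"
  note X = F.X and Y = F.Y
  have cXYX: "compose (carrier X) g f \<in> mod_hom A X X" if "f \<in> mod_hom A X Y" "g \<in> mod_hom A Y X" for f g
    by (rule mod_hom_compose[OF X that])
  define \<eta>0 where "\<eta>0 M m g = (\<lambda>f\<in>mod_hom A X Y. compose (carrier X) g f \<odot>\<^bsub>M\<^esub> m)"
    for M :: "('m \<Rightarrow> 'm, 'u) module" and m g
  define \<eta>1 where "\<eta>1 M m = (\<lambda>g\<in>mod_hom A Y X. c1 (\<eta>0 M m g))" for M :: "('m \<Rightarrow> 'm, 'u) module" and m
  define \<eta> where "\<eta> M = (\<lambda>m\<in>carrier M. c2 (\<eta>1 M m))" for M :: "('m \<Rightarrow> 'm, 'u) module"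
  have \<eta>0: "\<eta>0 M m g \<in> mod_hom ?S F.H M"
    if M: "left_module ?S M" and m: "m \<in> carrier M" and g: "g \<in> mod_hom A Y X" for M m g
  proof -
    interpret M: left_module ?S M by fact
    have "linear_map ?S F.H M (\<lambda>f. compose (carrier X) g f \<odot>\<^bsub>M\<^esub> m)"
    proof (rule linear_mapI, goal_cases)
      case (1 f) then show ?case using cXYX[OF _ g] m by (simp add: M.smult_closed)
    next
      case (2 f f')
      then show ?case using cXYX[OF _ g] m M.smult_l_distr[of "compose (carrier X) g f" "compose (carrier X) g f'" m]
        by (simp add: compose_add_right[OF _ _ g])
    next
      case (3 s f)
      then show ?case using cXYX[OF _ g] m M.smult_assoc[of s "compose (carrier X) g f" m]
        by (simp add: mod_hom_compose_assoc)
    qed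
    from linear_map_restrict[OF F.H this] show ?thesis by (simp add: \<eta>0_def)
  qed
  have c1\<eta>0: "c1 (\<eta>0 M m g) \<in> carrier (F.ob M)"
    if "left_module ?S M" "m \<in> carrier M" "g \<in> mod_hom A Y X" for M m g
    using F.code_closed[OF that(1) \<eta>0[OF that]] .
  have \<eta>1: "\<eta>1 M m \<in> mod_hom ?T G.H (F.ob M)"
    if M: "left_module ?S M" and m: "m \<in> carrier M" for M m
  proof -
    interpret M: left_module ?S M by fact
    note cl = F.ob(3)[OF M]
    have "linear_map ?T G.H (F.ob M) (\<lambda>g. c1 (\<eta>0 M m g))"
    proof (rule linear_mapI, goal_cases)
      case (1 g) then show ?case using c1\<eta>0[OF M m] by simp
    next
      case (2 g g')
      then have g: "g \<in> mod_hom A Y X" "g' \<in> mod_hom A Y X" by simp_all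
      have "\<eta>0 M m (\<lambda>y\<in>carrier Y. g y \<oplus>\<^bsub>X\<^esub> g' y) = \<eta>0 M m g \<oplus>\<^bsub>coinduced A X Y M\<^esub> \<eta>0 M m g'"
        using cXYX[OF _ g(1)] cXYX[OF _ g(2)] m M.smult_l_distr[of _ _ m]
        by (auto simp: \<eta>0_def compose_add_left intro!: restrict_ext)
      then show ?case using linear_map_plus[OF cl] \<eta>0[OF M m g(1)] \<eta>0[OF M m g(2)] by simp
    next
      case (3 q g)
      then have q: "q \<in> mod_hom A Y Y" and g: "g \<in> mod_hom A Y X" by simp_all
      have "\<eta>0 M m (compose (carrier Y) g q) = q \<odot>\<^bsub>coinduced A X Y M\<^esub> \<eta>0 M m g"
        using mod_hom_compose[OF X _ q] by (auto simp: \<eta>0_def mod_hom_compose_assoc intro!: restrict_ext)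
      then show ?case using linear_map_scale[OF cl, of q] q \<eta>0[OF M m g] by simp
    qed
    from linear_map_restrict[OF G.H this] show ?thesis by (simp add: \<eta>1_def)
  qed
  have \<eta>1_linear: "linear_map ?S M (coinduced A Y X (F.ob M)) (\<eta>1 M)" if M: "left_module ?S M" for M
  proof -
    interpret M: left_module ?S M by fact
    note cl = F.ob(3)[OF M]
    show ?thesis
    proof (rule linear_mapI, goal_cases)
      case (1 m) then show ?case using \<eta>1[OF M] by simp
    next
      case (2 m m')
      have "c1 (\<eta>0 M (m \<oplus>\<^bsub>M\<^esub> m') g) = c1 (\<eta>0 M m g) \<oplus>\<^bsub>F.ob M\<^esub> c1 (\<eta>0 M m' g)" if g: "g \<in> mod_hom A Y X" for g
      proof -
        have "\<eta>0 M (m \<oplus>\<^bsub>M\<^esub> m') g = \<eta>0 M m g \<oplus>\<^bsub>coinduced A X Y M\<^esub> \<eta>0 M m' g"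
          using cXYX[OF _ g] 2 M.smult_r_distr[of _ m m'] by (auto simp: \<eta>0_def intro!: restrict_ext)
        then show ?thesis using linear_map_plus[OF cl] \<eta>0[OF M 2(1) g] \<eta>0[OF M 2(2) g] by simp
      qed
      then show ?case by (auto simp: \<eta>1_def intro!: restrict_ext)
    next
      case (3 s m)
      then have s: "s \<in> mod_hom A X X" by simp
      have "\<eta>0 M (s \<odot>\<^bsub>M\<^esub> m) g = \<eta>0 M m (compose (carrier Y) s g)" if g: "g \<in> mod_hom A Y X" for g
        unfolding \<eta>0_def
      proof (rule restrict_ext)
        fix f assume f: "f \<in> mod_hom A X Y"
        show "compose (carrier X) g f \<odot>\<^bsub>M\<^esub> (s \<odot>\<^bsub>M\<^esub> m) = compose (carrier X) (compose (carrier Y) s g) f \<odot>\<^bsub>M\<^esub> m"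
          using M.smult_assoc[of "compose (carrier X) g f" s m] cXYX[OF f g] 3 mod_hom_compose_assoc[OF f, of s g] by simp
      qed
      then show ?case using mod_hom_compose[OF Y _ s] by (auto simp: \<eta>1_def intro!: restrict_ext)
    qed
  qed
  obtain n :: nat and c d where
    cd: "\<forall>k<n. () \<in> {()} \<and> linear_map A X Y (c k) \<and> linear_map A Y X (d k)" and
    sum: "\<forall>x\<in>carrier X. x = (\<Oplus>\<^bsub>X\<^esub>k\<in>{..<n}. d k (c k x))"
    using factors_family[OF left_moduleD(3)[OF X] fac] by auto
  define c' where "c' k = restrict (c k) (carrier X)" for k
  define d' where "d' k = restrict (d k) (carrier Y)" for k
  have c': "c' k \<in> mod_hom A X Y" and d': "d' k \<in> mod_hom A Y X" if "k < n" for k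
    unfolding c'_def d'_def using cd that linear_map_restrict[OF X] linear_map_restrict[OF Y] by blast+
  define p where "p k = compose (carrier X) (d' k) (c' k)" for k
  have p: "p k \<in> mod_hom A X X" if "k < n" for k unfolding p_def by (rule cXYX[OF c'[OF that] d'[OF that]])
  have S: "ring ?S" by (rule ring_op_End[OF X])
  interpret S: ring ?S by (rule S)
  have one: "(\<Oplus>\<^bsub>?S\<^esub>k\<in>{..<n}. p k) = (\<lambda>x\<in>carrier X. x)" (is "?sum = ?id")
  proof (rule mod_hom_eqI)
    show "?sum \<in> mod_hom A X X" using p S.finsum_closed[of p "{..<n}"] by auto
    show "?id \<in> mod_hom A X X" by (rule mod_hom_identity[OF X])
    fix x assume x: "x \<in> carrier X"
    have cx: "c k x \<in> carrier Y" if "k < n" for k using cd that x linear_map_closed[of A X Y "c k"] by blast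
    have "?sum x = (\<Oplus>\<^bsub>X\<^esub>k\<in>{..<n}. p k x)" by (rule finsum_pointwise[OF X X pointwise_op_End p x])
    also have "\<dots> = (\<Oplus>\<^bsub>X\<^esub>k\<in>{..<n}. d k (c k x))"
    proof (rule abelian_monoid.finsum_cong'[OF left_moduleD(3)[OF X]])
      show "(\<lambda>k. d k (c k x)) \<in> {..<n} \<rightarrow> carrier X"
        using cx cd linear_map_closed[of A Y X] by blast
    qed (use x cx in \<open>simp_all add: p_def c'_def d'_def compose_def\<close>)
    finally show "?sum x = ?id x" using sum x by simp
  qed
  \<comment> \<open>Both halves of the bijectivity evaluate an additive map on the endomorphism ring at the identity.\<close>
  have at_one: "w (\<lambda>x\<in>carrier X. x) = (\<Oplus>\<^bsub>L\<^esub>k\<in>{..<n}. w (p k))"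
    if "abelian_group L" "\<And>s. s \<in> mod_hom A X X \<Longrightarrow> w s \<in> carrier L"
      "\<And>s t. s \<in> mod_hom A X X \<Longrightarrow> t \<in> mod_hom A X X \<Longrightarrow> w (\<lambda>x\<in>carrier X. s x \<oplus>\<^bsub>X\<^esub> t x) = w s \<oplus>\<^bsub>L\<^esub> w t"
    for w and L :: "('b, 'v) ring_scheme"
    unfolding one[symmetric]
  proof (rule additive_finsum[OF S.abelian_group_axioms that(1)])
    fix s t assume "s \<in> carrier ?S" "t \<in> carrier ?S"
    then show "w (s \<oplus>\<^bsub>?S\<^esub> t) = w s \<oplus>\<^bsub>L\<^esub> w t" unfolding op_End_simps by (rule that(3))
  qed (use that(2) p in auto)
  have bij: "bij_betw (\<eta>1 M) (carrier M) (mod_hom ?T G.H (F.ob M))" if M: "left_module ?S M" for M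
  proof (rule bij_betwI')
    interpret M: left_module ?S M by fact
    have FM: "left_module ?T (F.ob M)" by (rule F.ob(2)[OF M])
    have expand: "m = (\<Oplus>\<^bsub>M\<^esub>k\<in>{..<n}. p k \<odot>\<^bsub>M\<^esub> m)" if m: "m \<in> carrier M" for m
    proof -
      have "m = (\<lambda>x\<in>carrier X. x) \<odot>\<^bsub>M\<^esub> m" using M.smult_one[OF m] by simp
      also have "\<dots> = (\<Oplus>\<^bsub>M\<^esub>k\<in>{..<n}. p k \<odot>\<^bsub>M\<^esub> m)"
        by (rule at_one[OF M.M.abelian_group_axioms, of "\<lambda>s. s \<odot>\<^bsub>M\<^esub> m"])
           (use m M.smult_closed[of _ m] M.smult_l_distr[of _ _ m] in auto)
      finally show ?thesis .
    qed
    fix m m' assume m: "m \<in> carrier M" and m': "m' \<in> carrier M"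
    show "\<eta>1 M m = \<eta>1 M m' \<longleftrightarrow> m = m'"
    proof
      assume eq: "\<eta>1 M m = \<eta>1 M m'"
      have "p k \<odot>\<^bsub>M\<^esub> m = p k \<odot>\<^bsub>M\<^esub> m'" if k: "k < n" for k
      proof -
        have "c1 (\<eta>0 M m (d' k)) = c1 (\<eta>0 M m' (d' k))" using fun_cong[OF eq, of "d' k"] d'[OF k] by (simp add: \<eta>1_def)
        then have "\<eta>0 M m (d' k) = \<eta>0 M m' (d' k)"
          by (rule inj_onD[OF F.inj_code[OF M] _ \<eta>0[OF M m d'[OF k]] \<eta>0[OF M m' d'[OF k]]])
        from fun_cong[OF this, of "c' k"] show ?thesis using c'[OF k] by (simp add: \<eta>0_def p_def)
      qed
      then have "(\<Oplus>\<^bsub>M\<^esub>k\<in>{..<n}. p k \<odot>\<^bsub>M\<^esub> m) = (\<Oplus>\<^bsub>M\<^esub>k\<in>{..<n}. p k \<odot>\<^bsub>M\<^esub> m')"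
        by (intro M.M.finsum_cong') (use p m' M.smult_closed[of _ m'] in auto)
      then show "m = m'" using expand[OF m] expand[OF m'] by simp
    qed simp
  next
    fix m assume "m \<in> carrier M"
    then show "\<eta>1 M m \<in> mod_hom ?T G.H (F.ob M)" by (rule \<eta>1[OF M])
  next
    interpret M: left_module ?S M by fact
    fix \<Phi> assume \<Phi>: "\<Phi> \<in> mod_hom ?T G.H (F.ob M)"
    have \<Phi>c: "\<Phi> g \<in> carrier (F.ob M)" if "g \<in> mod_hom A Y X" for g using G.coinduced_closed[OF \<Phi> that] .
    let ?dec = "\<lambda>g. F.decode M (\<Phi> g)"
    have dec: "?dec g \<in> mod_hom ?S F.H M" if "g \<in> mod_hom A Y X" for g by (rule F.decode_closed[OF M \<Phi>c[OF that]])
    note dl = F.ob(4)[OF M]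
    define m where "m = (\<Oplus>\<^bsub>M\<^esub>k\<in>{..<n}. ?dec (d' k) (c' k))"
    have dcM: "?dec (d' k) (c' k) \<in> carrier M" if "k < n" for k
      by (rule F.coinduced_closed[OF dec[OF d'[OF that]] c'[OF that]])
    have m: "m \<in> carrier M" unfolding m_def using dcM by (intro M.M.finsum_closed) auto
    have main: "compose (carrier X) g f \<odot>\<^bsub>M\<^esub> m = ?dec g f" if g: "g \<in> mod_hom A Y X" and f: "f \<in> mod_hom A X Y" for g f
    proof -
      let ?gf = "compose (carrier X) g f"
      have gf: "?gf \<in> mod_hom A X X" by (rule cXYX[OF f g])
      have "?gf \<odot>\<^bsub>M\<^esub> m = (\<Oplus>\<^bsub>M\<^esub>k\<in>{..<n}. ?gf \<odot>\<^bsub>M\<^esub> ?dec (d' k) (c' k))"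
        unfolding m_def
        by (rule additive_finsum[OF M.M.abelian_group_axioms M.M.abelian_group_axioms])
           (use gf dcM M.smult_closed[of ?gf] M.smult_r_distr[of ?gf] in auto)
      also have "\<dots> = (\<Oplus>\<^bsub>M\<^esub>k\<in>{..<n}. ?dec (compose (carrier Y) (p k) g) f)"
      proof (rule M.M.finsum_cong')
        show "(\<lambda>k. ?dec (compose (carrier Y) (p k) g) f) \<in> {..<n} \<rightarrow> carrier M"
          using F.coinduced_closed[OF dec f] mod_hom_compose[OF Y g] p by auto
        fix k assume "k \<in> {..<n}"
        then have k: "k < n" by simp
        let ?q = "compose (carrier Y) (c' k) g"
        have q: "?q \<in> mod_hom A Y Y" by (rule mod_hom_compose[OF Y g c'[OF k]])
        have "?gf \<odot>\<^bsub>M\<^esub> ?dec (d' k) (c' k) = ?dec (d' k) (compose (carrier X) (c' k) ?gf)"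
          using F.coinduced_scale[OF dec[OF d'[OF k]] gf c'[OF k]] by simp
        also have "compose (carrier X) (c' k) ?gf = compose (carrier X) ?q f"
          by (rule mod_hom_compose_assoc[OF f])
        also have "?dec (d' k) (compose (carrier X) ?q f) = (?q \<odot>\<^bsub>coinduced A X Y M\<^esub> ?dec (d' k)) f"
          using f by simp
        also have "?q \<odot>\<^bsub>coinduced A X Y M\<^esub> ?dec (d' k) = F.decode M (?q \<odot>\<^bsub>F.ob M\<^esub> \<Phi> (d' k))"
          using linear_map_scale[OF dl, of ?q "\<Phi> (d' k)"] q \<Phi>c[OF d'[OF k]] by simp
        also have "?q \<odot>\<^bsub>F.ob M\<^esub> \<Phi> (d' k) = \<Phi> (compose (carrier Y) (d' k) ?q)"
          using G.coinduced_scale[OF \<Phi> q d'[OF k]] by simp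
        also have "compose (carrier Y) (d' k) ?q = compose (carrier Y) (p k) g"
          unfolding p_def by (rule mod_hom_compose_assoc[OF g])
        finally show "?gf \<odot>\<^bsub>M\<^esub> ?dec (d' k) (c' k) = ?dec (compose (carrier Y) (p k) g) f" .
      qed simp
      also have "\<dots> = ?dec (compose (carrier Y) (\<lambda>x\<in>carrier X. x) g) f"
      proof (rule at_one[symmetric, OF M.M.abelian_group_axioms, of "\<lambda>s. ?dec (compose (carrier Y) s g) f"])
        fix s assume "s \<in> mod_hom A X X"
        then show "?dec (compose (carrier Y) s g) f \<in> carrier M"
          by (intro F.coinduced_closed[OF dec f] mod_hom_compose[OF Y g])
      next
        fix s t assume st: "s \<in> mod_hom A X X" "t \<in> mod_hom A X X"
        note sg = mod_hom_compose[OF Y g st(1)] and tg = mod_hom_compose[OF Y g st(2)]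
        have "\<Phi> (compose (carrier Y) (\<lambda>x\<in>carrier X. s x \<oplus>\<^bsub>X\<^esub> t x) g)
            = \<Phi> (compose (carrier Y) s g) \<oplus>\<^bsub>F.ob M\<^esub> \<Phi> (compose (carrier Y) t g)"
          unfolding compose_add_left[OF g] by (rule G.coinduced_plus[OF \<Phi> sg tg])
        then show "?dec (compose (carrier Y) (\<lambda>x\<in>carrier X. s x \<oplus>\<^bsub>X\<^esub> t x) g) f
            = ?dec (compose (carrier Y) s g) f \<oplus>\<^bsub>M\<^esub> ?dec (compose (carrier Y) t g) f"
          using linear_map_plus[OF dl \<Phi>c[OF sg] \<Phi>c[OF tg]] f by simp
      qed
      also have "\<dots> = ?dec g f" using mod_hom_compose_id(1)[OF g] by simp
      finally show ?thesis .
    qed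
    have "\<Phi> = \<eta>1 M m"
    proof (rule mod_hom_eqI[OF \<Phi> \<eta>1[OF M m]])
      fix g assume "g \<in> carrier G.H"
      then have g: "g \<in> mod_hom A Y X" by simp
      have "\<eta>0 M m g = ?dec g"
        by (rule mod_hom_eqI[OF \<eta>0[OF M m g] dec[OF g]]) (use main[OF g] in \<open>simp add: \<eta>0_def\<close>)
      then show "\<Phi> g = \<eta>1 M m g" using g F.code_decode[OF M \<Phi>c[OF g]] by (simp add: \<eta>1_def)
    qed
    then show "\<exists>m\<in>carrier M. \<Phi> = \<eta>1 M m" using m by blast
  qed
  have iso: "\<eta> M \<in> mod_iso ?S M (G.ob (F.ob M))" if M: "left_module ?S M" for M
  proof -
    have FM: "left_module ?T (F.ob M)" by (rule F.ob(2)[OF M])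
    have "\<eta> M \<in> mod_hom ?S M (G.ob (F.ob M))"
      unfolding \<eta>_def by (rule linear_map_restrict[OF M linear_map_comp[OF G.ob(3)[OF FM] \<eta>1_linear[OF M]]])
    moreover have "bij_betw (\<eta> M) (carrier M) (carrier (G.ob (F.ob M)))"
    proof -
      have "bij_betw c2 (mod_hom ?T G.H (F.ob M)) (carrier (G.ob (F.ob M)))"
        using G.inj_code[OF FM] G.ob(1)[OF FM] by (simp add: bij_betw_def)
      from bij_betw_trans[OF bij[OF M] this] show ?thesis
        by (rule bij_betw_cong[THEN iffD1, rotated]) (simp add: \<eta>_def)
    qed
    ultimately show ?thesis by (simp add: mod_iso_def)
  qed
  have nat: "compose (carrier M) (\<eta> N) h = compose (carrier M) (G.mor (F.ob M) (F.ob N) (F.mor M N h)) (\<eta> M)"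
    if M: "left_module ?S M" and N: "left_module ?S N" and h: "h \<in> mod_hom ?S M N" for M N h
  proof (rule extensionalityI[of _ "carrier M"])
    fix m assume m: "m \<in> carrier M"
    have FM: "left_module ?T (F.ob M)" by (rule F.ob(2)[OF M])
    have hm: "h m \<in> carrier N" by (rule mod_hom_closed[OF h m])
    have "\<eta>1 N (h m) = compose (mod_hom A Y X) (F.mor M N h) (\<eta>1 M m)"
    proof (rule extensionalityI[of _ "mod_hom A Y X"])
      fix g assume g: "g \<in> mod_hom A Y X"
      have "\<eta>0 N (h m) g = compose (mod_hom A X Y) h (\<eta>0 M m g)"
      proof (rule extensionalityI[of _ "mod_hom A X Y"])
        fix f assume f: "f \<in> mod_hom A X Y"
        then show "\<eta>0 N (h m) g f = compose (mod_hom A X Y) h (\<eta>0 M m g) f"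
          using linear_map_scale[OF mod_hom_linear[OF h], of "compose (carrier X) g f" m] cXYX[OF f g] m
          by (simp add: \<eta>0_def compose_def)
      qed (simp_all add: \<eta>0_def)
      then show "\<eta>1 N (h m) g = compose (mod_hom A Y X) (F.mor M N h) (\<eta>1 M m) g"
        using g F.mor_code[OF M \<eta>0[OF M m g], of N h] by (simp add: \<eta>1_def compose_def)
    qed (simp_all add: \<eta>1_def)
    then have "\<eta> N (h m) = G.mor (F.ob M) (F.ob N) (F.mor M N h) (\<eta> M m)"
      using hm m G.mor_code[OF FM \<eta>1[OF M m], of "F.ob N" "F.mor M N h"] by (simp add: \<eta>_def)
    then show "compose (carrier M) (\<eta> N) h m = compose (carrier M) (G.mor (F.ob M) (F.ob N) (F.mor M N h)) (\<eta> M) m"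
      using m by (simp add: compose_def)
  qed simp_all
  show ?thesis unfolding naturally_isomorphic_to_id_def
    by (rule exI[of _ \<eta>]) (use iso nat in blast)
qed

theorem morita_equivalent_op_End:
  fixes A :: "('r, 'a) module" and X :: "('a, 'm) module" and Y :: "('a, 'n) module"
  assumes X: "left_module A X" and Y: "left_module A Y"
    and XY: "factors_through A {()} (\<lambda>_. Y) X X (\<lambda>x. x)" and YX: "factors_through A {()} (\<lambda>_. X) Y Y (\<lambda>y. y)"
  shows "morita_equivalent TYPE('u::infinite) (op_End A X) (op_End A Y)"
proof -
  obtain c1 :: "(('m \<Rightarrow> 'n) \<Rightarrow> 'u) \<Rightarrow> 'u" where F: "coded_hom A X Y c1" using ex_coded_hom[OF X Y YX] by blast
  obtain c2 :: "(('n \<Rightarrow> 'm) \<Rightarrow> 'u) \<Rightarrow> 'u" where G: "coded_hom A Y X c2" using ex_coded_hom[OF Y X XY] by blast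
  show ?thesis unfolding morita_equivalent_def
    using ring_op_End[OF X] ring_op_End[OF Y] coded_hom.functorial[OF F] coded_hom.functorial[OF G]
      round_trip_natural[OF F G XY] round_trip_natural[OF G F YX] by blast
qed

section \<open>The characteristic tilting module\<close>

lemma costandard_Ext_vanishing:
  fixes \<Delta> :: "'l::order \<Rightarrow> ('a, 'd) module" and nabla :: "'l \<Rightarrow> ('a, 'e) module"
  assumes A: "assoc_algebra R A" and \<Delta>: "\<And>l. l \<in> \<Lambda> \<Longrightarrow> left_module A (\<Delta> l)"
    and cos: "costandard_modules R A \<Lambda> \<Delta> nabla" and l: "l \<in> \<Lambda>" and m: "m \<in> \<Lambda>"
  obtains P :: "('a, nat \<Rightarrow> 'a) module" and e where "presentation A P (\<Delta> l) e" "kernel_maps_extend A P (\<Delta> l) e (nabla m)"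
proof (rule kernel_maps_extend_of_has_Ext[OF \<Delta>[OF l]])
  show "left_module A (nabla m)" using cos m by (simp add: costandard_modules_def fg_module_def)
  have "has_Ext R A (\<Delta> l) (nabla m) 1 (if (1::nat) = 0 \<and> l = m then regular_module R
         else (regular_module R)\<lparr>carrier := {\<zero>\<^bsub>R\<^esub>}\<rparr>)"
    using cos l m unfolding costandard_modules_def by blast
  then show "has_Ext R A (\<Delta> l) (nabla m) 1 ((regular_module R)\<lparr>carrier := {\<zero>\<^bsub>R\<^esub>}\<rparr>)" by simp
  show "carrier ((regular_module R)\<lparr>carrier := {\<zero>\<^bsub>R\<^esub>}\<rparr>) = {\<zero>\<^bsub>R\<^esub>}" by simp
qed (rule that)

text \<open>
  The resolutions that witness the vanishing of \<open>Ext\<^sup>1(\<Delta>(l), \<nabla>(m))\<close> may differ for different \<open>m\<close>;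
  the filtration arguments need a presentation of \<open>\<Delta>(l)\<close> that works for all \<open>m\<close>.
\<close>

lemma costandard_presentations:
  fixes \<Delta> :: "'l::order \<Rightarrow> ('a, 'd) module" and nabla :: "'l \<Rightarrow> ('a, 'e) module"
  assumes A: "assoc_algebra R A" and \<Delta>: "\<And>l. l \<in> \<Lambda> \<Longrightarrow> left_module A (\<Delta> l)"
    and cos: "costandard_modules R A \<Lambda> \<Delta> nabla"
  obtains P :: "'l \<Rightarrow> ('a, nat \<Rightarrow> 'a) module" and e
  where "\<And>l. l \<in> \<Lambda> \<Longrightarrow> presentation A (P l) (\<Delta> l) (e l)"
    and "\<And>l m. l \<in> \<Lambda> \<Longrightarrow> m \<in> \<Lambda> \<Longrightarrow> kernel_maps_extend A (P l) (\<Delta> l) (e l) (nabla m)"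
proof -
  have nabla: "left_module A (nabla m)" if "m \<in> \<Lambda>" for m
    using cos that by (simp add: costandard_modules_def fg_module_def)
  have "\<exists>Pe :: ('a, nat \<Rightarrow> 'a) module \<times> ((nat \<Rightarrow> 'a) \<Rightarrow> 'd). presentation A (fst Pe) (\<Delta> l) (snd Pe)" if l: "l \<in> \<Lambda>" for l
  proof -
    obtain P :: "('a, nat \<Rightarrow> 'a) module" and e where "presentation A P (\<Delta> l) e"
      by (rule costandard_Ext_vanishing[OF A \<Delta> cos l l]) (use that in auto)
    then have "presentation A (fst (P, e)) (\<Delta> l) (snd (P, e))" by simp
    then show ?thesis by (rule exI)
  qed
  then have "\<forall>l\<in>\<Lambda>. \<exists>Pe :: ('a, nat \<Rightarrow> 'a) module \<times> ((nat \<Rightarrow> 'a) \<Rightarrow> 'd). presentation A (fst Pe) (\<Delta> l) (snd Pe)" by blast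
  from bchoice[OF this] obtain Pe :: "'l \<Rightarrow> ('a, nat \<Rightarrow> 'a) module \<times> ((nat \<Rightarrow> 'a) \<Rightarrow> 'd)" where
    Pe: "\<forall>l\<in>\<Lambda>. presentation A (fst (Pe l)) (\<Delta> l) (snd (Pe l))" ..
  have "kernel_maps_extend A (fst (Pe l)) (\<Delta> l) (snd (Pe l)) (nabla m)" if l: "l \<in> \<Lambda>" and m: "m \<in> \<Lambda>" for l m
  proof -
    have P: "presentation A (fst (Pe l)) (\<Delta> l) (snd (Pe l))" using Pe l by blast
    obtain P' :: "('a, nat \<Rightarrow> 'a) module" and e' where
      P': "presentation A P' (\<Delta> l) e'" "kernel_maps_extend A P' (\<Delta> l) e' (nabla m)"
      by (rule costandard_Ext_vanishing[OF A \<Delta> cos l m]) (use that in auto)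
    show ?thesis
      by (rule kernel_maps_extend_change_presentation[OF P' presentationD(2)[OF P] \<Delta>[OF l] nabla[OF m] presentationD(3,4)[OF P]])
  qed
  then show ?thesis using that[of "\<lambda>l. fst (Pe l)" "\<lambda>l. snd (Pe l)"] Pe by blast
qed

theorem corollary4p10:
  fixes R :: "('r, 'z) ring_scheme"
    and A :: "('r, 'a) module"
    and \<Lambda> :: "'l::order set"
    and \<Delta> :: "'l \<Rightarrow> ('a, 'd) module"
    and nabla :: "'l \<Rightarrow> ('a, 'e) module"
    and T :: "'l \<Rightarrow> ('a, 't) module"
    and X :: "'l \<Rightarrow> ('a, 'x) module"
    and Y :: "'l \<Rightarrow> ('a, 'y) module"
    and Q :: "'l \<Rightarrow> ('a, 'q) module"
    and X' :: "'l \<Rightarrow> ('a, 'v) module"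
    and Y' :: "'l \<Rightarrow> ('a, 'w) module"
  assumes "split_quasi_hereditary R A \<Lambda> \<Delta>"
    and "costandard_modules R A \<Lambda> \<Delta> nabla"
    and "\<forall>l\<in>\<Lambda>. \<exists>f g. short_exact A (\<Delta> l) (T l) (X l) f g"
    and "\<forall>l\<in>\<Lambda>. \<exists>f g. short_exact A (Y l) (T l) (nabla l) f g"
    and "\<forall>l\<in>\<Lambda>. \<exists>f g. short_exact A (\<Delta> l) (Q l) (X' l) f g"
    and "\<forall>l\<in>\<Lambda>. \<exists>f g. short_exact A (Y' l) (Q l) (nabla l) f g"
    and "\<forall>l\<in>\<Lambda>. X l \<in> filtered A (tensor_class R A {m\<in>\<Lambda>. m < l} \<Delta>)"
    and "\<forall>l\<in>\<Lambda>. X' l \<in> filtered A (tensor_class R A {m\<in>\<Lambda>. m < l} \<Delta>)"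
    and "\<forall>l\<in>\<Lambda>. Y l \<in> filtered A (tensor_class R A {m\<in>\<Lambda>. m < l} nabla)"
    and "\<forall>l\<in>\<Lambda>. Y' l \<in> filtered A (tensor_class R A {m\<in>\<Lambda>. m < l} nabla)"
  shows "(add_closure A (direct_sum \<Lambda> T) :: ('a, 'n) module set)
           = add_closure A (direct_sum \<Lambda> Q)
       \<and> morita_equivalent TYPE('u::infinite)
           (opposite (End_algebra A (direct_sum \<Lambda> T)))
           (opposite (End_algebra A (direct_sum \<Lambda> Q)))"
proof -
  let ?\<theta> = "\<lambda>l Z. tensor_class R A {m\<in>\<Lambda>. m < l} Z"
  have A: "assoc_algebra R A" and fin: "finite \<Lambda>" and \<Delta>: "\<And>l. l \<in> \<Lambda> \<Longrightarrow> left_module A (\<Delta> l)"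
    using assms(1) by (simp_all add: split_quasi_hereditary_def projective_noetherian_algebra_def fg_module_def)
  have nabla: "\<And>m. m \<in> \<Lambda> \<Longrightarrow> left_module A (nabla m)"
    using assms(2) by (simp add: costandard_modules_def fg_module_def)
  have ring: "ring A" using A by (simp add: assoc_algebra_def)
  obtain P :: "'l \<Rightarrow> ('a, nat \<Rightarrow> 'a) module" and e where
    pres: "\<And>l. l \<in> \<Lambda> \<Longrightarrow> presentation A (P l) (\<Delta> l) (e l)" and
    ext: "\<And>l m. l \<in> \<Lambda> \<Longrightarrow> m \<in> \<Lambda> \<Longrightarrow> kernel_maps_extend A (P l) (\<Delta> l) (e l) (nabla m)"
    using costandard_presentations[OF A \<Delta> assms(2)] by blast
  have extT: "kernel_maps_extend A (P l) (\<Delta> l) (e l) (T m)"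
    and extQ: "kernel_maps_extend A (P l) (\<Delta> l) (e l) (Q m)" if l: "l \<in> \<Lambda>" and m: "m \<in> \<Lambda>" for l m
  proof -
    obtain f g where ex: "short_exact A (Y m) (T m) (nabla m) f g" using assms(4) m by blast
    show "kernel_maps_extend A (P l) (\<Delta> l) (e l) (T m)"
      by (rule kernel_maps_extend_into_costandard_filtered[where nabla = nabla and I = "{k \<in> \<Lambda>. k < m}", OF A \<Delta>[OF l] pres[OF l] nabla ext[OF l] m _ ex])
         (use assms(9) m in auto)
    obtain f g where ex: "short_exact A (Y' m) (Q m) (nabla m) f g" using assms(6) m by blast
    show "kernel_maps_extend A (P l) (\<Delta> l) (e l) (Q m)"
      by (rule kernel_maps_extend_into_costandard_filtered[where nabla = nabla and I = "{k \<in> \<Lambda>. k < m}", OF A \<Delta>[OF l] pres[OF l] nabla ext[OF l] m _ ex])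
         (use assms(10) m in auto)
  qed
  have filX: "\<exists>n F. summand_filtration A \<Lambda> \<Delta> (X l) n F" and filX': "\<exists>n F. summand_filtration A \<Lambda> \<Delta> (X' l) n F"
    if l: "l \<in> \<Lambda>" for l
  proof -
    have sub: "{m \<in> \<Lambda>. m < l} \<subseteq> \<Lambda>" by blast
    have \<Delta>': "\<And>m. m \<in> {m \<in> \<Lambda>. m < l} \<Longrightarrow> left_module A (\<Delta> m)" using \<Delta> by simp
    have X: "X l \<in> filtered A (?\<theta> l \<Delta>)" and X': "X' l \<in> filtered A (?\<theta> l \<Delta>)" using assms(7,8) l by blast+
    show "\<exists>n F. summand_filtration A \<Lambda> \<Delta> (X l) n F"
      by (rule summand_filtration_of_filtered[OF A \<Delta>' X]) (use summand_filtration_mono[OF _ sub] in blast)+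
    show "\<exists>n F. summand_filtration A \<Lambda> \<Delta> (X' l) n F"
      by (rule summand_filtration_of_filtered[OF A \<Delta>' X']) (use summand_filtration_mono[OF _ sub] in blast)+
  qed
  have sesT: "\<And>l. l \<in> \<Lambda> \<Longrightarrow> \<exists>f g. short_exact A (\<Delta> l) (T l) (X l) f g"
    and sesQ: "\<And>l. l \<in> \<Lambda> \<Longrightarrow> \<exists>f g. short_exact A (\<Delta> l) (Q l) (X' l) f g" using assms(3,5) by blast+
  have T: "left_module A (T l)" and Q: "left_module A (Q l)" if "l \<in> \<Lambda>" for l
    using sesT[OF that] sesQ[OF that] short_exactD(2) by blast+
  let ?T = "direct_sum \<Lambda> T" and ?Q = "direct_sum \<Lambda> Q"
  have TM: "left_module A ?T" and QM: "left_module A ?Q"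
    by (rule left_module_direct_sum[OF ring T], assumption) (rule left_module_direct_sum[OF ring Q])
  have TQ: "factors_through A {()} (\<lambda>_. ?Q) ?T ?T (\<lambda>x. x)"
    by (rule factors_between_direct_sums[OF ring fin T Q
          identity_factors_through_tilting[OF pres sesT sesQ filX filX' extT extQ]])
  have QT: "factors_through A {()} (\<lambda>_. ?T) ?Q ?Q (\<lambda>x. x)"
    by (rule factors_between_direct_sums[OF ring fin Q T
          identity_factors_through_tilting[OF pres sesQ sesT filX' filX extQ extT]])
  have "(add_closure A ?T :: ('a, 'n) module set) = add_closure A ?Q"
    using add_closure_mono[OF TM QM TQ] add_closure_mono[OF QM TM QT] by (rule equalityI)
  moreover have "morita_equivalent TYPE('u) (op_End A ?T) (op_End A ?Q)"
    by (rule morita_equivalent_op_End[OF TM QM TQ QT])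
  ultimately show ?thesis by blast
qed

end
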